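(* Let $A$ be a finitely presented connected differential algebra over $\mathbb{Q}$, and let $M_A\to A$ be an $i$-minimal model of $A$ obtained by the sequential generator-adding method described in the context (assumed to terminate), with generators $x^k_j$ (closed) and $y^{k-1}_j$ (with $d y^{k-1}_j=z^k_j\ne 0$). Let $M_H$ be the $i$-minimal model, obtained by the same method, of the cohomology algebra $H^*(M_A)$ with zero differential. Let $\psi:M_A\to H^*(M_A)$ be the morphism of algebras determined by $\psi(x^k_j)=[x^k_j]$ and $\psi(y^k_j)=0$. If $M_A$ satisfies the $\psi$-condition up to degree $i$, i.e. $\psi(z^k_j)=0$ for every $z^k_j$ with $k\le i+1$, and the numerical invariants of $M_A$ and $M_H$ coincide up to degree $i$, i.e. $v^l_j(M_A)=v^l_j(M_H)$ for all $1\le l\le i$ and $j\ge0$, then $\psi$ is an $i$-quasi-isomorphism.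
   Context: Differential algebra: a graded algebra $A=\bigoplus_{n\ge 0}A_n$ over $\mathbb{Q}$ with $A_mA_n\subseteq A_{m+n}$, graded commutative ($ab=(-1)^{mn}ba$ for $a\in A_m,b\in A_n$), with a linear map $d_A$ satisfying $d_A^2=0$, $d_A(A_n)\subseteq A_{n+1}$, $d_A(ab)=d_A(a)b+(-1)^m a\,d_A(b)$ for $a\in A_m$. Connected means $A_0=\mathbb{Q}$. Finitely presented means: the quotient of a free graded commutative algebra on finitely many homogeneous generators of positive degree by finitely many homogeneous relations, with the differential given on generators. Morphisms of differential algebras are algebra morphisms preserving degree and commuting with differentials. Cohomology algebras are viewed as differential algebras with zero differential. $M$ is $i$-minimal if it is freely generated (as a graded commutative algebra) by homogeneous elements $\{a_l\}_{l\in J}$ of positive degree, $J$ well-ordered, with $|a_l|\le|a_s|\le i$ for $l<s$, and $d(a_s)$ expressed in terms of the $a_l$ with $l<s$. A morphism $\phi:M\to A$ is an $i$-quasi-isomorphism if $\phi^*:H^j(M)\to H^j(A)$ is an isomorphism for all $j\le i$ and a monomorphism for $j=i+1$. An $i$-minimal model of $A$ is an $i$-minimal $M$ with an $i$-quasi-isomorphism $M\to A$. The method (up to degree $i$), applied to a differential algebra $B$ with smallest positive degree of nonzero cohomology $k_0\le i$, builds a free differential algebra $M$ and a morphism $\phi:M\to B$ by successively adding free generators. (First step) Choose cocycles in $B$ representing a basis of $H^{k_0}(B)$; for each such cocycle $a$ add a generator $x^{k_0}_j$ of degree $k_0$ with zero differential and $\phi$-image $a$. Then for $k=k_0+1,\dots,i$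 do the following two steps. ($y$-step for $k$) One iteration: choose cocycles $z^k_j\in M$ representing a basis of the kernel of the current $\phi^*_k:H^k(M)\to H^k(B)$ and $b_j\in B_{k-1}$ with $d_B(b_j)=\phi(z^k_j)$; add generators $y^{k-1}_j$ of degree $k-1$ with $dy^{k-1}_j=z^k_j$, $\phi(y^{k-1}_j)=b_j$. Repeat iterations with the updated $M$ (numbering generators consecutively) until $\phi_k^*$ is injective. ($x$-step for $k$) Choose cocycles in $B_k$ whose classes complete a basis of $\operatorname{Im}\phi_k^*$ to a basis of $H^k(B)$; for each such cocycle $a$ add a generator $x^k_j$ of degree $k$ with zero differential and $\phi$-image $a$. Finally, perform the $y$-step for $k=i+1$. Numerical invariants. For a minimal algebra $M$ with differentials $d_l:M^l\to M^{l+1}$, define recursively linear subspaces $V^l_j,W^l_j\subseteq M^l$ and subalgebras $N^l_j\subseteq M$ by: $V^0_0=\{0\}$; $N^l_j$ is the (unital) subalgebra generated by all $V^m_k$ with $m<l$, or $m=l$ and $k\le j$; $N^l_\infty=\bigcup_{k\ge0}N^l_k$; and for $l>0$, $j\ge 0$: $V^l_0=\ker d_l$, $W^l_0=\ker d_l\cap N^{l-1}_\infty$, $V^l_{j+1}=d_l^{-1}(N^l_j)$, $W^l_{j+1}=d_l^{-1}(N^l_j)\cap N^l_j$. The numerical invariants of $M$ are $v^l_j(M)=\dim(V^l_j/W^l_j)$. For $M$ produced by the method, $v^l_0$ is the number of generators $x^l_j$ and, for $j\geq 1$, $v^l_j$ is the number of generators of degree $l$ added in the $j$-th iteration of the $y$-step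 for $k=l+1$. *)

theory Defs
  imports
    "Jordan_Normal_Form.VS_Connect"
    "HOL-Algebra.QuotRing"
    "HOL-Library.Poly_Mapping"
begin

section \<open>Differential algebras\<close>

abbreviation QQ :: "rat ring"
  where "QQ \<equiv> class_ring"

record 'a dga = "(rat, 'a) module" +
  grade :: "nat \<Rightarrow> 'a set"
  dif :: "'a \<Rightarrow> 'a"

locale differential_algebra =
  fixes A :: "('a, 'z) dga_scheme" (structure)
  assumes is_ring: "ring A"
    and is_vectorspace: "vectorspace QQ A"
    and smult_mult_left:
      "\<lbrakk>x \<in> carrier A; y \<in> carrier A\<rbrakk> \<Longrightarrow> (c \<odot> x) \<otimes> y = c \<odot> (x \<otimes> y)"
    and smult_mult_right:
      "\<lbrakk>x \<in> carrier A; y \<in> carrier A\<rbrakk> \<Longrightarrow> x \<otimes> (c \<odot> y) = c \<odot> (x \<otimes> y)"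
    and grade_subspace: "VectorSpace.subspace QQ (grade A n) A"
    and grade_decomposition:
      "x \<in> carrier A \<Longrightarrow>
        \<exists>!f. (\<forall>n. f n \<in> grade A n) \<and> finite {n. f n \<noteq> \<zero>} \<and> x = (\<Oplus>n\<in>{n. f n \<noteq> \<zero>}. f n)"
    and one_grade: "\<one> \<in> grade A 0"
    and mult_grade: "\<lbrakk>x \<in> grade A m; y \<in> grade A n\<rbrakk> \<Longrightarrow> x \<otimes> y \<in> grade A (m + n)"
    and graded_commutative:
      "\<lbrakk>x \<in> grade A m; y \<in> grade A n\<rbrakk> \<Longrightarrow> x \<otimes> y = (- 1) ^ (m * n) \<odot> (y \<otimes> x)"
    and dif_linear: "dif A \<in> LinearCombinations.module_hom QQ A A"
    and dif_dif: "x \<in> carrier A \<Longrightarrow> dif A (dif A x) = \<zero>"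
    and dif_grade: "x \<in> grade A n \<Longrightarrow> dif A x \<in> grade A (Suc n)"
    and leibniz:
      "\<lbrakk>x \<in> grade A m; y \<in> carrier A\<rbrakk> \<Longrightarrow>
        dif A (x \<otimes> y) = (dif A x \<otimes> y) \<oplus> ((- 1) ^ m \<odot> (x \<otimes> dif A y))"

definition connected_dga :: "('a, 'z) dga_scheme \<Rightarrow> bool"
  where "connected_dga A \<longleftrightarrow>
    grade A 0 = range (\<lambda>c. c \<odot>\<^bsub>A\<^esub> \<one>\<^bsub>A\<^esub>) \<and> \<one>\<^bsub>A\<^esub> \<noteq> \<zero>\<^bsub>A\<^esub>"

definition alg_hom :: "('a, 'y) dga_scheme \<Rightarrow> ('b, 'z) dga_scheme \<Rightarrow> ('a \<Rightarrow> 'b) set"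
  where "alg_hom A B = Ring.ring_hom A B \<inter> LinearCombinations.module_hom QQ A B"

definition dga_hom :: "('a, 'y) dga_scheme \<Rightarrow> ('b, 'z) dga_scheme \<Rightarrow> ('a \<Rightarrow> 'b) set"
  where "dga_hom A B =
    {f \<in> alg_hom A B. (\<forall>n. f ` grade A n \<subseteq> grade B n) \<and>
      (\<forall>x\<in>carrier A. f (dif A x) = dif B (f x))}"

inductive_set subalg :: "('a, 'z) dga_scheme \<Rightarrow> 'a set \<Rightarrow> 'a set"
  for A :: "('a, 'z) dga_scheme" and S :: "'a set"
  where
    one: "\<one>\<^bsub>A\<^esub> \<in> subalg A S"
  | incl: "x \<in> S \<Longrightarrow> x \<in> subalg A S"
  | smult: "x \<in> subalg A S \<Longrightarrow> c \<odot>\<^bsub>A\<^esub> x \<in> subalg A S"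
  | add: "\<lbrakk>x \<in> subalg A S; y \<in> subalg A S\<rbrakk> \<Longrightarrow> x \<oplus>\<^bsub>A\<^esub> y \<in> subalg A S"
  | mult: "\<lbrakk>x \<in> subalg A S; y \<in> subalg A S\<rbrakk> \<Longrightarrow> x \<otimes>\<^bsub>A\<^esub> y \<in> subalg A S"

text \<open>The subalgebra generated by \<open>S\<close> with the induced structure; this is a differential algebra
  as soon as \<open>dif A\<close> maps \<open>S\<close> into it.\<close>

definition sub_dga :: "'a dga \<Rightarrow> 'a set \<Rightarrow> 'a dga"
  where "sub_dga A S = A\<lparr>carrier := subalg A S, grade := (\<lambda>n. grade A n \<inter> subalg A S)\<rparr>"


section \<open>Cohomology\<close>

text \<open>The quotient of a subspace \<open>Z\<close> by a subspace \<open>I \<subseteq> Z\<close>. The ring part is only meaningful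
  if \<open>Z\<close> is a subring and \<open>I\<close> an ideal of it.\<close>

definition quotient_module ::
    "(rat, 'a, 'z) module_scheme \<Rightarrow> 'a set \<Rightarrow> 'a set \<Rightarrow> (rat, 'a set) module"
  where "quotient_module A Z I =
    ring.extend ((A\<lparr>carrier := Z\<rparr>) Quot I)
      (module.fields (\<lambda>c X. \<Union>x\<in>X. I +>\<^bsub>A\<^esub> (c \<odot>\<^bsub>A\<^esub> x)))"

definition cocycles :: "('a, 'z) dga_scheme \<Rightarrow> 'a set"
  where "cocycles A = {x \<in> carrier A. dif A x = \<zero>\<^bsub>A\<^esub>}"

definition coboundaries :: "('a, 'z) dga_scheme \<Rightarrow> 'a set"
  where "coboundaries A = dif A ` carrier A"

definition coh_class :: "('a, 'z) dga_scheme \<Rightarrow> 'a \<Rightarrow> 'a set"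
  where "coh_class A x = coboundaries A +>\<^bsub>A\<^esub> x"

text \<open>The graded piece of degree \<open>n\<close> is the image of the cocycles of degree \<open>n\<close>.\<close>

definition cohomology :: "('a, 'z) dga_scheme \<Rightarrow> 'a set dga"
  where "cohomology A =
    module.extend (quotient_module A (cocycles A) (coboundaries A))
      (dga.fields (\<lambda>n. coh_class A ` (cocycles A \<inter> grade A n)) (\<lambda>_. coboundaries A))"

abbreviation coh :: "('a, 'z) dga_scheme \<Rightarrow> nat \<Rightarrow> 'a set set"
  where "coh A n \<equiv> grade (cohomology A) n"

definition coh_space :: "('a, 'z) dga_scheme \<Rightarrow> 'a set set \<Rightarrow> 'a set dga"
  where "coh_space A U = (cohomology A)\<lparr>carrier := U\<rparr>"

definition coh_map :: "('b, 'z) dga_scheme \<Rightarrow> ('a \<Rightarrow> 'b) \<Rightarrow> 'a set \<Rightarrow> 'b set"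
  where "coh_map B \<phi> X = the_elem ((\<lambda>x. coh_class B (\<phi> x)) ` X)"

definition quasi_iso ::
    "nat \<Rightarrow> ('a, 'y) dga_scheme \<Rightarrow> ('b, 'z) dga_scheme \<Rightarrow> ('a \<Rightarrow> 'b) \<Rightarrow> bool"
  where "quasi_iso i M A \<phi> \<longleftrightarrow>
    \<phi> \<in> dga_hom M A \<and>
    (\<forall>j\<le>i. bij_betw (coh_map A \<phi>) (coh M j) (coh A j)) \<and>
    inj_on (coh_map A \<phi>) (coh M (Suc i))"


section \<open>Presentations and free graded commutative algebras\<close>

text \<open>The free associative algebra on \<open>G\<close>: rational combinations of words over \<open>G\<close>.\<close>

definition word_algebra :: "'g set \<Rightarrow> ('g list \<Rightarrow>\<^sub>0 rat) ring"
  where "word_algebra G =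
    \<lparr>carrier = {p. Poly_Mapping.keys p \<subseteq> lists G},
     mult = (\<lambda>p q. \<Sum>u\<in>Poly_Mapping.keys p. \<Sum>v\<in>Poly_Mapping.keys q.
       Poly_Mapping.single (u @ v) (Poly_Mapping.lookup p u * Poly_Mapping.lookup q v)),
     one = Poly_Mapping.single [] 1, zero = 0, add = (+)\<rparr>"

definition homogeneous :: "('g \<Rightarrow> nat) \<Rightarrow> ('g list \<Rightarrow>\<^sub>0 rat) \<Rightarrow> bool"
  where "homogeneous deg p \<longleftrightarrow> (\<exists>n. \<forall>w\<in>Poly_Mapping.keys p. sum_list (map deg w) = n)"

definition graded_commutators :: "'g set \<Rightarrow> ('g \<Rightarrow> nat) \<Rightarrow> ('g list \<Rightarrow>\<^sub>0 rat) set"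
  where "graded_commutators G deg =
    {Poly_Mapping.single [g, h] 1 - Poly_Mapping.single [h, g] ((- 1) ^ (deg g * deg h)) | g h.
      g \<in> G \<and> h \<in> G}"

definition word_eval :: "('a, 'z) dga_scheme \<Rightarrow> ('g \<Rightarrow> 'a) \<Rightarrow> ('g list \<Rightarrow>\<^sub>0 rat) \<Rightarrow> 'a"
  where "word_eval A a p =
    (\<Oplus>\<^bsub>A\<^esub>w\<in>Poly_Mapping.keys p.
      Poly_Mapping.lookup p w \<odot>\<^bsub>A\<^esub> foldr (\<lambda>g x. a g \<otimes>\<^bsub>A\<^esub> x) w \<one>\<^bsub>A\<^esub>)"

text \<open>\<open>A\<close> is, as a graded algebra, the quotient of the free graded commutative algebra on generators
  \<open>g \<in> G\<close> of degree \<open>deg g\<close> by the relations \<open>R\<close>, with \<open>g\<close> corresponding to \<open>a g\<close>. The free graded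
  commutative algebra is the word algebra modulo the graded commutators of the generators; over
  the rationals the relation of an odd generator with itself already makes its square vanish.\<close>

definition presented_by ::
    "('a, 'z) dga_scheme \<Rightarrow> 'g set \<Rightarrow> ('g \<Rightarrow> nat) \<Rightarrow> ('g \<Rightarrow> 'a) \<Rightarrow> ('g list \<Rightarrow>\<^sub>0 rat) set \<Rightarrow> bool"
  where "presented_by A G deg a R \<longleftrightarrow>
    (\<forall>g\<in>G. a g \<in> grade A (deg g)) \<and>
    word_eval A a ` carrier (word_algebra G) = carrier A \<and>
    {p \<in> carrier (word_algebra G). word_eval A a p = \<zero>\<^bsub>A\<^esub>} =
      genideal (word_algebra G) (graded_commutators G deg \<union> R)"

definition finitely_presented :: "('a, 'z) dga_scheme \<Rightarrow> bool"
  where "finitely_presented A \<longleftrightarrow>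
    (\<exists>(n::nat) deg a R. (\<forall>g<n. 0 < deg g) \<and> finite R \<and>
      (\<forall>r\<in>R. r \<in> carrier (word_algebra {..<n}) \<and> homogeneous deg r) \<and>
      presented_by A {..<n} deg a R)"

text \<open>Generators of a free algebra are pairwise distinct elements, so a family of them is given
  by the set \<open>S\<close> of its members.\<close>

definition freely_generated :: "('a, 'z) dga_scheme \<Rightarrow> 'a set \<Rightarrow> ('a \<Rightarrow> nat) \<Rightarrow> bool"
  where "freely_generated M S deg \<longleftrightarrow> (\<forall>s\<in>S. 0 < deg s) \<and> presented_by M S deg (\<lambda>s. s) {}"


section \<open>Minimal models\<close>

definition minimal_dga :: "nat \<Rightarrow> ('a, 'z) dga_scheme \<Rightarrow> bool"
  where "minimal_dga i M \<longleftrightarrow> differential_algebra M \<and>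
    (\<exists>S deg r. freely_generated M S deg \<and> well_order_on S r \<and>
      (\<forall>s\<in>S. deg s \<le> i) \<and>
      (\<forall>l s. (l, s) \<in> r \<longrightarrow> deg l \<le> deg s) \<and>
      (\<forall>s\<in>S. dif M s \<in> subalg M {l. (l, s) \<in> r \<and> l \<noteq> s}))"

definition minimal_model ::
    "nat \<Rightarrow> ('b, 'y) dga_scheme \<Rightarrow> ('a, 'z) dga_scheme \<Rightarrow> ('a \<Rightarrow> 'b) \<Rightarrow> bool"
  where "minimal_model i B M \<phi> \<longleftrightarrow> minimal_dga i M \<and> quasi_iso i M B \<phi>"

definition basis_family :: "(rat, 'v, 'z) module_scheme \<Rightarrow> ('s \<Rightarrow> 'v) \<Rightarrow> 's set \<Rightarrow> bool"
  where "basis_family V f S \<longleftrightarrow> inj_on f S \<and> vectorspace.basis QQ V (f ` S)"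

definition positive_coh :: "('a, 'z) dga_scheme \<Rightarrow> nat \<Rightarrow> bool"
  where "positive_coh B k \<longleftrightarrow> 0 < k \<and> coh B k \<noteq> {\<zero>\<^bsub>cohomology B\<^esub>}"

definition first_degree :: "('a, 'z) dga_scheme \<Rightarrow> nat"
  where "first_degree B = (LEAST k. positive_coh B k)"

text \<open>A run of the method up to degree \<open>i\<close> on \<open>B\<close>, described inside its final result \<open>\<phi> : M \<rightarrow> B\<close>:
  \<open>X k\<close> is the set of generators added in the \<open>x\<close>-step for \<open>k\<close> (or in the first step, for
  \<open>k = first_degree B\<close>), and \<open>Y k t\<close> the set of generators, of degree \<open>k - 1\<close>, added in the
  iteration number \<open>t\<close> of the \<open>y\<close>-step for \<open>k\<close>, counted from \<open>0\<close>. An intermediate algebra is the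
  subalgebra generated by the generators added so far. In a \<open>y\<close>-step the cocycles \<open>z\<close> are the
  elements \<open>dif M y\<close>, and the elements \<open>b\<close> are the \<open>\<phi> y\<close>. Iterations continue formally after
  \<open>\<phi>\<^sup>*\<close> has become injective, but then add nothing.\<close>

definition gens_below :: "(nat \<Rightarrow> 'm set) \<Rightarrow> (nat \<Rightarrow> nat \<Rightarrow> 'm set) \<Rightarrow> nat \<Rightarrow> 'm set"
  where "gens_below X Y k = (\<Union>m<k. X m) \<union> (\<Union>m<k. \<Union>t. Y m t)"

definition y_stage :: "'m dga \<Rightarrow> (nat \<Rightarrow> 'm set) \<Rightarrow> (nat \<Rightarrow> nat \<Rightarrow> 'm set) \<Rightarrow> nat \<Rightarrow> nat \<Rightarrow> 'm dga"
  where "y_stage M X Y k t = sub_dga M (gens_below X Y k \<union> (\<Union>s<t. Y k s))"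

definition x_stage :: "'m dga \<Rightarrow> (nat \<Rightarrow> 'm set) \<Rightarrow> (nat \<Rightarrow> nat \<Rightarrow> 'm set) \<Rightarrow> nat \<Rightarrow> 'm dga"
  where "x_stage M X Y k = sub_dga M (gens_below X Y k \<union> (\<Union>t. Y k t))"

definition coh_kernel ::
    "('m, 'y) dga_scheme \<Rightarrow> ('b, 'z) dga_scheme \<Rightarrow> ('m \<Rightarrow> 'b) \<Rightarrow> nat \<Rightarrow> 'm set set"
  where "coh_kernel N B \<phi> k = {c \<in> coh N k. coh_map B \<phi> c = \<zero>\<^bsub>cohomology B\<^esub>}"

locale method_run =
  fixes i :: nat
    and B :: "'b dga"
    and M :: "'m dga"
    and \<phi> :: "'m \<Rightarrow> 'b"
    and X :: "nat \<Rightarrow> 'm set"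
    and Y :: "nat \<Rightarrow> nat \<Rightarrow> 'm set"
  assumes applicable: "\<exists>k\<le>i. positive_coh B k"
    and dga_M: "differential_algebra M"
    and phi_hom: "\<phi> \<in> dga_hom M B"
    and free: "\<exists>deg. freely_generated M ((\<Union>k. X k) \<union> (\<Union>k t. Y k t)) deg"
    and X_range: "X k \<noteq> {} \<Longrightarrow> k \<in> {first_degree B..i}"
    and Y_range: "Y k t \<noteq> {} \<Longrightarrow> k \<in> {Suc (first_degree B)..Suc i}"
    and X_grade: "X k \<subseteq> grade M k"
    and Y_grade: "Y k t \<subseteq> grade M (k - 1)"
    and X_closed: "x \<in> X k \<Longrightarrow> dif M x = \<zero>\<^bsub>M\<^esub>"
    and first_step:
      "k = first_degree B \<Longrightarrow>
        basis_family (coh_space B (coh B k)) (\<lambda>x. coh_class B (\<phi> x)) (X k)"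
    and y_step_cocycles:
      "\<lbrakk>k \<in> {Suc (first_degree B)..Suc i}; y \<in> Y k t\<rbrakk> \<Longrightarrow>
        dif M y \<in> carrier (y_stage M X Y k t)"
    and y_step_basis:
      "\<lbrakk>k \<in> {Suc (first_degree B)..Suc i}; N = y_stage M X Y k t\<rbrakk> \<Longrightarrow>
        basis_family (coh_space N (coh_kernel N B \<phi> k)) (\<lambda>y. coh_class N (dif M y)) (Y k t)"
    and y_step_terminates:
      "k \<in> {Suc (first_degree B)..Suc i} \<Longrightarrow>
        \<exists>t. inj_on (coh_map B \<phi>) (coh (y_stage M X Y k t) k)"
    and x_step:
      "\<lbrakk>k \<in> {Suc (first_degree B)..i}; N = x_stage M X Y k\<rbrakk> \<Longrightarrow>
        \<exists>C. vectorspace.basis QQ (coh_space B (coh_map B \<phi> ` coh N k)) C \<and>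
          C \<inter> (\<lambda>x. coh_class B (\<phi> x)) ` X k = {} \<and>
          inj_on (\<lambda>x. coh_class B (\<phi> x)) (X k) \<and>
          vectorspace.basis QQ (coh_space B (coh B k)) (C \<union> (\<lambda>x. coh_class B (\<phi> x)) ` X k)"


section \<open>Numerical invariants\<close>

function Vsub :: "('m, 'z) dga_scheme \<Rightarrow> nat \<Rightarrow> nat \<Rightarrow> 'm set"
  and Nsub :: "('m, 'z) dga_scheme \<Rightarrow> nat \<Rightarrow> nat \<Rightarrow> 'm set"
  where
    "Vsub M 0 j = {\<zero>\<^bsub>M\<^esub>}"
  | "Vsub M (Suc l) 0 = {x \<in> grade M (Suc l). dif M x = \<zero>\<^bsub>M\<^esub>}"
  | "Vsub M (Suc l) (Suc j) = {x \<in> grade M (Suc l). dif M x \<in> Nsub M (Suc l) j}"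
  | "Nsub M l j = subalg M ((\<Union>m\<in>{..<l}. \<Union>k. Vsub M m k) \<union> (\<Union>k\<in>{..j}. Vsub M l k))"
  by pat_completeness auto
termination
  by (relation "inv_image (less_than <*lex*> less_than <*lex*> less_than)
      (\<lambda>s. case s of Inl (M, l, j) \<Rightarrow> (l, j, 0) | Inr (M, l, j) \<Rightarrow> (l, j, 1))") auto

definition Ninf :: "('m, 'z) dga_scheme \<Rightarrow> nat \<Rightarrow> 'm set"
  where "Ninf M l = (\<Union>k. Nsub M l k)"

text \<open>Only meaningful for \<open>l > 0\<close>.\<close>

fun Wsub :: "('m, 'z) dga_scheme \<Rightarrow> nat \<Rightarrow> nat \<Rightarrow> 'm set"
  where
    "Wsub M l 0 = Vsub M l 0 \<inter> Ninf M (l - 1)"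
  | "Wsub M l (Suc j) = Vsub M l (Suc j) \<inter> Nsub M l j"

definition num_inv :: "('m, 'z) dga_scheme \<Rightarrow> nat \<Rightarrow> nat \<Rightarrow> nat"
  where "num_inv M l j = vectorspace.dim QQ (quotient_module M (Vsub M l j) (Wsub M l j))"

end

theory Submission
  imports Defs
begin

text \<open>The morphism \<open>\<psi>\<close> commutes with the differentials because it kills all \<open>dif MA y\<close>. As \<open>H = cohomology MA\<close>
  has zero differential, \<open>\<phi>H\<close> is itself surjective in degrees up to \<open>i\<close>, so \<open>\<psi>\<close> lifts generator by
  generator to a morphism \<open>f : MA \<rightarrow> MH\<close> with \<open>\<phi>H \<circ> f = \<psi>\<close> strictly, without homotopies. It then suffices
  that \<open>f\<close> is bijective. This is shown along the stages of the method, which are the subalgebras \<open>Nsub l j\<close>.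
  If \<open>f\<close> is bijective on a stage, then it induces an injection between the spaces \<open>V/W\<close> of the next
  stage: in positive filtration because all cocycles of degree \<open>l\<close> already lie in the stage, and for
  closed generators because \<open>\<psi> x = [x]\<close> while \<open>\<psi>\<close> maps the old stage to classes of that stage. All these
  spaces are finite dimensional, so equality of the numerical invariants makes the injection
  bijective. Since \<open>MH\<close> is free, \<open>f\<close> then has a section over the new stage, which is forced to be its
  inverse.\<close>

section \<open>Rational vector spaces\<close>

text \<open>The invariants are intrinsic, while the stages depend on choices made during a run. They
  meet because \<open>Nsub M l j\<close> equals \<open>subalg M (T (Suc l) j)\<close>; the shift
  from \<open>l\<close> to \<open>Suc l\<close> occurs because generators of degree \<open>l\<close>
  come from the \<open>x\<close>-step for \<open>l\<close> and from the \<open>y\<close>-step for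
  \<open>l + 1\<close>. This equality rests on the location of cocycles: an exact element of degree
  \<open>l\<close> is the differential of an element of degree \<open>l - 1\<close>, and all of that
  degree is present before the \<open>x\<close>-step for \<open>l\<close>. Injectivity of the model
  map on cohomology then puts every cocycle of degree \<open>l\<close> into the span of
  \<open>X l\<close> and the earlier stage. The obstacle to comparing the models is that
  \<open>f\<close> need not carry generators to generators. Only subalgebras can be compared, and
  surjectivity comes from counting dimensions. A dimension is informative only in the
  finite-dimensional case; finite presentation of \<open>A\<close> provides it, since every degree
  of \<open>A\<close> and then of each stage of both models is finite-dimensional. At the end
  \<open>\<psi>\<close> is \<open>\<phi>H\<close> composed with an isomorphism.\<close>

locale rat_space = abelian_group V for V :: "(rat, 'v, 'z) module_scheme" (structure) +
  assumes smult_closed [simp, intro]: "x \<in> carrier V \<Longrightarrow> c \<odot> x \<in> carrier V"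
    and smult_add_left: "x \<in> carrier V \<Longrightarrow> (a + b) \<odot> x = a \<odot> x \<oplus> b \<odot> x"
    and smult_add_right: "\<lbrakk>x \<in> carrier V; y \<in> carrier V\<rbrakk> \<Longrightarrow> c \<odot> (x \<oplus> y) = c \<odot> x \<oplus> c \<odot> y"
    and smult_smult: "x \<in> carrier V \<Longrightarrow> a \<odot> (b \<odot> x) = (a * b) \<odot> x"
    and smult_one [simp]: "x \<in> carrier V \<Longrightarrow> 1 \<odot> x = x"

text \<open>\<open>rat_space\<close> is the same notion without the scalar field as a second
  structure, so its rules carry no membership conditions on scalars. This equivalence gives access
  to bases and dimensions.\<close>

lemma rat_space_iff: "rat_space V \<longleftrightarrow> vectorspace QQ V"
proof
  assume "rat_space V"
  then interpret rat_space V .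
  interpret QQ: field QQ by (rule class_field)
  show "vectorspace QQ V"
    by unfold_locales (auto simp: smult_add_left smult_add_right smult_smult)
next
  assume "vectorspace QQ V"
  then interpret vectorspace QQ V .
  show "rat_space V"
    using smult_l_distr smult_r_distr smult_assoc1 smult_closed smult_one
    by unfold_locales auto
qed

context rat_space
begin

lemma smult_zero_left [simp]: "x \<in> carrier V \<Longrightarrow> 0 \<odot> x = \<zero>"
  using smult_add_left[of x 0 0] by (metis add_0 smult_closed add.l_cancel_one')

lemma smult_zero_right [simp]: "c \<odot> \<zero> = \<zero>"
  using smult_smult[of \<zero> c 0] smult_zero_left[of \<zero>] by simp

lemma smult_minus_one: "x \<in> carrier V \<Longrightarrow> (- 1) \<odot> x = \<ominus> x"
  using smult_add_left[of x "-1" 1]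
  by (metis add.left_inverse minus_equality smult_closed smult_one smult_zero_left)

lemma minus_eq_add_smult: "\<lbrakk>x \<in> carrier V; y \<in> carrier V\<rbrakk> \<Longrightarrow> x \<ominus> y = x \<oplus> (- 1) \<odot> y"
  by (simp add: a_minus_def smult_minus_one)

lemma smult_minus [simp]: "x \<in> carrier V \<Longrightarrow> c \<odot> (\<ominus> x) = \<ominus> (c \<odot> x)"
  by (metis minus_equality l_neg a_inv_closed smult_add_right smult_closed smult_zero_right)

lemma smult_eq_zero_iff: "x \<in> carrier V \<Longrightarrow> c \<odot> x = \<zero> \<longleftrightarrow> c = 0 \<or> x = \<zero>"
  using smult_smult[of x "inverse c" c] by (cases "c = 0") auto

lemma minus_add_cancel: "\<lbrakk>x \<in> carrier V; y \<in> carrier V\<rbrakk> \<Longrightarrow> (x \<ominus> y) \<oplus> y = x"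
  by (simp add: a_minus_def a_assoc l_neg)

lemma minus_zero_right [simp]: "x \<in> carrier V \<Longrightarrow> x \<ominus> \<zero> = x"
  by (simp add: minus_eq_add_smult)

lemma minus_self [simp]: "x \<in> carrier V \<Longrightarrow> x \<ominus> x = \<zero>"
  by (simp add: a_minus_def r_neg)

lemma add_minus_cancel_left: "\<lbrakk>x \<in> carrier V; y \<in> carrier V\<rbrakk> \<Longrightarrow> (x \<oplus> y) \<ominus> x = y"
  by (simp add: a_minus_def a_comm[of x y] a_assoc r_neg)

lemma minus_trans:
  "\<lbrakk>x \<in> carrier V; y \<in> carrier V; z \<in> carrier V\<rbrakk> \<Longrightarrow> (x \<ominus> y) \<oplus> (y \<ominus> z) = x \<ominus> z"
  by (simp add: a_minus_def a_assoc r_neg1 r_neg2)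

lemma minus_swap: "\<lbrakk>x \<in> carrier V; y \<in> carrier V\<rbrakk> \<Longrightarrow> \<ominus> (x \<ominus> y) = y \<ominus> x"
  by (simp add: a_minus_def minus_add a_comm)

lemma eq_iff_minus_zero: "\<lbrakk>x \<in> carrier V; y \<in> carrier V\<rbrakk> \<Longrightarrow> x = y \<longleftrightarrow> x \<ominus> y = \<zero>"
  by (metis minus_add_cancel l_zero a_minus_def r_neg)

abbreviation subsp :: "'v set \<Rightarrow> bool"
  where "subsp W \<equiv> VectorSpace.subspace QQ W V"

lemma subsp_iff:
  "subsp W \<longleftrightarrow> W \<subseteq> carrier V \<and> \<zero> \<in> W \<and> (\<forall>x\<in>W. \<forall>y\<in>W. x \<oplus> y \<in> W) \<and> (\<forall>c. \<forall>x\<in>W. c \<odot> x \<in> W)"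
  using rat_space_axioms
  by (auto simp: VectorSpace.subspace_def submodule_def rat_space_iff vectorspace_def)

lemma subspI:
  assumes "W \<subseteq> carrier V" "\<zero> \<in> W" "\<And>x y. \<lbrakk>x \<in> W; y \<in> W\<rbrakk> \<Longrightarrow> x \<oplus> y \<in> W"
    "\<And>c x. x \<in> W \<Longrightarrow> c \<odot> x \<in> W"
  shows "subsp W"
  using assms by (simp add: subsp_iff)

lemma subspD:
  assumes "subsp W"
  shows "x \<in> W \<Longrightarrow> x \<in> carrier V" "\<zero> \<in> W" "\<lbrakk>x \<in> W; y \<in> W\<rbrakk> \<Longrightarrow> x \<oplus> y \<in> W"
    "x \<in> W \<Longrightarrow> c \<odot> x \<in> W" "x \<in> W \<Longrightarrow> \<ominus> x \<in> W" "\<lbrakk>x \<in> W; y \<in> W\<rbrakk> \<Longrightarrow> x \<ominus> y \<in> W"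
  using assms by (auto simp: subsp_iff smult_minus_one[symmetric] minus_eq_add_smult subset_eq)

lemma subsp_Int: "\<lbrakk>subsp U; subsp W\<rbrakk> \<Longrightarrow> subsp (U \<inter> W)"
  by (auto simp: subsp_iff)

lemma subsp_carrier: "subsp (carrier V)"
  by (simp add: subsp_iff)

lemma rat_space_subsp: "subsp W \<Longrightarrow> rat_space (V\<lparr>carrier := W\<rparr>)"
  using rat_space_axioms unfolding rat_space_iff
  by (rule vectorspace.subspace_is_vs)

lemma finsum_in_subsp:
  assumes "subsp W" "\<And>n. n \<in> F \<Longrightarrow> f n \<in> W"
  shows "(\<Oplus>n\<in>F. f n) \<in> W"
  using assms(2)
proof (induction F rule: infinite_finite_induct)
  case (insert a F)
  then have "f \<in> F \<rightarrow> carrier V" "f a \<in> carrier V" using subspD(1)[OF assms(1)] by auto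
  with insert show ?case using subspD(3)[OF assms(1)] by simp
qed (use subspD(2)[OF assms(1)] in auto)

end

text \<open>An inductive span supports rule induction and never looks at the carrier, so a span
  inside a subspace is literally the span in the whole space.\<close>

inductive_set lspan :: "(rat, 'v, 'z) module_scheme \<Rightarrow> 'v set \<Rightarrow> 'v set"
  for V :: "(rat, 'v, 'z) module_scheme" and S :: "'v set"
  where
    zero: "\<zero>\<^bsub>V\<^esub> \<in> lspan V S"
  | incl: "x \<in> S \<Longrightarrow> x \<in> lspan V S"
  | smult: "x \<in> lspan V S \<Longrightarrow> c \<odot>\<^bsub>V\<^esub> x \<in> lspan V S"
  | add: "\<lbrakk>x \<in> lspan V S; y \<in> lspan V S\<rbrakk> \<Longrightarrow> x \<oplus>\<^bsub>V\<^esub> y \<in> lspan V S"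

lemma lspan_carrier_update: "lspan (V\<lparr>carrier := C\<rparr>) S = lspan V S"
proof (intro Set.set_eqI iffI)
  fix x
  show "x \<in> lspan V S" if "x \<in> lspan (V\<lparr>carrier := C\<rparr>) S"
    using that by induction (auto intro: lspan.intros)
  show "x \<in> lspan (V\<lparr>carrier := C\<rparr>) S" if "x \<in> lspan V S"
    using that
  proof induction
    case zero then show ?case using lspan.zero[of "V\<lparr>carrier := C\<rparr>" S] by simp
  next
    case (smult x c) then show ?case using lspan.smult[of x "V\<lparr>carrier := C\<rparr>" S c] by simp
  next
    case (add x y) then show ?case using lspan.add[of x "V\<lparr>carrier := C\<rparr>" S y] by simp
  qed (auto intro: lspan.incl)
qed

lemma lspan_mono: "S \<subseteq> T \<Longrightarrow> lspan V S \<subseteq> lspan V T"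
proof
  fix x assume "S \<subseteq> T" "x \<in> lspan V S"
  from this(2,1) show "x \<in> lspan V T" by induction (auto intro: lspan.intros)
qed

lemma lspan_subset_lspan: "S \<subseteq> lspan V T \<Longrightarrow> lspan V S \<subseteq> lspan V T"
proof
  fix x assume "S \<subseteq> lspan V T" "x \<in> lspan V S"
  from this(2,1) show "x \<in> lspan V T" by induction (auto intro: lspan.intros)
qed

context rat_space
begin

lemma lspan_least: "\<lbrakk>S \<subseteq> W; subsp W\<rbrakk> \<Longrightarrow> lspan V S \<subseteq> W"
proof
  fix x assume "S \<subseteq> W" "subsp W" "x \<in> lspan V S"
  from this(3,1,2) show "x \<in> W" by induction (auto simp: subspD)
qed

lemma lspan_closed: "\<lbrakk>x \<in> lspan V S; S \<subseteq> carrier V\<rbrakk> \<Longrightarrow> x \<in> carrier V"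
  using lspan_least[OF _ subsp_carrier] by blast

lemma subsp_lspan: "S \<subseteq> carrier V \<Longrightarrow> subsp (lspan V S)"
  by (intro subspI) (auto intro: lspan.intros lspan_closed)

lemma span_eq_lspan:
  assumes "S \<subseteq> carrier V"
  shows "LinearCombinations.module.span QQ V S = lspan V S"
proof
  interpret vs: vectorspace QQ V using rat_space_axioms by (simp add: rat_space_iff)
  show "vs.span S \<subseteq> lspan V S"
  proof
    fix x assume "x \<in> vs.span S"
    then obtain a F where F: "finite F" "F \<subseteq> S" "x = vs.lincomb a F"
      by (auto simp: vs.span_def)
    have "(\<Oplus>v\<in>F. a v \<odot> v) \<in> lspan V S"
      using F(2) by (intro finsum_in_subsp subsp_lspan assms) (auto intro: lspan.intros)
    then show "x \<in> lspan V S" by (simp add: F(3) vs.lincomb_def)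
  qed
  show "lspan V S \<subseteq> vs.span S"
    using assms by (intro lspan_least vs.span_is_subspace vs.in_own_span)
qed

lemma lspan_Un_subsp:
  assumes "x \<in> lspan V (S \<union> W)" "subsp W" "S \<subseteq> carrier V"
  shows "\<exists>s\<in>lspan V S. \<exists>w\<in>W. x = s \<oplus> w"
  using assms(1)
proof induction
  case zero
  then show ?case by (intro bexI[of _ \<zero>]) (auto intro: lspan.zero subspD[OF assms(2)])
next
  case (incl x)
  then show ?case
  proof
    assume "x \<in> S"
    then show ?thesis
      using assms(3) by (intro bexI[of _ x] bexI[of _ \<zero>]) (auto intro: lspan.incl subspD[OF assms(2)])
  next
    assume "x \<in> W"
    then show ?thesis
      using subspD(1)[OF assms(2)] by (intro bexI[of _ \<zero>] bexI[of _ x]) (auto intro: lspan.zero)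
  qed
next
  case (smult x c)
  then obtain s w where *: "s \<in> lspan V S" "w \<in> W" "x = s \<oplus> w" by blast
  then have "c \<odot> x = c \<odot> s \<oplus> c \<odot> w"
    using lspan_closed[OF *(1) assms(3)] subspD(1)[OF assms(2)] by (simp add: smult_add_right)
  with * show ?case by (meson lspan.smult subspD(4)[OF assms(2)])
next
  case (add x y)
  then obtain s w s' w' where *: "s \<in> lspan V S" "w \<in> W" "x = s \<oplus> w"
     "s' \<in> lspan V S" "w' \<in> W" "y = s' \<oplus> w'" by blast
  have "s \<in> carrier V" "s' \<in> carrier V" "w \<in> carrier V" "w' \<in> carrier V"
    using * lspan_closed[OF _ assms(3)] subspD(1)[OF assms(2)] by auto
  then have "x \<oplus> y = (s \<oplus> s') \<oplus> (w \<oplus> w')"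
    using * by (simp add: a_ac)
  with * show ?case by (meson lspan.add subspD(3)[OF assms(2)])
qed

end

section \<open>Linear maps and transport of structure\<close>

abbreviation linear :: "(rat, 'v, 'y) module_scheme \<Rightarrow> (rat, 'w, 'z) module_scheme \<Rightarrow> ('v \<Rightarrow> 'w) \<Rightarrow> bool"
  where "linear V W f \<equiv> f \<in> LinearCombinations.module_hom QQ V W"

lemma linear_iff:
  "linear V W f \<longleftrightarrow> f \<in> carrier V \<rightarrow> carrier W \<and>
    (\<forall>x\<in>carrier V. \<forall>y\<in>carrier V. f (x \<oplus>\<^bsub>V\<^esub> y) = f x \<oplus>\<^bsub>W\<^esub> f y) \<and>
    (\<forall>c. \<forall>x\<in>carrier V. f (c \<odot>\<^bsub>V\<^esub> x) = c \<odot>\<^bsub>W\<^esub> f x)"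
  by (auto simp: LinearCombinations.module_hom_def)

locale rat_linear = V: rat_space V + W: rat_space W
  for V :: "(rat, 'v, 'y) module_scheme" (structure)
    and W :: "(rat, 'w, 'z) module_scheme" (structure) +
  fixes f :: "'v \<Rightarrow> 'w"
  assumes linear: "linear V W f"
begin

lemma closed [simp]: "x \<in> carrier V \<Longrightarrow> f x \<in> carrier W"
  using linear by (auto simp: linear_iff)

lemma add [simp]: "\<lbrakk>x \<in> carrier V; y \<in> carrier V\<rbrakk> \<Longrightarrow> f (x \<oplus>\<^bsub>V\<^esub> y) = f x \<oplus>\<^bsub>W\<^esub> f y"
  using linear by (auto simp: linear_iff)

lemma smult [simp]: "x \<in> carrier V \<Longrightarrow> f (c \<odot>\<^bsub>V\<^esub> x) = c \<odot>\<^bsub>W\<^esub> f x"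
  using linear by (auto simp: linear_iff)

lemma zero [simp]: "f \<zero>\<^bsub>V\<^esub> = \<zero>\<^bsub>W\<^esub>"
  using smult[of "\<zero>\<^bsub>V\<^esub>" 0] by simp

lemma minus [simp]: "\<lbrakk>x \<in> carrier V; y \<in> carrier V\<rbrakk> \<Longrightarrow> f (x \<ominus>\<^bsub>V\<^esub> y) = f x \<ominus>\<^bsub>W\<^esub> f y"
  by (simp add: V.minus_eq_add_smult W.minus_eq_add_smult)

lemma finsum:
  "g \<in> F \<rightarrow> carrier V \<Longrightarrow> f (\<Oplus>\<^bsub>V\<^esub>n\<in>F. g n) = (\<Oplus>\<^bsub>W\<^esub>n\<in>F. f (g n))"
proof (induction F rule: infinite_finite_induct)
  case (insert a F)
  then have "g a \<in> carrier V" "g \<in> F \<rightarrow> carrier V" by auto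
  with insert show ?case by (simp add: Pi_iff)
qed simp_all

lemma lspan_image:
  assumes "S \<subseteq> carrier V"
  shows "lspan W (f ` S) = f ` lspan V S"
proof (intro Set.set_eqI iffI)
  fix y assume "y \<in> lspan W (f ` S)"
  then show "y \<in> f ` lspan V S"
  proof induction
    case zero
    then show ?case using lspan.zero[of V S] by force
  next
    case (incl x)
    then show ?case by (auto intro: lspan.incl)
  next
    case (smult y c)
    then obtain x where "x \<in> lspan V S" "y = f x" by blast
    then show ?case using V.lspan_closed[OF _ assms] by (intro image_eqI[of _ _ "c \<odot>\<^bsub>V\<^esub> x"]) (auto intro: lspan.smult)
  next
    case (add y y')
    then obtain x x' where "x \<in> lspan V S" "y = f x" "x' \<in> lspan V S" "y' = f x'" by blast
    then show ?case using V.lspan_closed[OF _ assms]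
      by (intro image_eqI[of _ _ "x \<oplus>\<^bsub>V\<^esub> x'"]) (auto intro: lspan.add)
  qed
next
  fix y assume "y \<in> f ` lspan V S"
  then obtain x where x: "x \<in> lspan V S" and y: "y = f x" by blast
  from x have "x \<in> carrier V \<and> f x \<in> lspan W (f ` S)"
    by induction (use assms in \<open>auto intro: lspan.intros\<close>)
  with y show "y \<in> lspan W (f ` S)" by simp
qed

lemma subsp_vimage:
  assumes "V.subsp U" "W.subsp U'"
  shows "V.subsp {x \<in> U. f x \<in> U'}"
  using assms V.subspD[OF assms(1)] W.subspD[OF assms(2)] by (intro V.subspI) auto

lemma subsp_image:
  assumes "V.subsp U"
  shows "W.subsp (f ` U)"
proof (rule W.subspI)
  note U = V.subspD[OF assms]
  show "f ` U \<subseteq> carrier W" using U(1) by auto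
  show "\<zero>\<^bsub>W\<^esub> \<in> f ` U" using U(2) by (metis image_eqI zero)
  show "x \<oplus>\<^bsub>W\<^esub> y \<in> f ` U" if "x \<in> f ` U" "y \<in> f ` U" for x y
    using that U(1,3) by (auto simp: image_iff simp flip: add)
  show "c \<odot>\<^bsub>W\<^esub> x \<in> f ` U" if "x \<in> f ` U" for c x
    using that U(1,4) by (auto simp: image_iff simp flip: smult)
qed

end

text \<open>Every element of \<open>W\<close> has a preimage, so each axiom is pulled back to
  \<open>V\<close>. The rule serves quotients and cohomology (with the class map) as well as
  subalgebras (with the identity).\<close>

lemma rat_space_surj_image:
  assumes "rat_space V" "f ` carrier V = carrier W"
    and "\<And>x y. \<lbrakk>x \<in> carrier V; y \<in> carrier V\<rbrakk> \<Longrightarrow> f x \<oplus>\<^bsub>W\<^esub> f y = f (x \<oplus>\<^bsub>V\<^esub> y)"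
    and "\<And>c x. x \<in> carrier V \<Longrightarrow> c \<odot>\<^bsub>W\<^esub> f x = f (c \<odot>\<^bsub>V\<^esub> x)"
    and "\<zero>\<^bsub>W\<^esub> = f \<zero>\<^bsub>V\<^esub>"
  shows "rat_space W"
proof -
  interpret V: rat_space V by fact
  note hom = assms(3-5)
  show ?thesis
  proof (intro rat_space.intro rat_space_axioms.intro abelian_groupI; unfold assms(2)[symmetric])
    show "\<exists>y\<in>f ` carrier V. y \<oplus>\<^bsub>W\<^esub> x = \<zero>\<^bsub>W\<^esub>" if x: "x \<in> f ` carrier V" for x
    proof -
      obtain v where "v \<in> carrier V" "x = f v" using x by blast
      then show ?thesis
        by (intro bexI[of _ "f (\<ominus>\<^bsub>V\<^esub> v)"]) (simp_all add: hom V.l_neg)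
    qed
  qed (auto simp: hom V.a_ac V.smult_add_left V.smult_add_right V.smult_smult)
qed

section \<open>Finite-dimensional spaces and quotients\<close>

text \<open>Finite dimension of a subset relative to the ambient space: \<open>U\<close> need not be
  the carrier of a structure of its own.\<close>

definition finite_span :: "(rat, 'v, 'z) module_scheme \<Rightarrow> 'v set \<Rightarrow> bool"
  where "finite_span V U \<longleftrightarrow> (\<exists>F. finite F \<and> F \<subseteq> U \<and> U \<subseteq> lspan V F)"

lemma (in rat_space) fin_dim_if_finite_span:
  assumes "finite_span V (carrier V)"
  shows "vectorspace.fin_dim QQ V"
proof -
  interpret vs: vectorspace QQ V using rat_space_axioms by (simp add: rat_space_iff)
  obtain F where F: "finite F" "F \<subseteq> carrier V" "carrier V \<subseteq> lspan V F"
    using assms by (auto simp: finite_span_def)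
  then have "vs.span F = carrier V"
    using span_eq_lspan[OF F(2)] lspan_least[OF F(2) subsp_carrier] by auto
  with F show ?thesis unfolding vs.fin_dim_def by blast
qed

text \<open>The image of a basis is independent and has as many elements as the dimension of the
  target, hence is a basis of it.\<close>

lemma (in linear_map) inj_imp_surj_if_dim_eq:
  assumes fdV: "V.fin_dim" and fdW: "W.fin_dim" and dim: "V.dim = W.dim"
    and inj: "inj_on T (carrier V)"
  shows "T ` carrier V = carrier W"
proof -
  obtain \<beta> where \<beta>: "finite \<beta>" "V.basis \<beta>" using V.finite_basis_exists fdV by blast
  have \<beta>V: "\<beta> \<subseteq> carrier V" "V.module.lin_indpt \<beta>" using \<beta>(2) unfolding V.basis_def by auto
  have \<beta>W: "T ` \<beta> \<subseteq> carrier W" using \<beta>V(1) by auto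
  have ind: "W.module.lin_indpt (T ` \<beta>)"
  proof (rule W.module.finite_lin_indpt2)
    fix a
    assume a: "a \<in> T ` \<beta> \<rightarrow> carrier K" and 0: "W.module.lincomb a (T ` \<beta>) = \<zero>\<^bsub>W\<^esub>"
    have aT: "a \<circ> T \<in> \<beta> \<rightarrow> carrier K" using a by auto
    have "T (V.module.lincomb (a \<circ> T) \<beta>) = T \<zero>\<^bsub>V\<^esub>"
      using lincomb_linear_image[OF inj \<beta>V(1) a \<beta>(1)] 0 f0_is_0 by argo
    then have "V.module.lincomb (a \<circ> T) \<beta> = \<zero>\<^bsub>V\<^esub>"
      using inj V.module.lincomb_closed[OF \<beta>V(1) aT] V.module.M.zero_closed by (meson inj_onD)
    then have "(a \<circ> T) \<in> \<beta> \<rightarrow> {\<zero>\<^bsub>K\<^esub>}"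
      using V.not_lindepD[OF \<beta>V(2) \<beta>(1) order_refl aT] by blast
    then show "\<forall>v\<in>T ` \<beta>. a v = \<zero>\<^bsub>K\<^esub>" by auto
  qed (use \<beta>(1) \<beta>W in auto)
  have "card (T ` \<beta>) = W.dim"
    using dim V.dim_basis[OF \<beta>] card_image[OF inj_on_subset[OF inj \<beta>V(1)]] by argo
  then have "W.basis (T ` \<beta>)"
    using W.dim_li_is_basis[OF fdW finite_imageI[OF \<beta>(1)] \<beta>W ind] by simp
  then have span: "W.module.span (T ` \<beta>) = carrier W"
    unfolding W.basis_def by blast
  have "T ` \<beta> \<subseteq> imT" using \<beta>V(1) by (auto simp: im_def)
  then have "W.module.span (T ` \<beta>) \<subseteq> imT"
    by (intro W.module.span_is_subset im_is_submodule)
  with span show ?thesis by (auto simp: im_def)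
qed

lemma (in rat_linear) inj_eq_dim_imp_surj:
  assumes "finite_span V (carrier V)" "finite_span W (carrier W)"
    and "vectorspace.dim QQ V = vectorspace.dim QQ W"
    and inj: "\<And>x. \<lbrakk>x \<in> carrier V; f x = \<zero>\<^bsub>W\<^esub>\<rbrakk> \<Longrightarrow> x = \<zero>\<^bsub>V\<^esub>"
  shows "f ` carrier V = carrier W"
proof (rule linear_map.inj_imp_surj_if_dim_eq)
  show "linear_map QQ V W f"
    using V.rat_space_axioms W.rat_space_axioms linear
    unfolding rat_space_iff linear_map_def mod_hom_def vectorspace_def mod_hom_axioms_def by blast
  show "inj_on f (carrier V)"
  proof (rule inj_onI)
    fix x y assume xy: "x \<in> carrier V" "y \<in> carrier V" "f x = f y"
    then have "x \<ominus>\<^bsub>V\<^esub> y = \<zero>\<^bsub>V\<^esub>"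
      by (intro inj) (simp_all add: a_minus_def[of W] W.r_neg)
    then show "x = y" using V.eq_iff_minus_zero[OF xy(1,2)] by blast
  qed
qed (use assms V.fin_dim_if_finite_span W.fin_dim_if_finite_span in auto)

lemma (in rat_space) finite_basis_if_finite_span:
  assumes "subsp U" "finite_span V U" "vectorspace.basis QQ (V\<lparr>carrier := U\<rparr>) B"
  shows "finite B"
proof -
  let ?U = "V\<lparr>carrier := U\<rparr>"
  interpret U: rat_space ?U using assms(1) by (rule rat_space_subsp)
  interpret UU: vectorspace QQ ?U using U.rat_space_axioms by (simp add: rat_space_iff)
  obtain F where F: "finite F" "F \<subseteq> U" "U \<subseteq> lspan V F" using assms(2) by (auto simp: finite_span_def)
  have "lspan ?U F = U"
    using F lspan_least[OF F(2) assms(1)] by (auto simp: lspan_carrier_update)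
  then have "UU.fin_dim"
    using F U.span_eq_lspan[of F] unfolding UU.fin_dim_def by auto
  then show ?thesis
    using UU.fin_dim_li_fin assms(3) unfolding UU.basis_def by blast
qed

lemma (in rat_space) basis_lspan:
  assumes "subsp U" "vectorspace.basis QQ (V\<lparr>carrier := U\<rparr>) B"
  shows "B \<subseteq> U" "lspan V B = U" "\<zero> \<notin> B"
proof -
  let ?U = "V\<lparr>carrier := U\<rparr>"
  interpret U: rat_space ?U using assms(1) by (rule rat_space_subsp)
  interpret UU: vectorspace QQ ?U using U.rat_space_axioms by (simp add: rat_space_iff)
  show BU: "B \<subseteq> U" using assms(2) unfolding UU.basis_def by simp
  show "lspan V B = U"
    using assms(2) U.span_eq_lspan[of B] unfolding UU.basis_def by (simp add: lspan_carrier_update)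
  show "\<zero> \<notin> B"
    using UU.vs_zero_lin_dep[of B] assms(2) unfolding UU.basis_def by simp
qed

text \<open>Independent subsets of \<open>T\<close> have at most as many elements as the dimension
  of \<open>U\<close>, so a maximal one exists; by maximality it spans \<open>T\<close>.\<close>

lemma (in rat_space) finite_span_subset:
  assumes "finite_span V U" "subsp U" "subsp T" "T \<subseteq> U"
  shows "finite_span V T"
proof -
  let ?U = "V\<lparr>carrier := U\<rparr>"
  interpret U: rat_space ?U using assms(2) by (rule rat_space_subsp)
  interpret UU: vectorspace QQ ?U using U.rat_space_axioms by (simp add: rat_space_iff)
  obtain F where F: "finite F" "F \<subseteq> U" "U \<subseteq> lspan V F" using assms(1) by (auto simp: finite_span_def)
  have "lspan ?U F = U"
    using F lspan_least[OF F(2) assms(2)] by (auto simp: lspan_carrier_update)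
  then have fd: "UU.fin_dim"
    using F U.span_eq_lspan[of F] unfolding UU.fin_dim_def by auto
  let ?P = "\<lambda>A. A \<subseteq> T \<and> UU.lin_indpt A"
  have "?P {}" by (auto simp: UU.lin_dep_def)
  moreover have "finite A \<and> card A \<le> UU.dim" if "?P A" for A
    using that UU.li_le_dim[OF fd] assms(4) by auto
  ultimately obtain A where A: "finite A" "maximal A ?P"
    using maximal_exists[of ?P UU.dim "{}"] by blast
  then have A': "A \<subseteq> T" "UU.lin_indpt A" by (auto simp: maximal_def)
  have "x \<in> lspan V A" if "x \<in> T" for x
  proof (cases "x \<in> A")
    case True then show ?thesis by (rule lspan.incl)
  next
    case False
    then have "UU.lin_dep (A \<union> {x})"
      using A(2) that A'(1) unfolding maximal_def by blast
    then have "x \<in> UU.span A"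
      using UU.lin_dep_iff_in_span[of A x] A' False that assms(4) by auto
    then show ?thesis
      using U.span_eq_lspan[of A] A'(1) assms(4) by (auto simp: lspan_carrier_update)
  qed
  then show ?thesis using A(1) A'(1) by (auto simp: finite_span_def)
qed

lemma (in rat_linear) finite_span_image:
  assumes "finite_span V U" "U \<subseteq> carrier V"
  shows "finite_span W (f ` U)"
proof -
  obtain F where F: "finite F" "F \<subseteq> U" "U \<subseteq> lspan V F" using assms(1) by (auto simp: finite_span_def)
  then show ?thesis
    using lspan_image[of F] assms(2) unfolding finite_span_def by (intro exI[of _ "f ` F"]) auto
qed

section \<open>Quotients of a subspace by a smaller one\<close>

definition qclass :: "(rat, 'v, 'z) module_scheme \<Rightarrow> 'v set \<Rightarrow> 'v \<Rightarrow> 'v set"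
  where "qclass V I x = I +>\<^bsub>V\<^esub> x"

text \<open>Only the linear part of \<open>quotient_module\<close> is described here, so the results
  cover both cohomology and the spaces \<open>V/W\<close> behind the numerical invariants.\<close>

locale rat_quotient = rat_space V for V :: "(rat, 'v, 'z) module_scheme" (structure) +
  fixes Z I :: "'v set"
  assumes subsp_Z: "subsp Z" and subsp_I: "subsp I" and I_le_Z: "I \<subseteq> Z"
begin

abbreviation Q :: "(rat, 'v set) module" where "Q \<equiv> quotient_module V Z I"

lemma qclass_eq: "qclass V I x = (\<lambda>a. a \<oplus> x) ` I"
  by (auto simp: qclass_def a_r_coset_def' )

lemma mem_qclass_iff:
  assumes "x \<in> carrier V" "y \<in> carrier V"
  shows "y \<in> qclass V I x \<longleftrightarrow> y \<ominus> x \<in> I"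
proof
  assume "y \<in> qclass V I x"
  then obtain a where a: "a \<in> I" "y = a \<oplus> x" by (auto simp: qclass_eq)
  then have "y \<ominus> x = a"
    using assms subspD(1)[OF subsp_I a(1)] by (simp add: a_minus_def a_assoc r_neg)
  with a show "y \<ominus> x \<in> I" by simp
next
  assume "y \<ominus> x \<in> I"
  then show "y \<in> qclass V I x"
    using assms by (auto simp: qclass_eq image_iff minus_add_cancel intro: bexI[of _ "y \<ominus> x"])
qed

lemma qclass_closed: "\<lbrakk>x \<in> carrier V; y \<in> qclass V I x\<rbrakk> \<Longrightarrow> y \<in> carrier V"
  using subspD(1)[OF subsp_I] by (auto simp: qclass_eq)

lemma qclass_eq_iff:
  assumes x: "x \<in> carrier V" and y: "y \<in> carrier V"
  shows "qclass V I x = qclass V I y \<longleftrightarrow> x \<ominus> y \<in> I"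
proof
  assume "qclass V I x = qclass V I y"
  moreover have "x \<in> qclass V I x"
    using x mem_qclass_iff[OF x x] subspD(2)[OF subsp_I] by (simp add: a_minus_def r_neg)
  ultimately show "x \<ominus> y \<in> I" using mem_qclass_iff[OF y x] by simp
next
  assume I: "x \<ominus> y \<in> I"
  have "z \<ominus> x \<in> I \<longleftrightarrow> z \<ominus> y \<in> I" if z: "z \<in> carrier V" for z
  proof -
    have "z \<ominus> y = (z \<ominus> x) \<oplus> (x \<ominus> y)" "z \<ominus> x = (z \<ominus> y) \<oplus> (y \<ominus> x)" "y \<ominus> x = \<ominus> (x \<ominus> y)"
      using x y z by (simp_all add: minus_trans minus_swap)
    then show ?thesis using I subspD(3,5)[OF subsp_I] by metis
  qed
  then show "qclass V I x = qclass V I y"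
    using mem_qclass_iff[OF x] mem_qclass_iff[OF y] qclass_closed[OF x] qclass_closed[OF y] by blast
qed

lemma Q_carrier: "carrier Q = qclass V I ` Z"
  by (auto simp: quotient_module_def ring.extend_def module.fields_def FactRing_def A_RCOSETS_def'
      qclass_def a_r_coset_def')

lemma Q_zero: "\<zero>\<^bsub>Q\<^esub> = qclass V I \<zero>"
proof -
  have "(\<lambda>a. a \<oplus> \<zero>) ` I = I"
    using subspD(1)[OF subsp_I] by force
  then show ?thesis
    by (simp add: quotient_module_def ring.extend_def module.fields_def FactRing_def qclass_eq)
qed

lemma Q_add:
  assumes "x \<in> carrier V" "y \<in> carrier V"
  shows "qclass V I x \<oplus>\<^bsub>Q\<^esub> qclass V I y = qclass V I (x \<oplus> y)"
proof -
  have "qclass V I x \<oplus>\<^bsub>Q\<^esub> qclass V I y = (\<Union>a\<in>I. \<Union>b\<in>I. {(a \<oplus> x) \<oplus> (b \<oplus> y)})"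
    by (auto simp: quotient_module_def ring.extend_def module.fields_def FactRing_def qclass_eq
        set_add_def')
  also have "\<dots> = (\<lambda>a. a \<oplus> (x \<oplus> y)) ` I"
  proof (intro Set.set_eqI iffI)
    fix z assume "z \<in> (\<Union>a\<in>I. \<Union>b\<in>I. {(a \<oplus> x) \<oplus> (b \<oplus> y)})"
    then obtain a b where ab: "a \<in> I" "b \<in> I" "z = (a \<oplus> x) \<oplus> (b \<oplus> y)" by blast
    then have "z = (a \<oplus> b) \<oplus> (x \<oplus> y)"
      using assms subspD(1)[OF subsp_I] by (simp add: a_ac)
    with ab show "z \<in> (\<lambda>a. a \<oplus> (x \<oplus> y)) ` I" using subspD(3)[OF subsp_I] by blast
  next
    fix z assume "z \<in> (\<lambda>a. a \<oplus> (x \<oplus> y)) ` I"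
    then obtain a where a: "a \<in> I" "z = a \<oplus> (x \<oplus> y)" by blast
    then have "z = (a \<oplus> x) \<oplus> (\<zero> \<oplus> y)"
      using assms subspD(1)[OF subsp_I] by (simp add: a_ac)
    with a show "z \<in> (\<Union>a\<in>I. \<Union>b\<in>I. {(a \<oplus> x) \<oplus> (b \<oplus> y)})"
      using subspD(2)[OF subsp_I] by blast
  qed
  finally show ?thesis by (simp add: qclass_eq)
qed

text \<open>Scalar multiplication on cosets is a union over representatives; all of them contribute
  the same class, and the union is nonempty because \<open>x\<close> lies in its own class.\<close>

lemma Q_smult:
  assumes "x \<in> carrier V"
  shows "c \<odot>\<^bsub>Q\<^esub> qclass V I x = qclass V I (c \<odot> x)"
proof -
  have "c \<odot>\<^bsub>Q\<^esub> qclass V I x = (\<Union>y\<in>qclass V I x. qclass V I (c \<odot> y))"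
    by (auto simp: quotient_module_def ring.extend_def module.fields_def qclass_def)
  also have "\<dots> = (\<Union>y\<in>qclass V I x. qclass V I (c \<odot> x))"
  proof (rule SUP_cong[OF refl])
    fix y assume y': "y \<in> qclass V I x"
    then have y: "y \<in> carrier V" using assms qclass_closed by blast
    then have "c \<odot> y \<ominus> c \<odot> x = c \<odot> (y \<ominus> x)"
      using assms by (simp add: a_minus_def smult_add_right)
    moreover have "y \<ominus> x \<in> I" using y' y assms by (simp add: mem_qclass_iff)
    ultimately show "qclass V I (c \<odot> y) = qclass V I (c \<odot> x)"
      using y assms subspD(4)[OF subsp_I] by (simp add: qclass_eq_iff)
  qed
  also have "\<dots> = qclass V I (c \<odot> x)"
  proof -
    have "x \<in> qclass V I x"
      using mem_qclass_iff[OF assms assms] subspD(2)[OF subsp_I] assms by (simp add: a_minus_def r_neg)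
    then show ?thesis by blast
  qed
  finally show ?thesis .
qed

lemma rat_space_Q: "rat_space Q"
proof (rule rat_space_surj_image)
  note Zc = subspD(1)[OF subsp_Z]
  show "rat_space (V\<lparr>carrier := Z\<rparr>)" by (rule rat_space_subsp[OF subsp_Z])
  show "qclass V I ` carrier (V\<lparr>carrier := Z\<rparr>) = carrier Q" by (simp add: Q_carrier)
  show "qclass V I x \<oplus>\<^bsub>Q\<^esub> qclass V I y = qclass V I (x \<oplus>\<^bsub>V\<lparr>carrier := Z\<rparr>\<^esub> y)"
    if "x \<in> carrier (V\<lparr>carrier := Z\<rparr>)" "y \<in> carrier (V\<lparr>carrier := Z\<rparr>)" for x y
    using that Q_add[OF Zc Zc] by simp
  show "c \<odot>\<^bsub>Q\<^esub> qclass V I x = qclass V I (c \<odot>\<^bsub>V\<lparr>carrier := Z\<rparr>\<^esub> x)"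
    if "x \<in> carrier (V\<lparr>carrier := Z\<rparr>)" for c x
    using that Q_smult[OF Zc] by simp
  show "\<zero>\<^bsub>Q\<^esub> = qclass V I \<zero>\<^bsub>V\<lparr>carrier := Z\<rparr>\<^esub>" by (simp add: Q_zero)
qed

lemma linear_qclass: "linear (V\<lparr>carrier := Z\<rparr>) Q (qclass V I)"
  unfolding linear_iff
  using Q_add[OF subspD(1,1)[OF subsp_Z]] Q_smult[OF subspD(1)[OF subsp_Z]] by (simp add: Q_carrier)

lemma finite_span_Q:
  assumes F: "finite F" "F \<subseteq> Z" "Z \<subseteq> lspan V (F \<union> I)"
  shows "finite_span Q (carrier Q)"
proof -
  interpret ql: rat_linear "V\<lparr>carrier := Z\<rparr>" Q "qclass V I"
    by (intro rat_linear.intro rat_linear_axioms.intro rat_space_Q linear_qclass rat_space_subsp subsp_Z)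
  have Zc: "z \<in> Z \<Longrightarrow> z \<in> carrier V" for z by (rule subspD(1)[OF subsp_Z])
  have img: "lspan Q (qclass V I ` F) = qclass V I ` lspan V F"
    using ql.lspan_image[of F] F(2) by (simp add: lspan_carrier_update)
  have "qclass V I z \<in> lspan Q (qclass V I ` F)" if z: "z \<in> Z" for z
  proof -
    have FC: "F \<subseteq> carrier V" using F(2) Zc by blast
    obtain s w where sw: "s \<in> lspan V F" "w \<in> I" "z = s \<oplus> w"
      using lspan_Un_subsp[OF _ subsp_I FC] F(3) z by blast
    have s: "s \<in> carrier V" using sw(1) FC by (rule lspan_closed)
    have w: "w \<in> carrier V" by (rule subspD(1)[OF subsp_I sw(2)])
    have "z \<ominus> s = w"
      unfolding sw(3) using s w by (rule add_minus_cancel_left)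
    then have "qclass V I z = qclass V I s"
      using qclass_eq_iff[OF Zc[OF z] s] sw(2) by simp
    then show ?thesis
      unfolding img using sw(1) by blast
  qed
  then show ?thesis
    using F unfolding finite_span_def Q_carrier by (intro exI[of _ "qclass V I ` F"]) blast
qed

end

text \<open>The two dimensions make the injection of quotients induced by \<open>f\<close> surjective; the conclusion is
  stated on representatives.\<close>

lemma quotient_dim_surj:
  assumes "rat_linear V W f"
    and Z: "VectorSpace.subspace QQ Z V" and N: "VectorSpace.subspace QQ N V"
    and Z': "VectorSpace.subspace QQ Z' W" and N': "VectorSpace.subspace QQ N' W"
    and fZ: "f ` Z \<subseteq> Z'" and fN: "f ` N \<subseteq> N'"
    and inj: "\<And>x. \<lbrakk>x \<in> Z; f x \<in> N'\<rbrakk> \<Longrightarrow> x \<in> N"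
    and fin: "finite F" "F \<subseteq> Z" "Z \<subseteq> lspan V (F \<union> (Z \<inter> N))"
    and fin': "finite F'" "F' \<subseteq> Z'" "Z' \<subseteq> lspan W (F' \<union> (Z' \<inter> N'))"
    and dim: "vectorspace.dim QQ (quotient_module V Z (Z \<inter> N)) =
      vectorspace.dim QQ (quotient_module W Z' (Z' \<inter> N'))"
    and x': "x' \<in> Z'"
  shows "\<exists>x\<in>Z. x' \<ominus>\<^bsub>W\<^esub> f x \<in> N'"
proof -
  interpret rat_linear V W f by fact
  interpret q: rat_quotient V Z "Z \<inter> N"
    by (intro rat_quotient.intro rat_quotient_axioms.intro V.rat_space_axioms V.subsp_Int Z N Int_lower1)
  interpret q': rat_quotient W Z' "Z' \<inter> N'"
    by (intro rat_quotient.intro rat_quotient_axioms.intro W.rat_space_axioms W.subsp_Int Z' N' Int_lower1)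
  have Zc: "z \<in> carrier V" if "z \<in> Z" for z using that by (rule V.subspD(1)[OF Z])
  have Zc': "z \<in> carrier W" if "z \<in> Z'" for z using that by (rule W.subspD(1)[OF Z'])
  \<comment> \<open>The induced map of quotients, defined through a chosen representative. The
    choice is immaterial since \<open>f\<close> maps \<open>Z \<inter> N\<close> into
    \<open>Z' \<inter> N'\<close>.\<close>
  define g where "g c = qclass W (Z' \<inter> N') (f (SOME z. z \<in> Z \<and> c = qclass V (Z \<inter> N) z))" for c
  have g: "g (qclass V (Z \<inter> N) z) = qclass W (Z' \<inter> N') (f z)" if z: "z \<in> Z" for z
  proof -
    define w where "w = (SOME w. w \<in> Z \<and> qclass V (Z \<inter> N) z = qclass V (Z \<inter> N) w)"
    have w: "w \<in> Z \<and> qclass V (Z \<inter> N) z = qclass V (Z \<inter> N) w"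
      unfolding w_def by (rule someI[of _ z]) (simp add: z)
    then have "w \<ominus>\<^bsub>V\<^esub> z \<in> Z \<inter> N"
      using q.qclass_eq_iff[OF Zc Zc, of w z] z by blast
    moreover have "f (w \<ominus>\<^bsub>V\<^esub> z) = f w \<ominus>\<^bsub>W\<^esub> f z"
      using w z Zc by (intro minus) blast+
    ultimately have "f w \<ominus>\<^bsub>W\<^esub> f z \<in> Z' \<inter> N'"
      using fZ fN by (metis IntD1 IntD2 IntI image_subset_iff)
    then have "qclass W (Z' \<inter> N') (f w) = qclass W (Z' \<inter> N') (f z)"
      using q'.qclass_eq_iff[OF closed closed, OF Zc Zc] w z by blast
    then show ?thesis unfolding g_def w_def by blast
  qed
  interpret g: rat_linear "quotient_module V Z (Z \<inter> N)" "quotient_module W Z' (Z' \<inter> N')" g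
  proof (intro rat_linear.intro rat_linear_axioms.intro q.rat_space_Q q'.rat_space_Q)
    have fZ': "f z \<in> Z'" if "z \<in> Z" for z using fZ that by blast
    show "linear (quotient_module V Z (Z \<inter> N)) (quotient_module W Z' (Z' \<inter> N')) g"
      unfolding linear_iff q.Q_carrier q'.Q_carrier
    proof (intro conjI ballI allI funcsetI; elim imageE; hypsubst)
      fix x y c assume x: "x \<in> Z" and y: "y \<in> Z"
      show "g (qclass V (Z \<inter> N) x) \<in> qclass W (Z' \<inter> N') ` Z'" using g[OF x] fZ'[OF x] by simp
      show "g (qclass V (Z \<inter> N) x \<oplus>\<^bsub>quotient_module V Z (Z \<inter> N)\<^esub> qclass V (Z \<inter> N) y) =
        g (qclass V (Z \<inter> N) x) \<oplus>\<^bsub>quotient_module W Z' (Z' \<inter> N')\<^esub> g (qclass V (Z \<inter> N) y)"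
        using x y Zc[OF x] Zc[OF y] V.subspD(3)[OF Z x y] by (simp add: g q.Q_add q'.Q_add)
      show "g (c \<odot>\<^bsub>quotient_module V Z (Z \<inter> N)\<^esub> qclass V (Z \<inter> N) x) =
        c \<odot>\<^bsub>quotient_module W Z' (Z' \<inter> N')\<^esub> g (qclass V (Z \<inter> N) x)"
        using x Zc[OF x] V.subspD(4)[OF Z x] by (simp add: g q.Q_smult q'.Q_smult)
    qed
  qed
  have "g ` carrier (quotient_module V Z (Z \<inter> N)) = carrier (quotient_module W Z' (Z' \<inter> N'))"
  proof (rule g.inj_eq_dim_imp_surj[OF q.finite_span_Q[OF fin] q'.finite_span_Q[OF fin'] dim])
    fix c assume c: "c \<in> carrier (quotient_module V Z (Z \<inter> N))"
      and gc: "g c = \<zero>\<^bsub>quotient_module W Z' (Z' \<inter> N')\<^esub>"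
    then obtain z where z: "z \<in> Z" "c = qclass V (Z \<inter> N) z" unfolding q.Q_carrier by blast
    then have "qclass W (Z' \<inter> N') (f z) = qclass W (Z' \<inter> N') \<zero>\<^bsub>W\<^esub>"
      using gc unfolding q'.Q_zero by (simp add: g)
    then have "f z \<in> N'"
      using q'.qclass_eq_iff[OF closed[OF Zc] W.zero_closed] z(1) Zc[OF z(1)] by simp
    then have "z \<in> Z \<inter> N" using inj z by blast
    then show "c = \<zero>\<^bsub>quotient_module V Z (Z \<inter> N)\<^esub>"
      using z Zc[OF z(1)] q.qclass_eq_iff[OF Zc V.zero_closed] by (simp add: q.Q_zero)
  qed
  moreover have "qclass W (Z' \<inter> N') x' \<in> carrier (quotient_module W Z' (Z' \<inter> N'))"
    unfolding q'.Q_carrier using x' by blast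
  ultimately obtain c where "c \<in> carrier (quotient_module V Z (Z \<inter> N))" "g c = qclass W (Z' \<inter> N') x'"
    by (metis imageE)
  then obtain z where z: "z \<in> Z" "g (qclass V (Z \<inter> N) z) = qclass W (Z' \<inter> N') x'"
    unfolding q.Q_carrier by blast
  then have "x' \<ominus>\<^bsub>W\<^esub> f z \<in> N'"
    using q'.qclass_eq_iff[OF Zc'[OF x'] closed[OF Zc[OF z(1)]]] g by auto
  with z(1) show ?thesis by blast
qed

section \<open>Gradings\<close>

context rat_space
begin

lemma finsum_support:
  assumes "finite F" "{n. f n \<noteq> \<zero>} \<subseteq> F" "\<And>n. f n \<in> carrier V"
  shows "(\<Oplus>n\<in>{n. f n \<noteq> \<zero>}. f n) = (\<Oplus>n\<in>F. f n)"
  using assms by (intro add.finprod_mono_neutral_cong_left) auto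

text \<open>Existence holds on homogeneous elements and is preserved by linear combinations.
  Applying \<open>p m\<close> to any decomposition leaves only its \<open>m\<close>-th term, which
  gives uniqueness. This is how subalgebras and cohomology inherit their gradings.\<close>

lemma direct_sum_by_projections:
  assumes gr: "\<And>n. subsp (gr n)"
    and p_lin: "\<And>n. linear V V (p n)"
    and p_gr: "\<And>n x. x \<in> carrier V \<Longrightarrow> p n x \<in> gr n"
    and p_id: "\<And>n x. x \<in> gr n \<Longrightarrow> p n x = x"
    and p_zero: "\<And>m n x. \<lbrakk>x \<in> gr m; m \<noteq> n\<rbrakk> \<Longrightarrow> p n x = \<zero>"
    and x: "x \<in> lspan V (\<Union>n. gr n)"
  shows "\<exists>!f. (\<forall>n. f n \<in> gr n) \<and> finite {n. f n \<noteq> \<zero>} \<and> x = (\<Oplus>n\<in>{n. f n \<noteq> \<zero>}. f n)"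
proof (rule ex1I)
  have p: "rat_linear V V (p n)" for n
    by (intro rat_linear.intro rat_linear_axioms.intro rat_space_axioms p_lin)
  note p_closed = rat_linear.closed[OF p] and p_add = rat_linear.add[OF p]
    and p_smult = rat_linear.smult[OF p] and p_0 = rat_linear.zero[OF p]
  have grc: "y \<in> gr n \<Longrightarrow> y \<in> carrier V" for y n by (rule subspD(1)[OF gr])
  let ?P = "\<lambda>x. finite {n. p n x \<noteq> \<zero>} \<and> x = (\<Oplus>n\<in>{n. p n x \<noteq> \<zero>}. p n x)"
  have "x \<in> carrier V \<and> ?P x"
    using x
  proof induction
    case zero
    then show ?case by (simp add: p_0)
  next
    case (incl x)
    then obtain m where m: "x \<in> gr m" by blast
    then have pn: "p n x = (if n = m then x else \<zero>)" for n using p_id p_zero by auto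
    then have "{n. p n x \<noteq> \<zero>} = (if x = \<zero> then {} else {m})" by auto
    then show ?case using pn grc[OF m] by (auto split: if_splits)
  next
    case (smult x c)
    then have fin: "finite {n. p n x \<noteq> \<zero>}" and x: "x \<in> carrier V" by auto
    have sub: "{n. p n (c \<odot> x) \<noteq> \<zero>} \<subseteq> {n. p n x \<noteq> \<zero>}"
      using x by (auto simp: p_smult)
    have "(\<Oplus>n\<in>{n. p n (c \<odot> x) \<noteq> \<zero>}. p n (c \<odot> x)) = (\<Oplus>n\<in>{n. p n x \<noteq> \<zero>}. p n (c \<odot> x))"
      using x by (intro finsum_support fin sub) (simp add: p_closed)
    also have "\<dots> = (\<Oplus>n\<in>{n. p n x \<noteq> \<zero>}. c \<odot> p n x)"
      using x by (intro finsum_cong') (auto simp: p_smult p_closed)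
    also have "\<dots> = c \<odot> (\<Oplus>n\<in>{n. p n x \<noteq> \<zero>}. p n x)"
    proof -
      interpret s: rat_linear V V "\<lambda>x. c \<odot> x"
        by unfold_locales (auto simp: linear_iff smult_add_right smult_smult mult.commute)
      show ?thesis using x by (subst s.finsum) (auto simp: p_closed)
    qed
    finally show ?case using smult finite_subset[OF sub fin] by auto
  next
    case (add x y)
    then have fin: "finite ({n. p n x \<noteq> \<zero>} \<union> {n. p n y \<noteq> \<zero>})" (is "finite ?F")
      and x: "x \<in> carrier V" and y: "y \<in> carrier V" by auto
    have sub: "{n. p n (x \<oplus> y) \<noteq> \<zero>} \<subseteq> ?F" using x y by (auto simp: p_add)
    have "(\<Oplus>n\<in>{n. p n (x \<oplus> y) \<noteq> \<zero>}. p n (x \<oplus> y)) = (\<Oplus>n\<in>?F. p n (x \<oplus> y))"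
      using x y by (intro finsum_support fin sub) (simp add: p_closed)
    also have "\<dots> = (\<Oplus>n\<in>?F. p n x \<oplus> p n y)"
      using x y by (intro finsum_cong') (auto simp: p_add p_closed)
    also have "\<dots> = (\<Oplus>n\<in>?F. p n x) \<oplus> (\<Oplus>n\<in>?F. p n y)"
      using x y by (intro finsum_addf) (auto simp: p_closed)
    also have "(\<Oplus>n\<in>?F. p n x) = (\<Oplus>n\<in>{n. p n x \<noteq> \<zero>}. p n x)"
      using x fin by (intro finsum_support[symmetric]) (auto simp: p_closed)
    also have "(\<Oplus>n\<in>?F. p n y) = (\<Oplus>n\<in>{n. p n y \<noteq> \<zero>}. p n y)"
      using y fin by (intro finsum_support[symmetric]) (auto simp: p_closed)
    finally show ?case using add finite_subset[OF sub fin] by auto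
  qed
  then show "(\<forall>n. p n x \<in> gr n) \<and> finite {n. p n x \<noteq> \<zero>} \<and> x = (\<Oplus>n\<in>{n. p n x \<noteq> \<zero>}. p n x)"
    using p_gr by blast
  fix f assume f: "(\<forall>n. f n \<in> gr n) \<and> finite {n. f n \<noteq> \<zero>} \<and> x = (\<Oplus>n\<in>{n. f n \<noteq> \<zero>}. f n)"
  show "f = (\<lambda>n. p n x)"
  proof
    fix m
    let ?F = "{n. f n \<noteq> \<zero>}"
    have fc: "f n \<in> carrier V" for n using f grc by blast
    have "p m x = (\<Oplus>n\<in>?F. p m (f n))"
      using f fc rat_linear.finsum[OF p, of f ?F] by auto
    also have "\<dots> = (\<Oplus>n\<in>?F. if m = n then f n else \<zero>)"
      using f fc by (intro finsum_cong') (auto simp: p_id intro: p_zero)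
    also have "\<dots> = f m"
    proof (cases "m \<in> ?F")
      case True
      then show ?thesis using f fc by (intro add.finprod_singleton) auto
    next
      case False
      then show ?thesis using fc by (subst add.finprod_one_eqI) auto
    qed
    finally show "f m = p m x" by simp
  qed
qed

end

section \<open>Homogeneous components\<close>

sublocale differential_algebra \<subseteq> ring A
  by (rule is_ring)

sublocale differential_algebra \<subseteq> rat_space A
  using is_vectorspace by (simp add: rat_space_iff)

sublocale differential_algebra \<subseteq> dif: rat_linear A A "dif A"
  by unfold_locales (rule dif_linear)

definition component :: "('a, 'z) dga_scheme \<Rightarrow> nat \<Rightarrow> 'a \<Rightarrow> 'a"
  where "component A n x = (THE f. (\<forall>n. f n \<in> grade A n) \<and> finite {n. f n \<noteq> \<zero>\<^bsub>A\<^esub>} \<and>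
    x = (\<Oplus>\<^bsub>A\<^esub>n\<in>{n. f n \<noteq> \<zero>\<^bsub>A\<^esub>}. f n)) n"

context differential_algebra
begin

lemma grade_closed: "x \<in> grade A n \<Longrightarrow> x \<in> carrier A"
  by (rule subspD(1)[OF grade_subspace])

lemmas grade_zero = subspD(2)[OF grade_subspace]
  and grade_add = subspD(3)[OF grade_subspace]
  and grade_smult = subspD(4)[OF grade_subspace]
  and grade_minus = subspD(6)[OF grade_subspace]

lemma component_props:
  assumes "x \<in> carrier A"
  shows "component A n x \<in> grade A n" "finite {n. component A n x \<noteq> \<zero>}"
    "x = (\<Oplus>n\<in>{n. component A n x \<noteq> \<zero>}. component A n x)"
  using theI'[OF grade_decomposition[OF assms]] unfolding component_def by blast+

lemma component_closed [simp]: "x \<in> carrier A \<Longrightarrow> component A n x \<in> carrier A"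
  using component_props(1) grade_closed by blast

text \<open>The index set may be larger than the support, so decompositions of two elements can be
  added over a common finite set.\<close>

lemma component_unique:
  assumes f: "\<And>n. f n \<in> grade A n" and F: "finite F" "{n. f n \<noteq> \<zero>} \<subseteq> F" and x: "x = (\<Oplus>n\<in>F. f n)"
  shows "component A n x = f n"
proof -
  have fc: "f n \<in> carrier A" for n using f grade_closed by blast
  then have "x \<in> carrier A" using x by (auto intro: finsum_closed)
  then have "\<exists>!f. (\<forall>n. f n \<in> grade A n) \<and> finite {n. f n \<noteq> \<zero>} \<and> x = (\<Oplus>n\<in>{n. f n \<noteq> \<zero>}. f n)"
    by (rule grade_decomposition)
  moreover have "(\<forall>n. f n \<in> grade A n) \<and> finite {n. f n \<noteq> \<zero>} \<and> x = (\<Oplus>n\<in>{n. f n \<noteq> \<zero>}. f n)"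
    using f finite_subset[OF F(2,1)] x finsum_support[OF F fc] by simp
  ultimately have "(THE f. (\<forall>n. f n \<in> grade A n) \<and> finite {n. f n \<noteq> \<zero>} \<and> x = (\<Oplus>n\<in>{n. f n \<noteq> \<zero>}. f n)) = f"
    by - (rule the1_equality)
  then show ?thesis by (simp add: component_def)
qed

lemma component_grade:
  assumes "x \<in> grade A m"
  shows "component A n x = (if n = m then x else \<zero>)"
  by (rule component_unique[where F = "{m}"])
    (use assms grade_closed[OF assms] grade_zero in auto)

lemma component_linear: "linear A A (component A n)"
  unfolding linear_iff
proof (intro conjI ballI allI)
  show "component A n \<in> carrier A \<rightarrow> carrier A" by auto
  fix x y c assume x: "x \<in> carrier A" and y: "y \<in> carrier A"
  let ?F = "{n. component A n x \<noteq> \<zero>} \<union> {n. component A n y \<noteq> \<zero>}"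
  have fin: "finite ?F" using component_props(2) x y by simp
  have xs: "x = (\<Oplus>n\<in>?F. component A n x)"
    using component_props(3)[OF x] finsum_support[OF fin, of "\<lambda>n. component A n x"] x by auto
  have ys: "y = (\<Oplus>n\<in>?F. component A n y)"
    using component_props(3)[OF y] finsum_support[OF fin, of "\<lambda>n. component A n y"] y by auto
  show "component A n (x \<oplus> y) = component A n x \<oplus> component A n y"
  proof (rule component_unique[OF _ fin])
    show "x \<oplus> y = (\<Oplus>n\<in>?F. component A n x \<oplus> component A n y)"
      using xs ys x y by (subst finsum_addf) auto
  qed (use x y component_props(1) grade_add in auto)
  show "component A n (c \<odot> x) = c \<odot> component A n x"
  proof (rule component_unique[OF _ fin])
    interpret s: rat_linear A A "\<lambda>x. c \<odot> x"
      by unfold_locales (auto simp: linear_iff smult_add_right smult_smult mult.commute)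
    have "c \<odot> (\<Oplus>n\<in>?F. component A n x) = (\<Oplus>n\<in>?F. c \<odot> component A n x)"
      using x by (subst s.finsum) auto
    then show "c \<odot> x = (\<Oplus>n\<in>?F. c \<odot> component A n x)"
      using xs by argo
  qed (use x component_props(1) grade_smult in auto)
qed

lemma component_is_linear: "rat_linear A A (component A n)"
  by (intro rat_linear.intro rat_linear_axioms.intro rat_space_axioms component_linear)

lemmas component_add = rat_linear.add[OF component_is_linear]
  and component_smult = rat_linear.smult[OF component_is_linear]
  and component_minus = rat_linear.minus[OF component_is_linear]
  and component_zero = rat_linear.zero[OF component_is_linear]

lemma carrier_lspan_grade: "carrier A = lspan A (\<Union>n. grade A n)"
proof
  show "carrier A \<subseteq> lspan A (\<Union>n. grade A n)"
  proof
    fix x assume x: "x \<in> carrier A"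
    have "(\<Oplus>n\<in>{n. component A n x \<noteq> \<zero>}. component A n x) \<in> lspan A (\<Union>n. grade A n)"
      using component_props(1)[OF x] grade_closed
      by (intro finsum_in_subsp subsp_lspan) (auto intro: lspan.incl)
    then show "x \<in> lspan A (\<Union>n. grade A n)" using component_props(3)[OF x] by simp
  qed
  show "lspan A (\<Union>n. grade A n) \<subseteq> carrier A"
    using lspan_closed grade_closed by (metis UN_E subsetI)
qed

lemma carrier_homogeneous_induct [consumes 1, case_names zero homogeneous smult add]:
  assumes "x \<in> carrier A" "P \<zero>" "\<And>n x. x \<in> grade A n \<Longrightarrow> P x"
    "\<And>c x. \<lbrakk>x \<in> carrier A; P x\<rbrakk> \<Longrightarrow> P (c \<odot> x)"
    "\<And>x y. \<lbrakk>x \<in> carrier A; y \<in> carrier A; P x; P y\<rbrakk> \<Longrightarrow> P (x \<oplus> y)"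
  shows "P x"
proof -
  have "x \<in> lspan A (\<Union>n. grade A n)" using assms(1) carrier_lspan_grade by simp
  then have "x \<in> carrier A \<and> P x"
    by induction (use assms(2-) grade_closed in auto)
  then show ?thesis ..
qed

lemma component_dif:
  assumes "x \<in> carrier A"
  shows "component A (Suc n) (dif A x) = dif A (component A n x)"
  using assms
proof (induction rule: carrier_homogeneous_induct)
  case (homogeneous m x)
  then show ?case
    using component_grade[OF dif_grade[OF homogeneous]] component_grade[OF homogeneous] by simp
qed (simp_all add: component_zero component_add component_smult)

lemma component_0_dif:
  assumes "x \<in> carrier A"
  shows "component A 0 (dif A x) = \<zero>"
  using assms
proof (induction rule: carrier_homogeneous_induct)
  case (homogeneous m x)
  then show ?case using component_grade[OF dif_grade[OF homogeneous]] by simp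
qed (simp_all add: component_zero component_add component_smult)

lemma dif_one [simp]: "dif A \<one> = \<zero>"
proof -
  have "dif A \<one> = dif A \<one> \<oplus> dif A \<one>"
    using leibniz[OF one_grade one_closed] by simp
  then show ?thesis by (metis add.l_cancel_one' dif.closed one_closed)
qed

lemma subalg_subset_carrier: "S \<subseteq> carrier A \<Longrightarrow> subalg A S \<subseteq> carrier A"
proof
  fix x assume "S \<subseteq> carrier A" "x \<in> subalg A S"
  from this(2,1) show "x \<in> carrier A" by induction auto
qed

lemma subalg_closed: "\<lbrakk>x \<in> subalg A S; S \<subseteq> carrier A\<rbrakk> \<Longrightarrow> x \<in> carrier A"
  using subalg_subset_carrier by blast

lemma subalg_zero: "\<zero> \<in> subalg A S"
  using subalg.smult[of \<one> A S 0] subalg.one[of A S] by simp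

lemma subalg_subsp: "S \<subseteq> carrier A \<Longrightarrow> subsp (subalg A S)"
  by (intro subspI) (auto intro: subalg_zero subalg.add subalg.smult subalg_closed)

end

section \<open>Generated subalgebras and words in homogeneous generators\<close>

lemma subalg_least: "S \<subseteq> subalg A T \<Longrightarrow> subalg A S \<subseteq> subalg A T"
proof
  fix x assume "S \<subseteq> subalg A T" "x \<in> subalg A S"
  from this(2,1) show "x \<in> subalg A T" by induction (auto intro: subalg.intros)
qed

lemma subalg_mono: "S \<subseteq> T \<Longrightarrow> subalg A S \<subseteq> subalg A T"
  by (rule subalg_least) (auto intro: subalg.incl)

lemma subalg_filter: "subalg A {s \<in> S. P s} \<subseteq> subalg A S"
  by (rule subalg_mono) blast

lemma subset_subalg: "S \<subseteq> subalg A S"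
  by (auto intro: subalg.incl)

lemma (in differential_algebra) lspan_subset_subalg: "S \<subseteq> subalg A T \<Longrightarrow> lspan A S \<subseteq> subalg A T"
proof
  fix x assume "S \<subseteq> subalg A T" "x \<in> lspan A S"
  from this(2,1) show "x \<in> subalg A T" by induction (auto intro: subalg.intros subalg_zero)
qed

text \<open>A word is a product of generators together with its total degree. Each letter has
  positive degree, so the total degree bounds both the length and the degrees of the
  letters.\<close>

inductive word :: "('a, 'z) dga_scheme \<Rightarrow> 'a set \<Rightarrow> nat \<Rightarrow> 'a \<Rightarrow> bool"
  for A :: "('a, 'z) dga_scheme" and S :: "'a set"
  where
    empty: "word A S 0 \<one>\<^bsub>A\<^esub>"
  | cons: "\<lbrakk>s \<in> S; s \<in> grade A d; 0 < d; word A S n w\<rbrakk> \<Longrightarrow> word A S (d + n) (s \<otimes>\<^bsub>A\<^esub> w)"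

definition homogeneous_gens :: "('a, 'z) dga_scheme \<Rightarrow> 'a set \<Rightarrow> bool"
  where "homogeneous_gens A S \<longleftrightarrow> (\<forall>s\<in>S. \<exists>d>0. s \<in> grade A d)"

lemma homogeneous_gens_subset: "\<lbrakk>homogeneous_gens A T; S \<subseteq> T\<rbrakk> \<Longrightarrow> homogeneous_gens A S"
  by (auto simp: homogeneous_gens_def)

text \<open>Removing the first letter strictly lowers the degree, and there are finitely many
  choices for that letter.\<close>

lemma finite_words:
  assumes "finite S"
  shows "finite {w. word A S n w}"
proof (induction n rule: less_induct)
  case (less n)
  have "{w. word A S n w} \<subseteq> {\<one>\<^bsub>A\<^esub>} \<union> (\<Union>s\<in>S. \<Union>m\<in>{..<n}. (\<lambda>w. s \<otimes>\<^bsub>A\<^esub> w) ` {w. word A S m w})"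
  proof
    fix w assume "w \<in> {w. word A S n w}"
    then have "word A S n w" by simp
    then show "w \<in> {\<one>\<^bsub>A\<^esub>} \<union> (\<Union>s\<in>S. \<Union>m\<in>{..<n}. (\<lambda>w. s \<otimes>\<^bsub>A\<^esub> w) ` {w. word A S m w})"
    proof cases
      case (cons s d m v)
      then have "m \<in> {..<n}" by simp
      with cons show ?thesis by blast
    qed simp
  qed
  then show ?case by (rule finite_subset) (use less assms in auto)
qed

context differential_algebra
begin

lemma homogeneous_gens_closed: "homogeneous_gens A S \<Longrightarrow> S \<subseteq> carrier A"
  using grade_closed by (auto simp: homogeneous_gens_def)

lemma word_grade: "word A S n w \<Longrightarrow> w \<in> grade A n"
  by (induction rule: word.induct) (auto intro: one_grade mult_grade)

lemma word_closed: "word A S n w \<Longrightarrow> w \<in> carrier A"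
  using word_grade grade_closed by blast

lemma word_in_subalg: "word A S n w \<Longrightarrow> w \<in> subalg A {s \<in> S. \<exists>d. 0 < d \<and> d \<le> n \<and> s \<in> grade A d}"
proof (induction rule: word.induct)
  case (cons s d n w)
  have "w \<in> subalg A {s \<in> S. \<exists>e. 0 < e \<and> e \<le> d + n \<and> s \<in> grade A e}"
    by (rule subsetD[OF subalg_mono cons.IH]) fastforce
  moreover have "s \<in> subalg A {s \<in> S. \<exists>e. 0 < e \<and> e \<le> d + n \<and> s \<in> grade A e}"
    using cons by (intro subalg.incl) auto
  ultimately show ?case by (rule subalg.mult[rotated])
qed (rule subalg.one)

lemma word_mult: "\<lbrakk>word A S m u; word A S n v\<rbrakk> \<Longrightarrow> word A S (m + n) (u \<otimes> v)"
proof (induction rule: word.induct)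
  case empty
  then show ?case using word_closed by simp
next
  case (cons s d m w)
  then have "s \<otimes> w \<otimes> v = s \<otimes> (w \<otimes> v)"
    using grade_closed word_closed by (intro m_assoc) blast+
  then show ?case using word.cons[OF cons(1-3) cons.IH[OF cons.prems]] by (simp add: ac_simps)
qed

text \<open>Words are closed under multiplication, so by bilinearity their span is too. This
  replaces inductions over subalgebra elements by inductions over words, where the degree is
  known.\<close>

lemma subalg_eq_lspan_words:
  assumes "homogeneous_gens A S"
  shows "subalg A S = lspan A {w. \<exists>n. word A S n w}"
proof
  let ?W = "{w. \<exists>n. word A S n w}"
  have W: "?W \<subseteq> carrier A" using word_closed by blast
  have left: "u \<otimes> y \<in> lspan A ?W" if u: "u \<in> ?W" and y: "y \<in> lspan A ?W" for u y
    using y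
  proof induction
    case zero
    then show ?case using u word_closed by (auto intro: lspan.zero)
  next
    case (incl x)
    then show ?case using u word_mult by (blast intro: lspan.incl)
  next
    case (smult x c)
    then show ?case using u word_closed lspan_closed[OF _ W] by (auto simp: smult_mult_right intro: lspan.smult)
  next
    case (add x y)
    then show ?case using u word_closed lspan_closed[OF _ W] by (auto simp: r_distr intro: lspan.add)
  qed
  have mult: "x \<otimes> y \<in> lspan A ?W" if x: "x \<in> lspan A ?W" and y: "y \<in> lspan A ?W" for x y
    using x
  proof induction
    case zero
    then show ?case using lspan_closed[OF y W] by (auto intro: lspan.zero)
  next
    case (incl x)
    then show ?case using left y by blast
  next
    case (smult x c)
    then show ?case using lspan_closed[OF _ W] y by (auto simp: smult_mult_left intro: lspan.smult)
  next
    case (add x y')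
    then show ?case using lspan_closed[OF _ W] y by (auto simp: l_distr intro: lspan.add)
  qed
  show "subalg A S \<subseteq> lspan A ?W"
  proof
    fix x assume "x \<in> subalg A S"
    then show "x \<in> lspan A ?W"
    proof induction
      case one
      then show ?case by (blast intro: lspan.incl word.empty)
    next
      case (incl x)
      then obtain d where d: "0 < d" "x \<in> grade A d" using assms by (auto simp: homogeneous_gens_def)
      have "word A S (d + 0) (x \<otimes> \<one>)" by (rule word.cons[OF incl d(2,1) word.empty])
      then show ?case using grade_closed[OF d(2)] by (auto intro: lspan.incl)
    qed (auto intro: lspan.smult lspan.add mult)
  qed
  have "?W \<subseteq> subalg A S"
    by (auto intro: subsetD[OF subalg_filter word_in_subalg])
  then show "lspan A ?W \<subseteq> subalg A S" by (rule lspan_subset_subalg)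
qed

text \<open>Taking the component of degree \<open>n\<close> keeps the words of degree
  \<open>n\<close> and kills the others; hence a subalgebra with homogeneous generators is a graded
  subspace.\<close>

lemma component_subalg:
  assumes "homogeneous_gens A S" "x \<in> subalg A S"
  shows "component A n x \<in> lspan A {w. word A S n w}"
proof -
  have W: "{w. \<exists>n. word A S n w} \<subseteq> carrier A" using word_closed by blast
  from assms have "x \<in> lspan A {w. \<exists>n. word A S n w}" by (simp add: subalg_eq_lspan_words)
  then show ?thesis
  proof induction
    case (incl x)
    then obtain m where "word A S m x" by blast
    then show ?case
      using component_grade[OF word_grade] by (auto intro: lspan.incl lspan.zero)
  qed (use lspan_closed[OF _ W] in \<open>auto simp: component_zero component_add component_smult
      intro: lspan.zero lspan.add lspan.smult\<close>)
qed

lemma component_in_subalg: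
  assumes "homogeneous_gens A S" "x \<in> subalg A S"
  shows "component A n x \<in> subalg A S"
proof -
  have "lspan A {w. word A S n w} \<subseteq> lspan A {w. \<exists>n. word A S n w}"
    by (rule lspan_mono) blast
  with component_subalg[OF assms, of n] show ?thesis
    using assms(1) by (auto simp: subalg_eq_lspan_words)
qed

text \<open>A word of degree \<open>n\<close> cannot contain a letter of degree above
  \<open>n\<close>, as all letters have positive degree.\<close>

lemma grade_subalg_low_gens:
  assumes "homogeneous_gens A S" "x \<in> subalg A S" "x \<in> grade A n"
  shows "x \<in> subalg A {s \<in> S. \<exists>d. 0 < d \<and> d \<le> n \<and> s \<in> grade A d}"
proof -
  have "x \<in> lspan A {w. word A S n w}"
    using component_subalg[OF assms(1,2), of n] component_grade[OF assms(3), of n] by simp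
  moreover have "{w. word A S n w} \<subseteq> subalg A {s \<in> S. \<exists>d. 0 < d \<and> d \<le> n \<and> s \<in> grade A d}"
    using word_in_subalg by blast
  ultimately show ?thesis using lspan_subset_subalg by blast
qed

lemma finite_span_grade_subalg:
  assumes "homogeneous_gens A S" "finite S"
  shows "finite_span A (grade A n \<inter> subalg A S)"
  unfolding finite_span_def
proof (intro exI conjI)
  show "finite {w. word A S n w}" by (rule finite_words[OF assms(2)])
  have "subalg A {s \<in> S. \<exists>d. 0 < d \<and> d \<le> n \<and> s \<in> grade A d} \<subseteq> subalg A S"
    by (rule subalg_mono) blast
  then show "{w. word A S n w} \<subseteq> grade A n \<inter> subalg A S"
    using word_grade word_in_subalg by blast
  show "grade A n \<inter> subalg A S \<subseteq> lspan A {w. word A S n w}"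
    using component_subalg[OF assms(1)] component_grade by (metis IntE subsetI)
qed

text \<open>By the Leibniz rule the property passes from generators to words, and then by linearity
  to the subalgebra.\<close>

lemma dif_subalg:
  assumes "homogeneous_gens A S" "\<And>s. s \<in> S \<Longrightarrow> dif A s \<in> subalg A S" "x \<in> subalg A S"
  shows "dif A x \<in> subalg A S"
proof -
  have W: "{w. \<exists>n. word A S n w} \<subseteq> carrier A" using word_closed by blast
  have wS: "w \<in> subalg A S" if "word A S n w" for n w
    using that subalg_eq_lspan_words[OF assms(1)] by (auto intro: lspan.incl)
  have dw: "dif A w \<in> subalg A S" if "word A S n w" for n w
    using that
  proof (induction rule: word.induct)
    case (cons s d n w)
    then show ?case
      using leibniz[OF cons(2) word_closed[OF cons(4)]] assms(2) wS
      by (auto intro!: subalg.add subalg.mult subalg.smult intro: subalg.incl)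
  qed (simp add: subalg_zero)
  from assms(1,3) have "x \<in> lspan A {w. \<exists>n. word A S n w}" by (simp add: subalg_eq_lspan_words)
  then show ?thesis
    by induction (use dw lspan_closed[OF _ W] in \<open>auto intro: subalg_zero subalg.add subalg.smult\<close>)
qed

end

section \<open>Algebra maps\<close>

text \<open>Degrees and differentials are left out on purpose: the universal property of a free
  algebra yields a bare algebra homomorphism, and both compatibilities are then checked on
  generators.\<close>

locale algebra_map = A: differential_algebra A + B: differential_algebra B
  for A :: "('a, 'y) dga_scheme" (structure) and B :: "('b, 'z) dga_scheme" (structure) +
  fixes f :: "'a \<Rightarrow> 'b"
  assumes alg_hom: "f \<in> alg_hom A B"

sublocale algebra_map \<subseteq> rat_linear A B f
  using alg_hom by unfold_locales (simp add: alg_hom_def)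

context algebra_map
begin

lemma mult [simp]: "\<lbrakk>x \<in> carrier A; y \<in> carrier A\<rbrakk> \<Longrightarrow> f (x \<otimes>\<^bsub>A\<^esub> y) = f x \<otimes>\<^bsub>B\<^esub> f y"
  using alg_hom by (auto simp: alg_hom_def Ring.ring_hom_def)

lemma one [simp]: "f \<one>\<^bsub>A\<^esub> = \<one>\<^bsub>B\<^esub>"
  using alg_hom by (auto simp: alg_hom_def Ring.ring_hom_def)

lemma subalg_image:
  assumes "S \<subseteq> carrier A" "x \<in> subalg A S"
  shows "f x \<in> subalg B (f ` S)"
  using assms(2)
proof induction
  case one then show ?case by (simp add: subalg.one)
next
  case (incl x) then show ?case by (auto intro: subalg.incl)
next
  case (smult x c) then show ?case using A.subalg_closed[OF _ assms(1)] by (simp add: subalg.smult)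
next
  case (add x y) then show ?case using A.subalg_closed[OF _ assms(1)] by (simp add: subalg.add)
next
  case (mult x y) then show ?case using A.subalg_closed[OF _ assms(1)] by (simp add: subalg.mult)
qed

lemma subalg_image_subset:
  assumes "S \<subseteq> carrier A" "f ` S \<subseteq> subalg B T" "x \<in> subalg A S"
  shows "f x \<in> subalg B T"
  using subalg_image[OF assms(1,3)] subalg_least[OF assms(2)] by blast

lemma agree_on_subalg:
  assumes "algebra_map A B g" "S \<subseteq> carrier A" "\<And>s. s \<in> S \<Longrightarrow> f s = g s" "x \<in> subalg A S"
  shows "f x = g x"
proof -
  interpret g: algebra_map A B g by fact
  from assms(4) have "x \<in> carrier A \<and> f x = g x"
  proof induction
    case (smult x c) then show ?case using smult g.smult by auto
  next
    case (add x y) then show ?case using add g.add by auto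
  next
    case (mult x y) then show ?case using mult g.mult by auto
  qed (use assms(2,3) in auto)
  then show ?thesis ..
qed

lemma word_image_grade:
  assumes "\<And>s d. \<lbrakk>s \<in> S; s \<in> grade A d; 0 < d\<rbrakk> \<Longrightarrow> f s \<in> grade B d" "word A S n w"
  shows "f w \<in> grade B n"
  using assms(2)
proof (induction rule: word.induct)
  case empty then show ?case using B.one_grade by simp
next
  case (cons s d n w)
  then show ?case
    using B.mult_grade[OF assms(1) cons.IH] A.grade_closed A.word_closed by simp
qed

text \<open>A homogeneous element is a combination of words of its own degree, and the image of a
  word has the right degree letter by letter.\<close>

lemma grade_image:
  assumes "homogeneous_gens A S" "carrier A = subalg A S"
    and "\<And>s d. \<lbrakk>s \<in> S; s \<in> grade A d; 0 < d\<rbrakk> \<Longrightarrow> f s \<in> grade B d" and "x \<in> grade A n"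
  shows "f x \<in> grade B n"
proof -
  have W: "{w. word A S n w} \<subseteq> carrier A" using A.word_closed by blast
  have "x \<in> lspan A {w. word A S n w}"
    using A.component_subalg[OF assms(1), of x n] A.component_grade[OF assms(4), of n]
      A.grade_closed[OF assms(4)] assms(2) by simp
  then have "f x \<in> lspan B (f ` {w. word A S n w})"
    using lspan_image[OF W] by blast
  moreover have "lspan B (f ` {w. word A S n w}) \<subseteq> grade B n"
    using word_image_grade[OF assms(3)] by (intro B.lspan_least B.grade_subspace) blast
  ultimately show ?thesis by blast
qed

text \<open>The condition on degrees is what makes the Leibniz signs in source and target
  agree.\<close>

lemma dif_commutes:
  assumes "homogeneous_gens A S"
    and grade: "\<And>s d. \<lbrakk>s \<in> S; s \<in> grade A d; 0 < d\<rbrakk> \<Longrightarrow> f s \<in> grade B d"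
    and dif: "\<And>s. s \<in> S \<Longrightarrow> f (dif A s) = dif B (f s)" and "x \<in> subalg A S"
  shows "f (dif A x) = dif B (f x)"
proof -
  have W: "{w. \<exists>n. word A S n w} \<subseteq> carrier A" using A.word_closed by blast
  have dw: "f (dif A w) = dif B (f w)" if "word A S n w" for n w
    using that
  proof (induction rule: word.induct)
    case (cons s d n w)
    note s = A.grade_closed[OF cons(2)] and w = A.word_closed[OF cons(4)]
    have "f (dif A (s \<otimes>\<^bsub>A\<^esub> w)) = f (dif A s) \<otimes>\<^bsub>B\<^esub> f w \<oplus>\<^bsub>B\<^esub> ((- 1) ^ d \<odot>\<^bsub>B\<^esub> (f s \<otimes>\<^bsub>B\<^esub> f (dif A w)))"
      using A.leibniz[OF cons(2) w] s w by simp
    also have "\<dots> = dif B (f s) \<otimes>\<^bsub>B\<^esub> f w \<oplus>\<^bsub>B\<^esub> ((- 1) ^ d \<odot>\<^bsub>B\<^esub> (f s \<otimes>\<^bsub>B\<^esub> dif B (f w)))"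
      using dif[OF cons(1)] cons.IH by simp
    also have "\<dots> = dif B (f s \<otimes>\<^bsub>B\<^esub> f w)"
      using B.leibniz[OF grade[OF cons(1-3)], of "f w"] w by simp
    finally show ?case using s w by simp
  qed simp
  from assms(1,4) have "x \<in> lspan A {w. \<exists>n. word A S n w}" by (simp add: A.subalg_eq_lspan_words)
  then show ?thesis
  proof induction
    case (incl x) then show ?case using dw by blast
  next
    case (smult x c) then show ?case using A.lspan_closed[OF _ W] by simp
  next
    case (add x y) then show ?case using A.lspan_closed[OF _ W] by simp
  qed simp
qed

lemma dga_homI:
  assumes "\<And>x n. x \<in> grade A n \<Longrightarrow> f x \<in> grade B n" "\<And>x. x \<in> carrier A \<Longrightarrow> f (dif A x) = dif B (f x)"
  shows "f \<in> dga_hom A B"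
  using assms alg_hom by (auto simp: dga_hom_def)

end

locale dga_map = A: differential_algebra A + B: differential_algebra B
  for A :: "('a, 'y) dga_scheme" (structure) and B :: "('b, 'z) dga_scheme" (structure) +
  fixes f :: "'a \<Rightarrow> 'b"
  assumes dga_hom: "f \<in> dga_hom A B"

sublocale dga_map \<subseteq> algebra_map
  using dga_hom by unfold_locales (simp add: dga_hom_def)

context dga_map
begin

lemma grade: "x \<in> grade A n \<Longrightarrow> f x \<in> grade B n"
  using dga_hom by (auto simp: dga_hom_def)

lemma dif: "x \<in> carrier A \<Longrightarrow> f (dif A x) = dif B (f x)"
  using dga_hom by (auto simp: dga_hom_def)

lemma component: "x \<in> carrier A \<Longrightarrow> component B n (f x) = f (component A n x)"
proof (induction rule: A.carrier_homogeneous_induct)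
  case (homogeneous m x)
  then show ?case
    using A.component_grade[OF homogeneous] B.component_grade[OF grade[OF homogeneous]] by simp
qed (simp_all add: A.component_zero A.component_add A.component_smult
    B.component_zero B.component_add B.component_smult)

end

section \<open>Differential subalgebras\<close>

lemma sub_dga_simps [simp]:
  "carrier (sub_dga A S) = subalg A S" "grade (sub_dga A S) n = grade A n \<inter> subalg A S"
  "dif (sub_dga A S) = dif A" "mult (sub_dga A S) = mult A" "add (sub_dga A S) = add A"
  "zero (sub_dga A S) = zero A" "one (sub_dga A S) = one A" "smult (sub_dga A S) = smult A"
  by (simp_all add: sub_dga_def)

lemma lspan_cong:
  assumes "zero V = zero W" "add V = add W" "smult V = smult W"
  shows "lspan V S = lspan W S"
proof -
  have "x \<in> lspan W S" if "x \<in> lspan V S" "zero V = zero W" "add V = add W" "smult V = smult W"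
    for x and V :: "(rat, 'a, 'b) module_scheme" and W :: "(rat, 'a, 'c) module_scheme"
    using that(1)
    by induction (use that(2-) in \<open>auto intro: lspan.intros\<close>)
  moreover have "x \<in> lspan V S" if "x \<in> lspan W S" "zero V = zero W" "add V = add W" "smult V = smult W"
    for x and V :: "(rat, 'a, 'b) module_scheme" and W :: "(rat, 'a, 'c) module_scheme"
    using that(1)
  proof induction
    case zero then show ?case using lspan.zero[of V S] that by simp
  next
    case (smult x c) then show ?case using lspan.smult[of x V S c] that by simp
  next
    case (add x y) then show ?case using lspan.add[of x V S y] that by simp
  qed (rule lspan.incl)
  ultimately show ?thesis using assms by blast
qed

text \<open>The only axiom that is not inherited formally is the decomposition into degrees. The
  projections \<open>component A\<close> supply it, since homogeneity of the generators keeps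
  components inside the subalgebra.\<close>

lemma sub_dga_differential_algebra:
  fixes A :: "'a dga"
  assumes "differential_algebra A" "homogeneous_gens A S" "\<And>s. s \<in> S \<Longrightarrow> dif A s \<in> subalg A S"
  shows "differential_algebra (sub_dga A S)"
proof -
  interpret A: differential_algebra A by fact
  have SC: "S \<subseteq> carrier A" by (rule A.homogeneous_gens_closed[OF assms(2)])
  have cl: "x \<in> carrier A" if "x \<in> subalg A S" for x by (rule A.subalg_closed[OF that SC])
  let ?N = "sub_dga A S"
  interpret N: rat_space ?N
  proof (rule rat_space_surj_image[where f = id])
    show "rat_space (A\<lparr>carrier := subalg A S\<rparr>)" by (rule A.rat_space_subsp[OF A.subalg_subsp[OF SC]])
  qed simp_all
  have N_subsp: "N.subsp W" if "A.subsp W" "W \<subseteq> subalg A S" for W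
    using that by (auto simp: N.subsp_iff A.subsp_iff)
  have gr: "N.subsp (grade A n \<inter> subalg A S)" for n
    by (intro N_subsp A.subsp_Int A.grade_subspace A.subalg_subsp SC Int_lower2)
  show ?thesis
  proof (rule differential_algebra.intro)
    show "ring ?N"
      by (rule ringI, rule N.abelian_group_axioms, rule monoidI)
        (auto intro: subalg.one subalg.mult simp: cl A.m_assoc A.l_distr A.r_distr)
    show "vectorspace QQ ?N" using N.rat_space_axioms by (simp add: rat_space_iff)
    show "N.subsp (grade ?N n)" for n using gr by simp
    show "\<exists>!f. (\<forall>n. f n \<in> grade ?N n) \<and> finite {n. f n \<noteq> \<zero>\<^bsub>?N\<^esub>} \<and>
      x = (\<Oplus>\<^bsub>?N\<^esub>n\<in>{n. f n \<noteq> \<zero>\<^bsub>?N\<^esub>}. f n)" if x: "x \<in> carrier ?N" for x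
    proof (rule N.direct_sum_by_projections[where p = "component A"])
      show "N.subsp (grade ?N n)" for n using gr by simp
      show "linear ?N ?N (component A n)" for n
        by (simp add: linear_iff A.component_in_subalg[OF assms(2)] cl A.component_add A.component_smult)
      show "component A n x \<in> grade ?N n" if "x \<in> carrier ?N" for n x
        using that A.component_in_subalg[OF assms(2)] A.component_props(1) cl by simp
      show "component A n x = x" if "x \<in> grade ?N n" for n x
        using that A.component_grade[of x n] by simp
      show "component A n x = \<zero>\<^bsub>?N\<^esub>" if "x \<in> grade ?N m" "m \<noteq> n" for m n x
        using that A.component_grade[of x m] by simp
      have x': "x \<in> subalg A S" using x by simp
      have "(\<Oplus>\<^bsub>A\<^esub>n\<in>{n. component A n x \<noteq> \<zero>\<^bsub>A\<^esub>}. component A n x) \<in> lspan A (\<Union>n. grade A n \<inter> subalg A S)"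
        using A.component_in_subalg[OF assms(2) x'] A.component_props(1)[OF cl[OF x']] cl
        by (intro A.finsum_in_subsp A.subsp_lspan) (auto intro: lspan.incl)
      then have "x \<in> lspan A (\<Union>n. grade A n \<inter> subalg A S)"
        using A.component_props(3)[OF cl[OF x']] by simp
      then show "x \<in> lspan ?N (\<Union>n. grade ?N n)"
        using lspan_cong[of A ?N] by simp
    qed
    show "linear ?N ?N (dif ?N)"
      using A.dif_subalg[OF assms(2,3)] by (simp add: linear_iff cl)
    show "x \<otimes>\<^bsub>?N\<^esub> y = (- 1) ^ (m * n) \<odot>\<^bsub>?N\<^esub> (y \<otimes>\<^bsub>?N\<^esub> x)"
      if "x \<in> grade ?N m" "y \<in> grade ?N n" for x y m n
      using that A.graded_commutative by simp
    show "dif ?N (x \<otimes>\<^bsub>?N\<^esub> y) = (dif ?N x \<otimes>\<^bsub>?N\<^esub> y) \<oplus>\<^bsub>?N\<^esub> ((- 1) ^ m \<odot>\<^bsub>?N\<^esub> (x \<otimes>\<^bsub>?N\<^esub> dif ?N y))"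
      if "x \<in> grade ?N m" "y \<in> carrier ?N" for x y m
      using that A.leibniz cl by simp
  qed (use cl A.smult_mult_left A.smult_mult_right A.one_grade A.mult_grade A.dif_dif A.dif_grade
      A.dif_subalg[OF assms(2,3)] in \<open>auto intro: subalg.one subalg.mult\<close>)
qed

lemma dga_hom_sub_dga:
  assumes "f \<in> dga_hom A B" "subalg A S \<subseteq> carrier A"
  shows "f \<in> dga_hom (sub_dga A S) B"
  using assms
  by (auto simp: dga_hom_def alg_hom_def Ring.ring_hom_def LinearCombinations.module_hom_def subset_iff)

section \<open>The cohomology algebra\<close>

context differential_algebra
begin

lemma cocyclesD: "z \<in> cocycles A \<Longrightarrow> z \<in> carrier A" "z \<in> cocycles A \<Longrightarrow> dif A z = \<zero>"
  by (auto simp: cocycles_def)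

lemma subsp_cocycles: "subsp (cocycles A)"
  by (rule subspI) (auto simp: cocycles_def)

lemma subsp_coboundaries: "subsp (coboundaries A)"
  unfolding coboundaries_def by (rule dif.subsp_image[OF subsp_carrier])

lemma coboundaries_subset_cocycles: "coboundaries A \<subseteq> cocycles A"
  by (auto simp: coboundaries_def cocycles_def dif_dif)

sublocale coh: rat_quotient A "cocycles A" "coboundaries A"
  by (intro rat_quotient.intro rat_quotient_axioms.intro rat_space_axioms
      subsp_cocycles subsp_coboundaries coboundaries_subset_cocycles)

lemma coh_class_eq_qclass: "coh_class A = qclass A (coboundaries A)"
  by (rule ext) (simp add: coh_class_def qclass_def)

lemma component_cocycle: "z \<in> cocycles A \<Longrightarrow> component A n z \<in> cocycles A"
  using component_dif[of z n] by (simp add: cocycles_def component_zero)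

text \<open>The components of a cocycle are cocycles, because the differential is homogeneous of
  degree one.\<close>

lemma cocycle_homogeneous_induct [consumes 1, case_names zero homogeneous smult add]:
  assumes "z \<in> cocycles A" "P \<zero>" "\<And>n x. \<lbrakk>x \<in> cocycles A; x \<in> grade A n\<rbrakk> \<Longrightarrow> P x"
    "\<And>c x. \<lbrakk>x \<in> cocycles A; P x\<rbrakk> \<Longrightarrow> P (c \<odot> x)"
    "\<And>x y. \<lbrakk>x \<in> cocycles A; y \<in> cocycles A; P x; P y\<rbrakk> \<Longrightarrow> P (x \<oplus> y)"
  shows "P z"
proof -
  let ?G = "\<Union>n. cocycles A \<inter> grade A n"
  have G: "?G \<subseteq> carrier A" using grade_closed by blast
  have zc: "z \<in> carrier A" by (rule cocyclesD[OF assms(1)])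
  have "(\<Oplus>n\<in>{n. component A n z \<noteq> \<zero>}. component A n z) \<in> lspan A ?G"
    using component_cocycle[OF assms(1)] component_props(1)[OF zc]
    by (intro finsum_in_subsp subsp_lspan G) (blast intro: lspan.incl)
  then have "z \<in> lspan A ?G" using component_props(3)[OF zc] by simp
  then have "z \<in> cocycles A \<and> P z"
  proof induction
    case zero then show ?case using assms(2) subspD(2)[OF subsp_cocycles] by blast
  next
    case (incl x) then show ?case using assms(3) by blast
  next
    case (smult x c) then show ?case using assms(4) subspD(4)[OF subsp_cocycles] by blast
  next
    case (add x y) then show ?case using assms(5) subspD(3)[OF subsp_cocycles] by blast
  qed
  then show ?thesis ..
qed

text \<open>Together with \<open>dif_mult_cocycle\<close> this is the ideal property of coboundaries
  among cocycles, which makes the product of cohomology classes well defined.\<close>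

lemma cocycle_mult_dif:
  assumes "z \<in> cocycles A" "y \<in> carrier A"
  shows "z \<otimes> dif A y \<in> coboundaries A"
  using assms(1)
proof (induction rule: cocycle_homogeneous_induct)
  case zero then show ?case using assms(2) subspD(2)[OF subsp_coboundaries] by simp
next
  case (homogeneous n x)
  note x = cocyclesD[OF homogeneous(1)]
  have "dif A (x \<otimes> y) = (- 1) ^ n \<odot> (x \<otimes> dif A y)"
    using leibniz[OF homogeneous(2) assms(2)] x assms(2) by simp
  \<comment> \<open>The Leibniz sign is its own inverse, so it can be moved to the other
    side.\<close>
  then have "(- 1) ^ n \<odot> dif A (x \<otimes> y) = x \<otimes> dif A y"
    using x assms(2) by (simp add: smult_smult flip: power_mult_distrib)
  moreover have "(- 1) ^ n \<odot> dif A (x \<otimes> y) \<in> coboundaries A"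
    using x assms(2) by (intro subspD(4)[OF subsp_coboundaries]) (auto simp: coboundaries_def)
  ultimately show ?case by simp
next
  case (smult c x)
  then show ?case using assms(2) cocyclesD(1) by (simp add: smult_mult_left subspD(4)[OF subsp_coboundaries])
next
  case (add x z)
  then show ?case using assms(2) cocyclesD(1) by (simp add: l_distr subspD(3)[OF subsp_coboundaries])
qed

lemma dif_mult_cocycle:
  assumes "z \<in> cocycles A" "y \<in> carrier A"
  shows "dif A y \<otimes> z \<in> coboundaries A"
  using assms(2)
proof (induction rule: carrier_homogeneous_induct)
  case zero then show ?case using cocyclesD[OF assms(1)] subspD(2)[OF subsp_coboundaries] by simp
next
  case (homogeneous n x)
  have "dif A (x \<otimes> z) = dif A x \<otimes> z"
    using leibniz[OF homogeneous cocyclesD(1)[OF assms(1)]] cocyclesD[OF assms(1)] grade_closed[OF homogeneous]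
    by simp
  then show ?case
    using grade_closed[OF homogeneous] cocyclesD(1)[OF assms(1)] unfolding coboundaries_def
    by (metis image_eqI m_closed)
next
  case (smult c x)
  then show ?case using cocyclesD(1)[OF assms(1)] by (simp add: smult_mult_left subspD(4)[OF subsp_coboundaries])
next
  case (add x z)
  then show ?case using cocyclesD(1)[OF assms(1)] by (simp add: l_distr subspD(3)[OF subsp_coboundaries])
qed

lemma cocycle_mult:
  assumes "z \<in> cocycles A" "w \<in> cocycles A"
  shows "z \<otimes> w \<in> cocycles A"
  using assms(1)
proof (induction rule: cocycle_homogeneous_induct)
  case zero then show ?case using cocyclesD[OF assms(2)] subspD(2)[OF subsp_cocycles] by simp
next
  case (homogeneous n x)
  then show ?case
    using leibniz[OF homogeneous(2) cocyclesD(1)[OF assms(2)]] cocyclesD[OF assms(2)] cocyclesD[OF homogeneous(1)]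
    by (simp add: cocycles_def)
next
  case (smult c x)
  then show ?case using cocyclesD(1)[OF assms(2)] cocyclesD(1) by (simp add: smult_mult_left subspD(4)[OF subsp_cocycles])
next
  case (add x z)
  then show ?case using cocyclesD(1)[OF assms(2)] cocyclesD(1) by (simp add: l_distr subspD(3)[OF subsp_cocycles])
qed

lemma one_cocycle: "\<one> \<in> cocycles A"
  by (simp add: cocycles_def)

abbreviation H :: "'a set dga" where "H \<equiv> cohomology A"
abbreviation cls :: "'a \<Rightarrow> 'a set" where "cls \<equiv> coh_class A"

lemma cohomology_select:
  "carrier H = carrier coh.Q" "zero H = zero coh.Q" "add H = add coh.Q" "smult H = smult coh.Q"
  "mult H = mult coh.Q" "one H = one coh.Q"
  "dif H x = coboundaries A" "grade H n = cls ` (cocycles A \<inter> grade A n)"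
  by (simp_all add: cohomology_def module.extend_def dga.fields_def)

lemma coh_carrier: "carrier H = cls ` cocycles A"
  by (simp add: cohomology_select coh.Q_carrier coh_class_eq_qclass)

lemma coh_grade: "grade H n = cls ` (cocycles A \<inter> grade A n)"
  by (rule cohomology_select)

lemma cls_zero: "\<zero>\<^bsub>H\<^esub> = cls \<zero>"
  by (simp add: cohomology_select coh.Q_zero coh_class_eq_qclass)

lemma coh_dif: "dif H x = \<zero>\<^bsub>H\<^esub>"
  by (simp add: cohomology_select quotient_module_def ring.extend_def module.fields_def FactRing_def)

lemma cls_add: "\<lbrakk>x \<in> carrier A; y \<in> carrier A\<rbrakk> \<Longrightarrow> cls x \<oplus>\<^bsub>H\<^esub> cls y = cls (x \<oplus> y)"
  by (simp add: cohomology_select coh.Q_add coh_class_eq_qclass)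

lemma cls_smult: "x \<in> carrier A \<Longrightarrow> c \<odot>\<^bsub>H\<^esub> cls x = cls (c \<odot> x)"
  by (simp add: cohomology_select coh.Q_smult coh_class_eq_qclass)

lemma cls_eq_iff: "\<lbrakk>x \<in> carrier A; y \<in> carrier A\<rbrakk> \<Longrightarrow> cls x = cls y \<longleftrightarrow> x \<ominus> y \<in> coboundaries A"
  by (simp add: coh.qclass_eq_iff coh_class_eq_qclass)

lemma cls_eq_zero_iff: "x \<in> carrier A \<Longrightarrow> cls x = \<zero>\<^bsub>H\<^esub> \<longleftrightarrow> x \<in> coboundaries A"
  by (simp add: cls_zero cls_eq_iff)

lemma cls_one: "\<one>\<^bsub>H\<^esub> = cls \<one>"
  by (simp add: cohomology_select quotient_module_def ring.extend_def module.fields_def FactRing_def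
      coh_class_def a_r_coset_def')

lemma mem_clsD:
  assumes "a \<in> cls x" "x \<in> cocycles A"
  shows "a \<in> cocycles A" "a \<ominus> x \<in> coboundaries A"
proof -
  have a: "a \<in> carrier A"
    using coh.qclass_closed[OF cocyclesD(1)[OF assms(2)]] assms(1) by (simp add: coh_class_eq_qclass)
  then show ax: "a \<ominus> x \<in> coboundaries A"
    using coh.mem_qclass_iff[OF cocyclesD(1)[OF assms(2)]] assms(1) by (simp add: coh_class_eq_qclass)
  have "a = (a \<ominus> x) \<oplus> x" using a cocyclesD(1)[OF assms(2)] minus_add_cancel by simp
  then show "a \<in> cocycles A"
    using ax assms(2) coboundaries_subset_cocycles subspD(3)[OF subsp_cocycles] by (metis subset_iff)
qed

lemma self_mem_cls: "x \<in> carrier A \<Longrightarrow> x \<in> cls x"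
  using coh.mem_qclass_iff[of x x] subspD(2)[OF subsp_coboundaries] by (simp add: coh_class_eq_qclass)

lemma cls_mult:
  assumes x: "x \<in> cocycles A" and y: "y \<in> cocycles A"
  shows "cls x \<otimes>\<^bsub>H\<^esub> cls y = cls (x \<otimes> y)"
proof -
  note xc = cocyclesD(1)[OF x] and yc = cocyclesD(1)[OF y]
  have "cls x \<otimes>\<^bsub>H\<^esub> cls y = (\<Union>a\<in>cls x. \<Union>b\<in>cls y. cls (a \<otimes> b))"
    by (simp add: cohomology_select quotient_module_def ring.extend_def module.fields_def FactRing_def
      coh_class_def a_r_coset_def' rcoset_mult_def)
  also have "\<dots> = (\<Union>a\<in>cls x. \<Union>b\<in>cls y. cls (x \<otimes> y))"
  proof (intro SUP_cong refl)
    fix a b assume "a \<in> cls x" "b \<in> cls y"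
    note a = mem_clsD[OF this(1) x] and b = mem_clsD[OF this(2) y]
    note ac = cocyclesD(1)[OF a(1)] and bc = cocyclesD(1)[OF b(1)]
    obtain u where u: "u \<in> carrier A" "a \<ominus> x = dif A u" using a(2) by (auto simp: coboundaries_def)
    obtain v where v: "v \<in> carrier A" "b \<ominus> y = dif A v" using b(2) by (auto simp: coboundaries_def)
    \<comment> \<open>The difference of the two products is telescoped through
      \<open>x \<otimes> b\<close>, so that each summand has one exact factor and one closed
      factor.\<close>
    have "(a \<ominus> x) \<otimes> b \<oplus> x \<otimes> (b \<ominus> y) = (a \<otimes> b \<ominus> x \<otimes> b) \<oplus> (x \<otimes> b \<ominus> x \<otimes> y)"
      using ac bc xc yc by (simp add: a_minus_def l_distr r_distr l_minus r_minus)
    also have "\<dots> = a \<otimes> b \<ominus> x \<otimes> y"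
      using ac bc xc yc by (intro minus_trans) auto
    finally have "a \<otimes> b \<ominus> x \<otimes> y \<in> coboundaries A"
      using cocycle_mult_dif[OF x v(1)] dif_mult_cocycle[OF b(1) u(1)] u v subspD(3)[OF subsp_coboundaries]
      by metis
    then show "cls (a \<otimes> b) = cls (x \<otimes> y)" using ac bc xc yc by (simp add: cls_eq_iff)
  qed
  also have "\<dots> = cls (x \<otimes> y)"
    using self_mem_cls[OF xc] self_mem_cls[OF yc] by blast
  finally show ?thesis .
qed

lemma rat_space_H: "rat_space H"
  by (rule rat_space_surj_image[where V = "A\<lparr>carrier := cocycles A\<rparr>" and f = cls])
    (simp_all add: rat_space_subsp subsp_cocycles coh_carrier cls_add cls_smult cls_zero cocyclesD)

lemma linear_cls: "linear (A\<lparr>carrier := cocycles A\<rparr>) H cls"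
  by (simp add: linear_iff coh_carrier cls_add cls_smult cocyclesD)

lemma rat_linear_cls: "rat_linear (A\<lparr>carrier := cocycles A\<rparr>) H cls"
  by (intro rat_linear.intro rat_linear_axioms.intro rat_space_H linear_cls rat_space_subsp subsp_cocycles)

lemma subsp_cls_image:
  assumes "subsp U" "U \<subseteq> cocycles A"
  shows "VectorSpace.subspace QQ (cls ` U) H"
proof -
  interpret cl: rat_linear "A\<lparr>carrier := cocycles A\<rparr>" H cls by (rule rat_linear_cls)
  have "cl.V.subsp U" using assms unfolding cl.V.subsp_iff subsp_iff by simp
  then show ?thesis by (rule cl.subsp_image)
qed

lemma lspan_cls: "S \<subseteq> cocycles A \<Longrightarrow> lspan H (cls ` S) = cls ` lspan A S"
  using rat_linear.lspan_image[OF rat_linear_cls, of S] by (simp add: lspan_carrier_update)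

lemma subsp_coh_grade: "VectorSpace.subspace QQ (grade H n) H"
  unfolding coh_grade by (intro subsp_cls_image subsp_Int subsp_cocycles grade_subspace Int_lower1)

lemma component_coboundary:
  assumes "x \<in> coboundaries A"
  shows "component A n x \<in> coboundaries A"
proof -
  obtain u where u: "u \<in> carrier A" "x = dif A u" using assms by (auto simp: coboundaries_def)
  show ?thesis
  proof (cases n)
    case 0
    then show ?thesis using u component_0_dif subspD(2)[OF subsp_coboundaries] by simp
  next
    case (Suc m)
    then show ?thesis using u component_dif component_closed unfolding coboundaries_def by auto
  qed
qed

text \<open>The component of degree \<open>n\<close> of any primitive is again a primitive, because
  the differential commutes with taking components up to the shift by one.\<close>

lemma grade_coboundary:
  assumes "x \<in> coboundaries A" "x \<in> grade A (Suc n)"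
  obtains u where "u \<in> grade A n" "x = dif A u"
proof -
  obtain u where u: "u \<in> carrier A" "x = dif A u" using assms by (auto simp: coboundaries_def)
  then have "x = dif A (component A n u)"
    using component_dif[of u n] component_grade[OF assms(2), of "Suc n"] by simp
  with that component_props(1)[OF u(1)] show ?thesis by blast
qed

lemma cohomology_differential_algebra: "differential_algebra H"
proof (rule differential_algebra.intro)
  interpret H: rat_space H by (rule rat_space_H)
  note Z = cocyclesD(1) subspD(3,4)[OF subsp_cocycles] cocycle_mult one_cocycle
  note ops = cls_add cls_mult cls_smult cls_one
  have HE: "\<exists>z\<in>cocycles A. x = cls z" if "x \<in> carrier H" for x using that by (auto simp: coh_carrier)
  have GE: "\<exists>z\<in>cocycles A. z \<in> grade A n \<and> x = cls z" if "x \<in> grade H n" for x n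
    using that by (auto simp: coh_grade)
  have clsH: "cls z \<in> carrier H" if "z \<in> cocycles A" for z using that by (simp add: coh_carrier)
  have clsG: "cls z \<in> grade H n" if "z \<in> cocycles A" "z \<in> grade A n" for z n using that by (simp add: coh_grade)
  show "ring H"
  proof (rule ringI, rule H.abelian_group_axioms, rule monoidI)
    fix x y z assume x: "x \<in> carrier H" and y: "y \<in> carrier H" and z: "z \<in> carrier H"
    obtain a b c where *: "a \<in> cocycles A" "b \<in> cocycles A" "c \<in> cocycles A" "x = cls a" "y = cls b" "z = cls c"
      using HE[OF x] HE[OF y] HE[OF z] by blast
    show "x \<otimes>\<^bsub>H\<^esub> y \<in> carrier H" "x \<otimes>\<^bsub>H\<^esub> y \<otimes>\<^bsub>H\<^esub> z = x \<otimes>\<^bsub>H\<^esub> (y \<otimes>\<^bsub>H\<^esub> z)"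
      "\<one>\<^bsub>H\<^esub> \<otimes>\<^bsub>H\<^esub> x = x" "x \<otimes>\<^bsub>H\<^esub> \<one>\<^bsub>H\<^esub> = x"
      "(x \<oplus>\<^bsub>H\<^esub> y) \<otimes>\<^bsub>H\<^esub> z = x \<otimes>\<^bsub>H\<^esub> z \<oplus>\<^bsub>H\<^esub> y \<otimes>\<^bsub>H\<^esub> z"
      "z \<otimes>\<^bsub>H\<^esub> (x \<oplus>\<^bsub>H\<^esub> y) = z \<otimes>\<^bsub>H\<^esub> x \<oplus>\<^bsub>H\<^esub> z \<otimes>\<^bsub>H\<^esub> y"
      using * by (simp_all add: ops Z clsH m_assoc l_distr r_distr)
  qed (simp add: cls_one clsH one_cocycle)
  show "vectorspace QQ H" using rat_space_H by (simp add: rat_space_iff)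
  show "(c \<odot>\<^bsub>H\<^esub> x) \<otimes>\<^bsub>H\<^esub> y = c \<odot>\<^bsub>H\<^esub> (x \<otimes>\<^bsub>H\<^esub> y)" "x \<otimes>\<^bsub>H\<^esub> (c \<odot>\<^bsub>H\<^esub> y) = c \<odot>\<^bsub>H\<^esub> (x \<otimes>\<^bsub>H\<^esub> y)"
    if xy: "x \<in> carrier H" "y \<in> carrier H" for x y c
  proof -
    obtain a b where "a \<in> cocycles A" "b \<in> cocycles A" "x = cls a" "y = cls b"
      using HE[OF xy(1)] HE[OF xy(2)] by blast
    then show "(c \<odot>\<^bsub>H\<^esub> x) \<otimes>\<^bsub>H\<^esub> y = c \<odot>\<^bsub>H\<^esub> (x \<otimes>\<^bsub>H\<^esub> y)" "x \<otimes>\<^bsub>H\<^esub> (c \<odot>\<^bsub>H\<^esub> y) = c \<odot>\<^bsub>H\<^esub> (x \<otimes>\<^bsub>H\<^esub> y)"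
      by (simp_all add: ops Z smult_mult_left smult_mult_right)
  qed
  show gr: "H.subsp (grade H n)" for n by (rule subsp_coh_grade)
  show "\<exists>!f. (\<forall>n. f n \<in> grade H n) \<and> finite {n. f n \<noteq> \<zero>\<^bsub>H\<^esub>} \<and> x = (\<Oplus>\<^bsub>H\<^esub>n\<in>{n. f n \<noteq> \<zero>\<^bsub>H\<^esub>}. f n)"
    if x: "x \<in> carrier H" for x
  proof -
    \<comment> \<open>The projections of the cohomology are induced by those of \<open>A\<close>.
      They do not depend on the representative, as components of coboundaries are
      coboundaries.\<close>
    define p where "p n c = cls (component A n (SOME z. z \<in> cocycles A \<and> c = cls z))" for n c
    have p: "p n (cls z) = cls (component A n z)" if z: "z \<in> cocycles A" for n z
    proof -
      define w where "w = (SOME w. w \<in> cocycles A \<and> cls z = cls w)"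
      have w: "w \<in> cocycles A \<and> cls z = cls w" unfolding w_def by (rule someI[of _ z]) (simp add: z)
      then have "w \<ominus> z \<in> coboundaries A" using z cocyclesD(1) cls_eq_iff by metis
      then have "component A n w \<ominus> component A n z \<in> coboundaries A"
        using component_coboundary[of "w \<ominus> z" n] component_minus[of w z n] w z cocyclesD(1) by auto
      then have "cls (component A n w) = cls (component A n z)"
        using w z cocyclesD(1) by (simp add: cls_eq_iff)
      then show ?thesis by (simp add: p_def w_def)
    qed
    show ?thesis
    proof (rule H.direct_sum_by_projections[where p = p])
      show "linear H H (p n)" for n
        unfolding linear_iff
      proof (intro conjI ballI allI funcsetI)
        fix x y c assume x: "x \<in> carrier H" and y: "y \<in> carrier H"
        obtain a b where *: "a \<in> cocycles A" "b \<in> cocycles A" "x = cls a" "y = cls b"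
          using HE[OF x] HE[OF y] by blast
        then show "p n x \<in> carrier H" "p n (x \<oplus>\<^bsub>H\<^esub> y) = p n x \<oplus>\<^bsub>H\<^esub> p n y"
          "p n (c \<odot>\<^bsub>H\<^esub> x) = c \<odot>\<^bsub>H\<^esub> p n x"
          by (simp_all add: p ops Z clsH component_add component_smult component_cocycle)
      qed
      show "p n x \<in> grade H n" if "x \<in> carrier H" for n x
        using HE[OF that] component_props(1) cocyclesD(1) component_cocycle by (auto simp: p intro!: clsG)
      show "p n x = x" if "x \<in> grade H n" for n x
        using GE[OF that] component_grade by (auto simp: p)
      show "p n x = \<zero>\<^bsub>H\<^esub>" if "x \<in> grade H m" "m \<noteq> n" for m n x
        using GE[OF that(1)] component_grade that(2) by (auto simp: p cls_zero)
      have "cls z \<in> lspan H (\<Union>n. grade H n)" if "z \<in> cocycles A" for z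
        using that
      proof (induction rule: cocycle_homogeneous_induct)
        case zero then show ?case by (simp add: lspan.zero flip: cls_zero)
      next
        case (homogeneous n z) then show ?case using clsG by (blast intro: lspan.incl)
      next
        case (smult c x) then show ?case by (simp add: lspan.smult cocyclesD(1) flip: cls_smult)
      next
        case (add x y) then show ?case by (simp add: lspan.add cocyclesD(1) flip: cls_add)
      qed
      then show "x \<in> lspan H (\<Union>n. grade H n)" using HE[OF x] by auto
    qed (rule gr)
  qed
  show "\<one>\<^bsub>H\<^esub> \<in> grade H 0" by (simp add: cls_one clsG one_cocycle one_grade)
  show "x \<otimes>\<^bsub>H\<^esub> y \<in> grade H (m + n)" "x \<otimes>\<^bsub>H\<^esub> y = (- 1) ^ (m * n) \<odot>\<^bsub>H\<^esub> (y \<otimes>\<^bsub>H\<^esub> x)"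
    if xy: "x \<in> grade H m" "y \<in> grade H n" for x y m n
  proof -
    obtain a b where *: "a \<in> cocycles A" "b \<in> cocycles A" "x = cls a" "y = cls b"
       "a \<in> grade A m" "b \<in> grade A n"
      using GE[OF xy(1)] GE[OF xy(2)] by blast
    then show "x \<otimes>\<^bsub>H\<^esub> y \<in> grade H (m + n)" by (simp add: ops Z clsG mult_grade)
    have "x \<otimes>\<^bsub>H\<^esub> y = cls (a \<otimes> b)" using * by (simp add: ops)
    also have "\<dots> = cls ((- 1) ^ (m * n) \<odot> (b \<otimes> a))"
      using graded_commutative[OF *(5,6)] by simp
    also have "\<dots> = (- 1) ^ (m * n) \<odot>\<^bsub>H\<^esub> (y \<otimes>\<^bsub>H\<^esub> x)" using * by (simp add: ops Z)
    finally show "x \<otimes>\<^bsub>H\<^esub> y = (- 1) ^ (m * n) \<odot>\<^bsub>H\<^esub> (y \<otimes>\<^bsub>H\<^esub> x)" .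
  qed
  show "linear H H (dif H)" by (simp add: linear_iff coh_dif)
  show "dif H x \<in> grade H (Suc n)" if "x \<in> grade H n" for x n
    using H.subspD(2)[OF gr] by (simp add: coh_dif)
  show "dif H (x \<otimes>\<^bsub>H\<^esub> y) = (dif H x \<otimes>\<^bsub>H\<^esub> y) \<oplus>\<^bsub>H\<^esub> ((- 1) ^ m \<odot>\<^bsub>H\<^esub> (x \<otimes>\<^bsub>H\<^esub> dif H y))"
    if xy: "x \<in> grade H m" "y \<in> carrier H" for x y m
  proof -
    obtain a b where *: "a \<in> cocycles A" "b \<in> cocycles A" "x = cls a" "y = cls b"
      using GE[OF xy(1)] HE[OF xy(2)] by blast
    then show ?thesis
      using subspD(2)[OF subsp_cocycles] by (simp add: coh_dif cls_zero ops cocyclesD(1))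
  qed
qed (simp add: coh_dif)

lemma finite_span_coh_grade:
  assumes "finite_span A (grade A n)"
  shows "finite_span H (grade H n)"
proof -
  interpret cl: rat_linear "A\<lparr>carrier := cocycles A\<rparr>" H cls by (rule rat_linear_cls)
  have "finite_span A (cocycles A \<inter> grade A n)"
    by (rule finite_span_subset[OF assms]) (auto intro: subsp_Int grade_subspace subsp_cocycles)
  then have "finite_span (A\<lparr>carrier := cocycles A\<rparr>) (cocycles A \<inter> grade A n)"
    by (simp add: finite_span_def lspan_carrier_update)
  then have "finite_span H (cls ` (cocycles A \<inter> grade A n))"
    by (rule cl.finite_span_image) simp
  then show ?thesis by (simp add: coh_grade)
qed

end

section \<open>Induced maps on cohomology\<close>

context dga_map
begin

lemma cocycle: "z \<in> cocycles A \<Longrightarrow> f z \<in> cocycles B"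
  by (auto simp: cocycles_def simp flip: dif)

lemma coboundary: "z \<in> coboundaries A \<Longrightarrow> f z \<in> coboundaries B"
  by (auto simp: coboundaries_def dif)

text \<open>All representatives of a class have cohomologous images, so \<open>coh_map\<close> takes
  the element of a genuine singleton.\<close>

lemma coh_map_class:
  assumes "z \<in> cocycles A"
  shows "coh_map B f (coh_class A z) = coh_class B (f z)"
proof -
  have zc: "z \<in> carrier A" by (rule A.cocyclesD[OF assms])
  have "coh_class B (f x) = coh_class B (f z)" if "x \<in> coh_class A z" for x
  proof -
    note x = A.mem_clsD[OF that assms]
    have "f x \<ominus>\<^bsub>B\<^esub> f z \<in> coboundaries B"
      using coboundary[OF x(2)] A.cocyclesD(1)[OF x(1)] zc by simp
    then show ?thesis using A.cocyclesD(1)[OF x(1)] zc by (simp add: B.cls_eq_iff)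
  qed
  then have "(\<lambda>x. coh_class B (f x)) ` coh_class A z = {coh_class B (f z)}"
    using A.self_mem_cls[OF zc] by blast
  then show ?thesis by (simp add: coh_map_def)
qed

lemma coh_map_inj_onD:
  assumes "inj_on (coh_map B f) (coh A k)" "z \<in> cocycles A" "z \<in> grade A k" "f z \<in> coboundaries B"
  shows "z \<in> coboundaries A"
proof -
  have 0: "\<zero>\<^bsub>A\<^esub> \<in> cocycles A" "\<zero>\<^bsub>A\<^esub> \<in> grade A k"
    using A.subspD(2)[OF A.subsp_cocycles] A.grade_zero by auto
  have "coh_map B f (coh_class A z) = coh_map B f (coh_class A \<zero>\<^bsub>A\<^esub>)"
    using assms A.cocyclesD(1) 0 by (simp add: coh_map_class B.cls_eq_iff)
  then have "coh_class A z = coh_class A \<zero>\<^bsub>A\<^esub>"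
    using assms(1-3) 0 unfolding inj_on_def A.coh_grade by blast
  then show ?thesis using assms(2) A.cocyclesD(1) by (simp add: A.cls_eq_iff)
qed

lemma coh_map_inj_onI:
  assumes "\<And>z. \<lbrakk>z \<in> cocycles A; z \<in> grade A k; f z \<in> coboundaries B\<rbrakk> \<Longrightarrow> z \<in> coboundaries A"
  shows "inj_on (coh_map B f) (coh A k)"
proof (rule inj_onI)
  fix x y assume "x \<in> coh A k" "y \<in> coh A k" "coh_map B f x = coh_map B f y"
  then obtain a b where *: "a \<in> cocycles A" "b \<in> cocycles A" "x = coh_class A a" "y = coh_class A b"
      "a \<in> grade A k" "b \<in> grade A k" "coh_class B (f a) = coh_class B (f b)"
    by (auto simp: A.coh_grade coh_map_class)
  then have "f (a \<ominus>\<^bsub>A\<^esub> b) \<in> coboundaries B" using A.cocyclesD(1) by (simp add: B.cls_eq_iff)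
  then have "a \<ominus>\<^bsub>A\<^esub> b \<in> coboundaries A"
    using * A.subspD(6)[OF A.subsp_cocycles] A.grade_minus by (intro assms) auto
  then show "x = y" using * A.cocyclesD(1) by (simp add: A.cls_eq_iff)
qed

end

section \<open>The universal property of free graded commutative algebras\<close>

definition wmult :: "('g list \<Rightarrow>\<^sub>0 rat) \<Rightarrow> ('g list \<Rightarrow>\<^sub>0 rat) \<Rightarrow> ('g list \<Rightarrow>\<^sub>0 rat)"
  where "wmult p q = (\<Sum>u\<in>Poly_Mapping.keys p. \<Sum>v\<in>Poly_Mapping.keys q.
    Poly_Mapping.single (u @ v) (Poly_Mapping.lookup p u * Poly_Mapping.lookup q v))"

lemma word_algebra_simps [simp]:
  "carrier (word_algebra G) = {p. Poly_Mapping.keys p \<subseteq> lists G}"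
  "mult (word_algebra G) = wmult" "one (word_algebra G) = Poly_Mapping.single [] 1"
  "zero (word_algebra G) = 0" "add (word_algebra G) = (+)"
  by (auto simp: word_algebra_def wmult_def fun_eq_iff)

text \<open>Identities linear in an argument are thereby reduced to monomials; associativity and
  multiplicativity of evaluation are obtained by applying it to one argument after another.\<close>

lemma poly_mapping_single_induct [consumes 1, case_names zero add]:
  assumes "Poly_Mapping.keys p \<subseteq> L" "P 0"
    and step: "\<And>w c q. \<lbrakk>w \<in> L; Poly_Mapping.keys q \<subseteq> L; P q\<rbrakk> \<Longrightarrow> P (Poly_Mapping.single w c + q)"
  shows "P p"
  using assms(1)
proof (induction p rule: Poly_Mapping.update_induct)
  case (update f a b)
  have eq: "Poly_Mapping.update a b f = Poly_Mapping.single a b + f"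
    using update(1) by (intro poly_mapping_eqI) (auto simp: lookup_update lookup_add lookup_single when_def in_keys_iff)
  have "a \<in> L" using update by (auto simp: in_keys_iff lookup_update subset_iff)
  moreover have "Poly_Mapping.keys f \<subseteq> L"
    using update by (auto simp: in_keys_iff lookup_update subset_iff)
  ultimately show ?case using step update.IH eq by metis
qed (rule assms(2))

lemma wmult_superset:
  assumes "finite U" "Poly_Mapping.keys p \<subseteq> U" "finite V" "Poly_Mapping.keys q \<subseteq> V"
  shows "wmult p q = (\<Sum>u\<in>U. \<Sum>v\<in>V.
    Poly_Mapping.single (u @ v) (Poly_Mapping.lookup p u * Poly_Mapping.lookup q v))"
proof -
  have "wmult p q = (\<Sum>u\<in>Poly_Mapping.keys p. \<Sum>v\<in>V.
      Poly_Mapping.single (u @ v) (Poly_Mapping.lookup p u * Poly_Mapping.lookup q v))"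
    unfolding wmult_def using assms(3,4)
    by (intro sum.cong refl sum.mono_neutral_left) (auto simp: in_keys_iff)
  also have "\<dots> = (\<Sum>u\<in>U. \<Sum>v\<in>V.
      Poly_Mapping.single (u @ v) (Poly_Mapping.lookup p u * Poly_Mapping.lookup q v))"
    using assms(1,2) by (intro sum.mono_neutral_left) (auto simp: in_keys_iff)
  finally show ?thesis .
qed

lemma wmult_add_left: "wmult (p + p') q = wmult p q + wmult p' q"
proof -
  let ?U = "Poly_Mapping.keys p \<union> Poly_Mapping.keys p'" and ?V = "Poly_Mapping.keys q"
  have "wmult (p + p') q = (\<Sum>u\<in>?U. \<Sum>v\<in>?V.
      Poly_Mapping.single (u @ v) (Poly_Mapping.lookup (p + p') u * Poly_Mapping.lookup q v))"
    by (rule wmult_superset) (auto simp: Poly_Mapping.keys_add)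
  moreover have "wmult p q = (\<Sum>u\<in>?U. \<Sum>v\<in>?V.
      Poly_Mapping.single (u @ v) (Poly_Mapping.lookup p u * Poly_Mapping.lookup q v))"
    by (rule wmult_superset) auto
  moreover have "wmult p' q = (\<Sum>u\<in>?U. \<Sum>v\<in>?V.
      Poly_Mapping.single (u @ v) (Poly_Mapping.lookup p' u * Poly_Mapping.lookup q v))"
    by (rule wmult_superset) auto
  ultimately show ?thesis
    by (simp add: lookup_add distrib_right single_add sum.distrib)
qed

lemma wmult_add_right: "wmult q (p + p') = wmult q p + wmult q p'"
proof -
  let ?U = "Poly_Mapping.keys p \<union> Poly_Mapping.keys p'" and ?V = "Poly_Mapping.keys q"
  have "wmult q (p + p') = (\<Sum>v\<in>?V. \<Sum>u\<in>?U.
      Poly_Mapping.single (v @ u) (Poly_Mapping.lookup q v * Poly_Mapping.lookup (p + p') u))"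
    by (rule wmult_superset) (auto simp: Poly_Mapping.keys_add)
  moreover have "wmult q p = (\<Sum>v\<in>?V. \<Sum>u\<in>?U.
      Poly_Mapping.single (v @ u) (Poly_Mapping.lookup q v * Poly_Mapping.lookup p u))"
    by (rule wmult_superset) auto
  moreover have "wmult q p' = (\<Sum>v\<in>?V. \<Sum>u\<in>?U.
      Poly_Mapping.single (v @ u) (Poly_Mapping.lookup q v * Poly_Mapping.lookup p' u))"
    by (rule wmult_superset) auto
  ultimately show ?thesis
    by (simp add: lookup_add distrib_left single_add sum.distrib)
qed

lemma wmult_single: "wmult (Poly_Mapping.single u a) (Poly_Mapping.single v b) = Poly_Mapping.single (u @ v) (a * b)"
  using wmult_superset[of "{u}" "Poly_Mapping.single u a" "{v}" "Poly_Mapping.single v b"] by simp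

lemma wmult_zero [simp]: "wmult 0 q = 0" "wmult p 0 = 0"
  by (simp_all add: wmult_def)

lemma wmult_assoc: "wmult (wmult p q) r = wmult p (wmult q r)"
proof -
  have 1: "wmult (wmult (Poly_Mapping.single u a) (Poly_Mapping.single v b)) r =
      wmult (Poly_Mapping.single u a) (wmult (Poly_Mapping.single v b) r)" for u v a b
    using subset_UNIV[of "Poly_Mapping.keys r"]
    by (induction r rule: poly_mapping_single_induct)
      (auto simp: wmult_add_left wmult_add_right wmult_single mult.assoc)
  have 2: "wmult (wmult (Poly_Mapping.single u a) q) r =
      wmult (Poly_Mapping.single u a) (wmult q r)" for u a
    using subset_UNIV[of "Poly_Mapping.keys q"]
    by (induction q rule: poly_mapping_single_induct)
      (auto simp: wmult_add_left wmult_add_right 1)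
  show ?thesis
    using subset_UNIV[of "Poly_Mapping.keys p"]
    by (induction p rule: poly_mapping_single_induct)
      (auto simp: wmult_add_left wmult_add_right 2)
qed

lemma wmult_one [simp]: "wmult (Poly_Mapping.single [] 1) p = p" "wmult p (Poly_Mapping.single [] 1) = p"
proof -
  show "wmult (Poly_Mapping.single [] 1) p = p"
    using subset_UNIV[of "Poly_Mapping.keys p"]
    by (induction p rule: poly_mapping_single_induct) (auto simp: wmult_add_right wmult_single)
  show "wmult p (Poly_Mapping.single [] 1) = p"
    using subset_UNIV[of "Poly_Mapping.keys p"]
    by (induction p rule: poly_mapping_single_induct) (auto simp: wmult_add_left wmult_single)
qed

lemma keys_wmult:
  assumes "Poly_Mapping.keys p \<subseteq> lists G" "Poly_Mapping.keys q \<subseteq> lists G"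
  shows "Poly_Mapping.keys (wmult p q) \<subseteq> lists G"
  using assms(1)
proof (induction p rule: poly_mapping_single_induct)
  case (add w c p)
  have "Poly_Mapping.keys (wmult (Poly_Mapping.single w c) q) \<subseteq> lists G"
    using assms(2)
  proof (induction q rule: poly_mapping_single_induct)
    case (add v b q)
    have "Poly_Mapping.keys (Poly_Mapping.single (w @ v) (c * b)) \<subseteq> lists G"
      using \<open>w \<in> lists G\<close> add(1) by simp
    then show ?case
      using Poly_Mapping.keys_add[of "Poly_Mapping.single (w @ v) (c * b)" "wmult (Poly_Mapping.single w c) q"] add(3)
      unfolding wmult_add_right wmult_single by blast
  qed simp
  then show ?case
    using Poly_Mapping.keys_add[of "wmult (Poly_Mapping.single w c) q" "wmult p q"] add(3)
    unfolding wmult_add_left by blast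
qed simp

lemma ring_word_algebra: "ring (word_algebra G)"
proof (rule ringI)
  show "abelian_group (word_algebra G)"
  proof (rule abelian_groupI)
    show "\<exists>y\<in>carrier (word_algebra G). y \<oplus>\<^bsub>word_algebra G\<^esub> x = \<zero>\<^bsub>word_algebra G\<^esub>"
      if "x \<in> carrier (word_algebra G)" for x
      using that by (intro bexI[of _ "- x"]) auto
    show "x \<oplus>\<^bsub>word_algebra G\<^esub> y \<in> carrier (word_algebra G)"
      if "x \<in> carrier (word_algebra G)" "y \<in> carrier (word_algebra G)" for x y
      using that Poly_Mapping.keys_add[of x y] by auto
  qed (auto simp: ac_simps)
  show "monoid (word_algebra G)"
    by (rule monoidI) (auto simp: wmult_assoc dest: subsetD[OF keys_wmult])
qed (auto simp: wmult_add_left wmult_add_right)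

section \<open>Evaluating noncommutative polynomials in an algebra\<close>

abbreviation monomial :: "('a, 'z) dga_scheme \<Rightarrow> ('g \<Rightarrow> 'a) \<Rightarrow> 'g list \<Rightarrow> 'a"
  where "monomial A a w \<equiv> foldr (\<lambda>g x. a g \<otimes>\<^bsub>A\<^esub> x) w \<one>\<^bsub>A\<^esub>"

locale evaluation = differential_algebra A
  for A :: "('a, 'z) dga_scheme" (structure) +
  fixes a :: "'g \<Rightarrow> 'a" and G :: "'g set"
  assumes gens_closed: "g \<in> G \<Longrightarrow> a g \<in> carrier A"
begin

lemma monomial_closed: "w \<in> lists G \<Longrightarrow> monomial A a w \<in> carrier A"
  by (induction w) (auto simp: gens_closed)

lemma keys_monomial_closed:
  "\<lbrakk>Poly_Mapping.keys p \<subseteq> lists G; w \<in> Poly_Mapping.keys p\<rbrakk> \<Longrightarrow> monomial A a w \<in> carrier A"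
  using monomial_closed by blast

lemma monomial_append: "\<lbrakk>u \<in> lists G; v \<in> lists G\<rbrakk> \<Longrightarrow> monomial A a (u @ v) = monomial A a u \<otimes> monomial A a v"
proof (induction u)
  case (Cons g u)
  then have "monomial A a (u @ v) = monomial A a u \<otimes> monomial A a v" by simp
  then show ?case
    using Cons.prems monomial_closed[of u] monomial_closed[of v] gens_closed[of g]
    by (simp add: m_assoc)
qed (use monomial_closed in simp)

lemma eval_superset:
  assumes "finite U" "Poly_Mapping.keys p \<subseteq> U" "U \<subseteq> lists G"
  shows "word_eval A a p = (\<Oplus>w\<in>U. Poly_Mapping.lookup p w \<odot> monomial A a w)"
  unfolding word_eval_def using assms monomial_closed
  by (intro add.finprod_mono_neutral_cong_left) (auto simp: in_keys_iff subset_iff)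

lemma eval_closed: "Poly_Mapping.keys p \<subseteq> lists G \<Longrightarrow> word_eval A a p \<in> carrier A"
  unfolding word_eval_def by (intro finsum_closed funcsetI smult_closed keys_monomial_closed)

lemma eval_zero [simp]: "word_eval A a 0 = \<zero>"
  by (simp add: word_eval_def)

lemma eval_single: "w \<in> lists G \<Longrightarrow> word_eval A a (Poly_Mapping.single w c) = c \<odot> monomial A a w"
  using eval_superset[of "{w}" "Poly_Mapping.single w c"] monomial_closed by simp

lemma eval_add:
  assumes "Poly_Mapping.keys p \<subseteq> lists G" "Poly_Mapping.keys q \<subseteq> lists G"
  shows "word_eval A a (p + q) = word_eval A a p \<oplus> word_eval A a q"
proof -
  let ?U = "Poly_Mapping.keys p \<union> Poly_Mapping.keys q"
  have "word_eval A a (p + q) = (\<Oplus>w\<in>?U. Poly_Mapping.lookup (p + q) w \<odot> monomial A a w)"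
    using assms by (intro eval_superset Poly_Mapping.keys_add) auto
  also have "\<dots> = (\<Oplus>w\<in>?U. Poly_Mapping.lookup p w \<odot> monomial A a w \<oplus> Poly_Mapping.lookup q w \<odot> monomial A a w)"
    using keys_monomial_closed[OF assms(1)] keys_monomial_closed[OF assms(2)]
    by (intro finsum_cong') (auto simp: lookup_add smult_add_left)
  also have "\<dots> = (\<Oplus>w\<in>?U. Poly_Mapping.lookup p w \<odot> monomial A a w) \<oplus>
      (\<Oplus>w\<in>?U. Poly_Mapping.lookup q w \<odot> monomial A a w)"
    using keys_monomial_closed[OF assms(1)] keys_monomial_closed[OF assms(2)] by (intro finsum_addf) auto
  also have "(\<Oplus>w\<in>?U. Poly_Mapping.lookup p w \<odot> monomial A a w) = word_eval A a p"
    using assms by (intro eval_superset[symmetric]) auto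
  also have "(\<Oplus>w\<in>?U. Poly_Mapping.lookup q w \<odot> monomial A a w) = word_eval A a q"
    using assms by (intro eval_superset[symmetric]) auto
  finally show ?thesis .
qed

lemma eval_mult:
  assumes "Poly_Mapping.keys p \<subseteq> lists G" "Poly_Mapping.keys q \<subseteq> lists G"
  shows "word_eval A a (wmult p q) = word_eval A a p \<otimes> word_eval A a q"
  using assms(1)
proof (induction p rule: poly_mapping_single_induct)
  case zero
  then show ?case using eval_closed[OF assms(2)] by simp
next
  case (add w c p)
  have kw: "Poly_Mapping.keys (Poly_Mapping.single w d) \<subseteq> lists G" for d using add(1) by simp
  have single: "word_eval A a (wmult (Poly_Mapping.single w c) q) = (c \<odot> monomial A a w) \<otimes> word_eval A a q"
    using assms(2)
  proof (induction q rule: poly_mapping_single_induct)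
    case zero
    then show ?case using monomial_closed[OF add(1)] by simp
  next
    case (add v b q)
    have wv: "w @ v \<in> lists G" using \<open>w \<in> lists G\<close> add(1) by simp
    have kv: "Poly_Mapping.keys (Poly_Mapping.single v b) \<subseteq> lists G" using add(1) by simp
    have kwv: "Poly_Mapping.keys (Poly_Mapping.single (w @ v) (c * b)) \<subseteq> lists G" using wv by simp
    note cl = monomial_closed[OF \<open>w \<in> lists G\<close>] monomial_closed[OF add(1)] eval_closed[OF add(2)]
    have "word_eval A a (wmult (Poly_Mapping.single w c) (Poly_Mapping.single v b + q)) =
        (c * b) \<odot> (monomial A a w \<otimes> monomial A a v) \<oplus> (c \<odot> monomial A a w) \<otimes> word_eval A a q"
      using eval_add[OF kwv keys_wmult[OF kw add(2)]] eval_single[OF wv] add.IH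
        monomial_append[OF \<open>w \<in> lists G\<close> add(1)] by (simp add: wmult_add_right wmult_single)
    also have "\<dots> = (c \<odot> monomial A a w) \<otimes> (b \<odot> monomial A a v \<oplus> word_eval A a q)"
      using cl by (simp add: r_distr smult_mult_left smult_mult_right smult_smult mult.commute)
    also have "\<dots> = (c \<odot> monomial A a w) \<otimes> word_eval A a (Poly_Mapping.single v b + q)"
      using eval_add[OF kv add(2)] eval_single[OF add(1)] by simp
    finally show ?case .
  qed
  note cl = monomial_closed[OF add(1)] eval_closed[OF add(2)] eval_closed[OF assms(2)]
  have "word_eval A a (wmult (Poly_Mapping.single w c + p) q) =
      (c \<odot> monomial A a w) \<otimes> word_eval A a q \<oplus> word_eval A a p \<otimes> word_eval A a q"
    using eval_add[OF keys_wmult[OF kw assms(2)] keys_wmult[OF add(2) assms(2)]] single add.IH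
    by (simp add: wmult_add_left)
  also have "\<dots> = (c \<odot> monomial A a w \<oplus> word_eval A a p) \<otimes> word_eval A a q"
    using cl by (simp add: l_distr)
  also have "\<dots> = word_eval A a (Poly_Mapping.single w c + p) \<otimes> word_eval A a q"
    using eval_add[OF kw add(2)] eval_single[OF add(1)] by simp
  finally show ?case .
qed

lemma eval_smult:
  assumes "Poly_Mapping.keys p \<subseteq> lists G"
  shows "word_eval A a (wmult (Poly_Mapping.single [] c) p) = c \<odot> word_eval A a p"
  using eval_mult[of "Poly_Mapping.single [] c" p] eval_single[of "[]" c] eval_closed[OF assms] assms
  by (simp add: smult_mult_left)

lemma eval_ring_hom: "word_eval A a \<in> Ring.ring_hom (word_algebra G) A"
  using eval_closed eval_add eval_mult eval_single[of "[]" 1] by (auto simp: Ring.ring_hom_def)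

text \<open>Being an ideal, the kernel contains the whole ideal generated by any relations that it
  contains.\<close>

lemma ideal_kernel: "ideal {p \<in> carrier (word_algebra G). word_eval A a p = \<zero>} (word_algebra G)"
proof -
  have "ring_hom_ring (word_algebra G) A (word_eval A a)"
    by (rule ring_hom_ringI2[OF ring_word_algebra is_ring eval_ring_hom])
  from ring_hom_ring.kernel_is_ideal[OF this] show ?thesis unfolding a_kernel_def' .
qed

lemma monomial_subalg: "w \<in> lists G \<Longrightarrow> monomial A a w \<in> subalg A (a ` G)"
  by (induction w) (auto intro: subalg.intros)

lemma eval_subalg:
  assumes "Poly_Mapping.keys p \<subseteq> lists G"
  shows "word_eval A a p \<in> subalg A (a ` G)"
  unfolding word_eval_def
proof (intro finsum_in_subsp subalg_subsp)
  show "a ` G \<subseteq> carrier A" using gens_closed by blast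
  show "Poly_Mapping.lookup p w \<odot> monomial A a w \<in> subalg A (a ` G)" if "w \<in> Poly_Mapping.keys p" for w
    using assms that by (intro subalg.smult monomial_subalg) blast
qed

end

context differential_algebra
begin

lemma evaluation_graded: "(\<And>g. g \<in> G \<Longrightarrow> a g \<in> grade A (deg g)) \<Longrightarrow> evaluation A a G"
  by unfold_locales (rule grade_closed)

lemma presented_by_generates:
  assumes "presented_by A G deg a R"
  shows "carrier A = subalg A (a ` G)"
proof -
  have a: "a g \<in> grade A (deg g)" if "g \<in> G" for g using assms that by (auto simp: presented_by_def)
  interpret evaluation A a G using evaluation_graded[of G a deg] a by blast
  have "carrier A \<subseteq> subalg A (a ` G)"
  proof
    fix x assume "x \<in> carrier A"
    then obtain p where "p \<in> carrier (word_algebra G)" "x = word_eval A a p"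
      using assms unfolding presented_by_def by blast
    then show "x \<in> subalg A (a ` G)" using eval_subalg by simp
  qed
  moreover have "subalg A (a ` G) \<subseteq> carrier A"
    using gens_closed by (intro subalg_subset_carrier) auto
  ultimately show ?thesis ..
qed

text \<open>Finitely many generators of positive degree give finitely many words in each degree.
  This is where finite presentation is turned into finite dimension.\<close>

lemma finitely_presented_finite_span_grade:
  assumes "finitely_presented A"
  shows "finite_span A (grade A n)"
proof -
  obtain m deg a R where deg: "\<forall>g<m. 0 < deg g" and pres: "presented_by A {..<m::nat} deg a R"
    using assms by (auto simp: finitely_presented_def)
  have "homogeneous_gens A (a ` {..<m})"
    using deg pres by (auto simp: homogeneous_gens_def presented_by_def)
  then have "finite_span A (grade A n \<inter> subalg A (a ` {..<m}))"
    by (rule finite_span_grade_subalg) simp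
  moreover have "grade A n \<inter> subalg A (a ` {..<m}) = grade A n"
    using presented_by_generates[OF pres] grade_closed by auto
  ultimately show ?thesis by simp
qed

lemma freely_generated_homogeneous:
  assumes "freely_generated A S deg"
  shows "homogeneous_gens A S" "carrier A = subalg A S"
  using assms presented_by_generates[of S deg "\<lambda>s. s" "{}"]
  by (auto simp: freely_generated_def homogeneous_gens_def presented_by_def)

end

text \<open>The kernel of evaluation in \<open>M\<close> is generated by the graded commutators
  alone. They also vanish in \<open>B\<close>, so evaluation in \<open>B\<close> factors through
  \<open>M\<close>. The prescribed degrees of the \<open>h s\<close> ensure that the signs
  match.\<close>

lemma freely_generated_extension:
  assumes M: "differential_algebra M" and B: "differential_algebra B"
    and free: "freely_generated M S deg" and h: "\<And>s. s \<in> S \<Longrightarrow> h s \<in> grade B (deg s)"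
  obtains F where "F \<in> alg_hom M B" "\<And>s. s \<in> S \<Longrightarrow> F s = h s"
proof -
  interpret M: differential_algebra M by fact
  interpret B: differential_algebra B by fact
  have pres: "presented_by M S deg (\<lambda>s. s) {}" using free by (simp add: freely_generated_def)
  interpret eM: evaluation M "\<lambda>s. s" S
    using pres by (intro M.evaluation_graded[of S _ deg]) (simp add: presented_by_def)
  interpret eB: evaluation B h S by (rule B.evaluation_graded[of S h deg]) (rule h)
  let ?W = "word_algebra S" and ?EM = "word_eval M (\<lambda>s. s)" and ?EB = "word_eval B h"
  interpret W: ring ?W by (rule ring_word_algebra)
  \<comment> \<open>Graded commutativity of \<open>B\<close>, applied to the images
    \<open>h g\<close> and \<open>h k\<close>, cancels the two terms.\<close>
  have "graded_commutators S deg \<subseteq> {p \<in> carrier ?W. ?EB p = \<zero>\<^bsub>B\<^esub>}"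
  proof
    fix p assume "p \<in> graded_commutators S deg"
    then obtain g k where gk: "g \<in> S" "k \<in> S"
      and p: "p = Poly_Mapping.single [g, k] 1 - Poly_Mapping.single [k, g] ((- 1) ^ (deg g * deg k))"
      by (auto simp: graded_commutators_def)
    let ?c = "(- 1) ^ (deg g * deg k) :: rat"
    have p': "p = Poly_Mapping.single [g, k] 1 + Poly_Mapping.single [k, g] (- ?c)"
      unfolding p by (simp add: single_uminus)
    have k1: "Poly_Mapping.keys (Poly_Mapping.single [g, k] (1::rat)) \<subseteq> lists S"
      and k2: "Poly_Mapping.keys (Poly_Mapping.single [k, g] (- ?c)) \<subseteq> lists S" using gk by auto
    note hc = B.grade_closed[OF h[OF gk(1)]] B.grade_closed[OF h[OF gk(2)]]
    have "?EB p = h g \<otimes>\<^bsub>B\<^esub> h k \<oplus>\<^bsub>B\<^esub> (- ?c) \<odot>\<^bsub>B\<^esub> (h k \<otimes>\<^bsub>B\<^esub> h g)"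
      unfolding p' using eB.eval_add[OF k1 k2] eB.eval_single[of "[g, k]" 1] eB.eval_single[of "[k, g]" "- ?c"] gk hc
      by simp
    also have "\<dots> = (?c + (- ?c)) \<odot>\<^bsub>B\<^esub> (h k \<otimes>\<^bsub>B\<^esub> h g)"
      using B.graded_commutative[OF h[OF gk(1)] h[OF gk(2)]] hc
        B.smult_add_left[of "h k \<otimes>\<^bsub>B\<^esub> h g" ?c "- ?c"] by simp
    finally have "?EB p = \<zero>\<^bsub>B\<^esub>" using hc by simp
    moreover have "p \<in> carrier ?W"
      unfolding p' using k1 k2 Poly_Mapping.keys_add[of "Poly_Mapping.single [g, k] 1" "Poly_Mapping.single [k, g] (- ?c)"]
      by (simp only: word_algebra_simps) blast
    ultimately show "p \<in> {p \<in> carrier ?W. ?EB p = \<zero>\<^bsub>B\<^esub>}" by blast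
  qed
  then have "genideal ?W (graded_commutators S deg) \<subseteq> {p \<in> carrier ?W. ?EB p = \<zero>\<^bsub>B\<^esub>}"
    by (rule W.genideal_minimal[OF eB.ideal_kernel])
  then have ker: "?EB p = \<zero>\<^bsub>B\<^esub>" if "p \<in> carrier ?W" "?EM p = \<zero>\<^bsub>M\<^esub>" for p
    using pres that unfolding presented_by_def by auto
  have wd: "?EB p = ?EB q" if p: "p \<in> carrier ?W" and q: "q \<in> carrier ?W" and eq: "?EM p = ?EM q" for p q
  proof -
    have k: "Poly_Mapping.keys p \<subseteq> lists S" "Poly_Mapping.keys q \<subseteq> lists S"
      "Poly_Mapping.keys (- q) \<subseteq> lists S" using p q by simp_all
    then have k4: "Poly_Mapping.keys (p + (- q)) \<subseteq> lists S"
      using Poly_Mapping.keys_add[of p "- q"] by blast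
    have "?EM q \<oplus>\<^bsub>M\<^esub> ?EM (- q) = \<zero>\<^bsub>M\<^esub>" using eM.eval_add[OF k(2,3)] by simp
    then have "?EM (p + (- q)) = \<zero>\<^bsub>M\<^esub>" using eM.eval_add[OF k(1,3)] eq by simp
    then have *: "?EB p \<oplus>\<^bsub>B\<^esub> ?EB (- q) = \<zero>\<^bsub>B\<^esub>"
      using ker[of "p + (- q)"] k4 eB.eval_add[OF k(1,3)] by simp
    have **: "?EB q \<oplus>\<^bsub>B\<^esub> ?EB (- q) = \<zero>\<^bsub>B\<^esub>" using eB.eval_add[OF k(2,3)] by simp
    show ?thesis
      using * ** eB.eval_closed[OF k(1)] eB.eval_closed[OF k(2)] eB.eval_closed[OF k(3)]
      by (metis B.add.right_cancel)
  qed
  \<comment> \<open>The factorization: evaluate in \<open>B\<close> any polynomial that represents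
    \<open>m\<close> in \<open>M\<close>. By \<open>wd\<close> the choice does not matter.\<close>
  define F where "F m = ?EB (SOME p. p \<in> carrier ?W \<and> ?EM p = m)" for m
  have F: "F (?EM p) = ?EB p" if p: "p \<in> carrier ?W" for p
  proof -
    have "(SOME q. q \<in> carrier ?W \<and> ?EM q = ?EM p) \<in> carrier ?W \<and>
        ?EM (SOME q. q \<in> carrier ?W \<and> ?EM q = ?EM p) = ?EM p"
      by (rule someI[of _ p]) (simp only: p simp_thms)
    then show ?thesis unfolding F_def using wd p by blast
  qed
  have surj: "\<exists>p. p \<in> carrier ?W \<and> m = ?EM p" if "m \<in> carrier M" for m
    using pres that unfolding presented_by_def by blast
  have hom: "F x \<in> carrier B" "F (x \<oplus>\<^bsub>M\<^esub> y) = F x \<oplus>\<^bsub>B\<^esub> F y" "F (x \<otimes>\<^bsub>M\<^esub> y) = F x \<otimes>\<^bsub>B\<^esub> F y"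
    "F (c \<odot>\<^bsub>M\<^esub> x) = c \<odot>\<^bsub>B\<^esub> F x" if x: "x \<in> carrier M" and y: "y \<in> carrier M" for x y c
  proof -
    obtain p where p: "p \<in> carrier ?W" "x = ?EM p" using surj[OF x] by blast
    obtain q where q: "q \<in> carrier ?W" "y = ?EM q" using surj[OF y] by blast
    have k: "Poly_Mapping.keys p \<subseteq> lists S" "Poly_Mapping.keys q \<subseteq> lists S" using p q by auto
    have pq: "p + q \<in> carrier ?W" "wmult p q \<in> carrier ?W" "wmult (Poly_Mapping.single [] c) p \<in> carrier ?W"
    proof -
      show "p + q \<in> carrier ?W" using Poly_Mapping.keys_add[of p q] k by (simp only: word_algebra_simps) blast
      show "wmult p q \<in> carrier ?W" using keys_wmult[OF k] by simp
      have "Poly_Mapping.keys (Poly_Mapping.single [] c) \<subseteq> lists S" by simp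
      from keys_wmult[OF this k(1)] show "wmult (Poly_Mapping.single [] c) p \<in> carrier ?W" by simp
    qed
    show "F x \<in> carrier B" using F[OF p(1)] p(2) eB.eval_closed[OF k(1)] by simp
    show "F (x \<oplus>\<^bsub>M\<^esub> y) = F x \<oplus>\<^bsub>B\<^esub> F y"
      using F[OF pq(1)] F[OF p(1)] F[OF q(1)] eM.eval_add[OF k] eB.eval_add[OF k] p(2) q(2) by simp
    show "F (x \<otimes>\<^bsub>M\<^esub> y) = F x \<otimes>\<^bsub>B\<^esub> F y"
      using F[OF pq(2)] F[OF p(1)] F[OF q(1)] eM.eval_mult[OF k] eB.eval_mult[OF k] p(2) q(2) by simp
    show "F (c \<odot>\<^bsub>M\<^esub> x) = c \<odot>\<^bsub>B\<^esub> F x"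
      using F[OF pq(3)] F[OF p(1)] eM.eval_smult[OF k(1)] eB.eval_smult[OF k(1)] p(2) by simp
  qed
  have "F \<one>\<^bsub>M\<^esub> = \<one>\<^bsub>B\<^esub>"
    using F[of "Poly_Mapping.single [] 1"] eM.eval_single[of "[]" 1] eB.eval_single[of "[]" 1] by simp
  then have "F \<in> Ring.ring_hom M B"
    by (intro ring_hom_memI hom(1-3))
  moreover have "linear M B F"
    unfolding linear_iff by (intro conjI ballI allI funcsetI hom(1,2,4))
  ultimately have "F \<in> alg_hom M B" by (simp add: alg_hom_def)
  moreover have "F s = h s" if "s \<in> S" for s
    using F[of "Poly_Mapping.single [s] 1"] eM.eval_single[of "[s]" 1] eB.eval_single[of "[s]" 1] that
      eM.gens_closed[OF that] eB.gens_closed[OF that] by simp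
  ultimately show ?thesis using that by blast
qed

section \<open>The structure of a model produced by the method\<close>

text \<open>A run describes cohomology at intermediate stages; the quasi-isomorphism adds what holds
  for the final algebra, in particular injectivity on its cohomology in degrees up to
  \<open>i + 1\<close>.\<close>

locale model_run = run: method_run i B M \<phi> X Y + B: differential_algebra B
  for i and B :: "'b dga" and M :: "'m dga" and \<phi> X Y +
  assumes quasi: "quasi_iso i M B \<phi>"

sublocale model_run \<subseteq> M: differential_algebra M
  by (rule run.dga_M)

sublocale model_run \<subseteq> phi: dga_map M B \<phi>
  using run.phi_hom by unfold_locales

context model_run
begin

definition S where "S = (\<Union>k. X k) \<union> (\<Union>k t. Y k t)"
text \<open>\<open>T k t\<close> consists of the generators present before iteration
  \<open>t\<close> of the \<open>y\<close>-step for \<open>k\<close>, and \<open>T_inf k\<close> of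
  those present just before the \<open>x\<close>-step for \<open>k\<close>. They generate
  \<open>y_stage\<close> and \<open>x_stage\<close>.\<close>

definition T where "T k t = gens_below X Y k \<union> (\<Union>s<t. Y k s)"
definition T_inf where "T_inf k = gens_below X Y k \<union> (\<Union>t. Y k t)"

lemma S_free: "\<exists>deg. freely_generated M S deg"
  using run.free by (simp add: S_def)

lemma homogeneous_S: "homogeneous_gens M S" and carrier_S: "carrier M = subalg M S"
  using S_free M.freely_generated_homogeneous by blast+

lemma T_subset_S: "T k t \<subseteq> S" and T_inf_subset_S: "T_inf k \<subseteq> S"
  by (auto simp: T_def T_inf_def S_def gens_below_def)

lemma homogeneous_T: "homogeneous_gens M (T k t)" and homogeneous_T_inf: "homogeneous_gens M (T_inf k)"
  using homogeneous_gens_subset[OF homogeneous_S] T_subset_S T_inf_subset_S by blast+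

lemma S_closed: "S \<subseteq> carrier M" and T_closed: "T k t \<subseteq> carrier M" and T_inf_closed: "T_inf k \<subseteq> carrier M"
  using M.homogeneous_gens_closed homogeneous_S homogeneous_T homogeneous_T_inf by blast+

section \<open>Generators and stages of a run\<close>

lemma first_degree_pos: "0 < first_degree B"
proof -
  obtain k where "positive_coh B k" using run.applicable by blast
  then have "positive_coh B (first_degree B)" unfolding first_degree_def by (rule LeastI)
  then show ?thesis by (simp add: positive_coh_def)
qed

lemma gens_below_mono: "k \<le> m \<Longrightarrow> gens_below X Y k \<subseteq> gens_below X Y m"
  by (force simp: gens_below_def)

lemma gens_below_Suc: "gens_below X Y (Suc k) = T_inf k \<union> X k"
  by (auto simp: gens_below_def T_inf_def lessThan_Suc)

lemma T_0: "T k 0 = gens_below X Y k"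
  by (simp add: T_def)

lemma T_Suc: "T k (Suc t) = T k t \<union> Y k t"
  by (auto simp: T_def lessThan_Suc)

lemma T_mono: "t \<le> t' \<Longrightarrow> T k t \<subseteq> T k t'"
  by (force simp: T_def)

lemma T_subset_T_inf: "T k t \<subseteq> T_inf k"
  by (auto simp: T_def T_inf_def)

lemma T_inf_eq: "T_inf k = (\<Union>t. T k t)"
  by (auto simp: T_def T_inf_def)

lemma T_inf_subset_T: "k < m \<Longrightarrow> T_inf k \<subseteq> T m t"
  using gens_below_mono[of "Suc k" m] by (auto simp: T_def gens_below_Suc)

lemma T_lt_subset: "k < m \<Longrightarrow> T k t \<subseteq> T m t'"
  using T_inf_subset_T T_subset_T_inf by blast

lemma dif_Y:
  assumes "y \<in> Y k t"
  shows "dif M y \<in> subalg M (T k t)"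
proof -
  have "k \<in> {Suc (first_degree B)..Suc i}" using run.Y_range assms by blast
  then show ?thesis using run.y_step_cocycles[OF _ assms] by (simp add: y_stage_def T_def)
qed

lemma dif_gens_below:
  assumes "s \<in> gens_below X Y k"
  shows "dif M s \<in> subalg M (T k t)"
proof -
  from assms consider m where "m < k" "s \<in> X m" | m t' where "m < k" "s \<in> Y m t'"
    by (auto simp: gens_below_def)
  then show ?thesis
  proof cases
    case 1 then show ?thesis using run.X_closed M.subalg_zero by simp
  next
    case 2 then show ?thesis
      using dif_Y[OF 2(2)] subalg_mono[OF T_lt_subset[OF 2(1)]] by blast
  qed
qed

lemma dif_T: "s \<in> T k t \<Longrightarrow> dif M s \<in> subalg M (T k t)"
proof -
  assume "s \<in> T k t"
  then consider "s \<in> gens_below X Y k" | t' where "t' < t" "s \<in> Y k t'" by (auto simp: T_def)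
  then show ?thesis
  proof cases
    case 1 then show ?thesis by (rule dif_gens_below)
  next
    case 2 then show ?thesis using dif_Y[OF 2(2)] subalg_mono[OF T_mono[of t' t k], of M] by auto
  qed
qed

lemma dif_T_inf:
  assumes "s \<in> T_inf k"
  shows "dif M s \<in> subalg M (T_inf k)"
proof -
  obtain t where "s \<in> T k t" using assms by (auto simp: T_inf_eq)
  then show ?thesis using dif_T subalg_mono[OF T_subset_T_inf] by blast
qed

lemma dif_subalg_T: "x \<in> subalg M (T k t) \<Longrightarrow> dif M x \<in> subalg M (T k t)"
  by (rule M.dif_subalg[OF homogeneous_T dif_T])

lemma dif_subalg_T_inf: "x \<in> subalg M (T_inf k) \<Longrightarrow> dif M x \<in> subalg M (T_inf k)"
  by (rule M.dif_subalg[OF homogeneous_T_inf dif_T_inf])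

text \<open>An element of degree \<open>n\<close> uses generators of degree at most
  \<open>n\<close>. These come from \<open>x\<close>-steps up to \<open>n\<close> and from
  \<open>y\<close>-steps up to \<open>n + 1\<close>, all completed in
  \<open>T_inf (Suc n)\<close>.\<close>

lemma grade_low:
  assumes "x \<in> grade M n"
  shows "x \<in> subalg M (T_inf (Suc n))"
proof -
  let ?L = "{s \<in> S. \<exists>d. 0 < d \<and> d \<le> n \<and> s \<in> grade M d}"
  have "x \<in> subalg M ?L"
    using M.grade_subalg_low_gens[OF homogeneous_S _ assms] M.grade_closed[OF assms] carrier_S by simp
  moreover have "?L \<subseteq> subalg M (T_inf (Suc n))"
  proof
    fix s assume "s \<in> ?L"
    then obtain d where d: "d \<le> n" "s \<in> grade M d" and s: "s \<in> S" by blast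
    \<comment> \<open>The degree of a nonzero element is unique. The zero element lies in every
      degree and is carried along as a separate, harmless case.\<close>
    have uniq: "s = \<zero>\<^bsub>M\<^esub> \<or> d = m" if "s \<in> grade M m" for m
      using M.component_grade[OF d(2), of m] M.component_grade[OF that, of m] by (auto split: if_splits)
    from s consider k where "s \<in> X k" | k t where "s \<in> Y k t" by (auto simp: S_def)
    then show "s \<in> subalg M (T_inf (Suc n))"
    proof cases
      case 1
      then have "s \<in> grade M k" using run.X_grade by blast
      then consider "s = \<zero>\<^bsub>M\<^esub>" | "k \<le> n" using uniq d(1) by blast
      then show ?thesis
      proof cases
        case 2 then show ?thesis
          using 1 by (intro subalg.incl) (auto simp: T_inf_def gens_below_def)
      qed (simp add: M.subalg_zero)
    next
      case 2
      \<comment> \<open>The bound \<open>1 \<le> k\<close> keeps the truncated subtraction honest: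
        degree at most \<open>n\<close> really means \<open>k \<le> n + 1\<close>.\<close>
      then have "s \<in> grade M (k - 1)" "1 \<le> k" using run.Y_grade run.Y_range[of k t] by (blast, fastforce)
      then consider "s = \<zero>\<^bsub>M\<^esub>" | "k < Suc n" | "k = Suc n" using uniq[of "k - 1"] d(1) by fastforce
      then show ?thesis
      proof cases
        case 2 with \<open>s \<in> Y k t\<close> show ?thesis
          by (intro subalg.incl) (auto simp: T_inf_def gens_below_def)
      next
        case 3 with \<open>s \<in> Y k t\<close> show ?thesis
          by (intro subalg.incl) (auto simp: T_inf_def)
      qed (simp add: M.subalg_zero)
    qed
  qed
  ultimately show ?thesis using subalg_least by blast
qed

text \<open>A homogeneous primitive has degree \<open>n\<close>, hence lies in
  \<open>T_inf (Suc n)\<close> by \<open>grade_low\<close>, and this stage is closed under the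
  differential. So exact elements of a degree precede the \<open>x\<close>-step for it.\<close>

lemma exact_in_T_inf:
  assumes "x \<in> coboundaries M" "x \<in> grade M (Suc n)"
  shows "x \<in> subalg M (T_inf (Suc n))"
  using M.grade_coboundary[OF assms] grade_low dif_subalg_T_inf by metis

lemma inj_coh:
  assumes "k \<le> Suc i" "z \<in> cocycles M" "z \<in> grade M k" "\<phi> z \<in> coboundaries B"
  shows "z \<in> coboundaries M"
proof -
  have "inj_on (coh_map B \<phi>) (coh M k)"
    using quasi assms(1) unfolding quasi_iso_def by (metis bij_betw_def le_Suc_eq)
  then show ?thesis using phi.coh_map_inj_onD assms by blast
qed

lemma X_cocycles: "X k \<subseteq> cocycles M"
  using run.X_closed run.X_grade M.grade_closed unfolding cocycles_def by blast

lemma x_stage_dga: "differential_algebra (x_stage M X Y k)"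
  unfolding x_stage_def T_inf_def[symmetric]
  by (rule sub_dga_differential_algebra[OF run.dga_M homogeneous_T_inf dif_T_inf])

lemma y_stage_dga: "differential_algebra (y_stage M X Y k t)"
  unfolding y_stage_def T_def[symmetric]
  by (rule sub_dga_differential_algebra[OF run.dga_M homogeneous_T dif_T])

lemma x_stage_map: "dga_map (x_stage M X Y k) B \<phi>"
  unfolding x_stage_def T_inf_def[symmetric]
  using x_stage_dga[of k] dga_hom_sub_dga[OF run.phi_hom M.subalg_subset_carrier[OF T_inf_closed]] B.differential_algebra_axioms
  by (auto simp: dga_map_def dga_map_axioms_def x_stage_def T_inf_def)

lemma y_stage_map: "dga_map (y_stage M X Y k t) B \<phi>"
  unfolding y_stage_def T_def[symmetric]
  using y_stage_dga[of k t] dga_hom_sub_dga[OF run.phi_hom M.subalg_subset_carrier[OF T_closed]] B.differential_algebra_axioms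
  by (auto simp: dga_map_def dga_map_axioms_def y_stage_def T_def)

lemma x_stage_simps:
  "carrier (x_stage M X Y k) = subalg M (T_inf k)" "grade (x_stage M X Y k) n = grade M n \<inter> subalg M (T_inf k)"
  "dif (x_stage M X Y k) = dif M" "zero (x_stage M X Y k) = zero M"
  by (simp_all add: x_stage_def T_inf_def)

lemma y_stage_simps:
  "carrier (y_stage M X Y k t) = subalg M (T k t)" "grade (y_stage M X Y k t) n = grade M n \<inter> subalg M (T k t)"
  "dif (y_stage M X Y k t) = dif M" "zero (y_stage M X Y k t) = zero M" "add (y_stage M X Y k t) = add M"
  "smult (y_stage M X Y k t) = smult M"
  by (simp_all add: y_stage_def T_def)

lemma phi_span_class:
  assumes "U \<subseteq> cocycles M"
  shows "lspan (cohomology B) ((\<lambda>x. coh_class B (\<phi> x)) ` U) = (\<lambda>x. coh_class B (\<phi> x)) ` lspan M U"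
proof -
  have "\<phi> ` U \<subseteq> cocycles B" using assms phi.cocycle by blast
  then show ?thesis
    using B.lspan_cls[of "\<phi> ` U"] phi.lspan_image[of U] assms M.cocyclesD(1) by (auto simp: image_image subset_iff)
qed

text \<open>The \<open>x\<close>-step completes the image of the stage to a basis of the cohomology
  of \<open>B\<close> in degree \<open>l\<close>, so \<open>X l\<close> and cocycles of the stage
  together hit every class.\<close>

lemma cohomologous_to_stage:
  assumes "1 \<le> l" "l \<le> i" "c \<in> cocycles M" "c \<in> grade M l"
  shows "\<exists>v\<in>lspan M (X l \<union> (cocycles M \<inter> grade M l \<inter> subalg M (T_inf l))).
    \<phi> c \<ominus>\<^bsub>B\<^esub> \<phi> v \<in> coboundaries B"
proof -
  interpret HB: rat_space "cohomology B" by (rule B.rat_space_H)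
  let ?Z = "cocycles M \<inter> grade M l \<inter> subalg M (T_inf l)"
  have U: "X l \<union> ?Z \<subseteq> cocycles M" using X_cocycles by blast
  have cB: "coh_class B (\<phi> c) \<in> coh B l"
    using phi.cocycle[OF assms(3)] phi.grade[OF assms(4)] by (simp add: B.coh_grade)
  have basis: "lspan (cohomology B) b = coh B l" if "vectorspace.basis QQ (coh_space B (coh B l)) b" for b
    using HB.basis_lspan(2)[OF B.subsp_coh_grade] that by (simp add: coh_space_def)
  have "coh_class B (\<phi> c) \<in> lspan (cohomology B) ((\<lambda>x. coh_class B (\<phi> x)) ` (X l \<union> ?Z))"
  proof (cases "l < first_degree B")
    \<comment> \<open>Below the first degree the cohomology of \<open>B\<close> is zero in positive
      degrees.\<close>
    case True
    then have "\<not> positive_coh B l" unfolding first_degree_def by (rule not_less_Least)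
    then have "coh_class B (\<phi> c) = \<zero>\<^bsub>cohomology B\<^esub>" using assms(1) cB by (auto simp: positive_coh_def)
    then show ?thesis by (simp add: lspan.zero)
  next
    case False
    then consider "l = first_degree B" | "l \<in> {Suc (first_degree B)..i}" using assms(2) by force
    then show ?thesis
    proof cases
      case 1
      then have "coh_class B (\<phi> c) \<in> lspan (cohomology B) ((\<lambda>x. coh_class B (\<phi> x)) ` X l)"
        using basis cB run.first_step[OF 1] unfolding basis_family_def by blast
      moreover have "lspan (cohomology B) ((\<lambda>x. coh_class B (\<phi> x)) ` X l) \<subseteq>
          lspan (cohomology B) ((\<lambda>x. coh_class B (\<phi> x)) ` (X l \<union> ?Z))"
        by (rule lspan_mono) blast
      ultimately show ?thesis by blast
    next
      case 2
      let ?N = "x_stage M X Y l"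
      interpret N: dga_map ?N B \<phi> by (rule x_stage_map)
      obtain C where C: "vectorspace.basis QQ (coh_space B (coh_map B \<phi> ` coh ?N l)) C"
        "vectorspace.basis QQ (coh_space B (coh B l)) (C \<union> (\<lambda>x. coh_class B (\<phi> x)) ` X l)"
        using run.x_step[OF 2 refl] by blast
      have img: "coh_map B \<phi> ` coh ?N l = (\<lambda>x. coh_class B (\<phi> x)) ` (cocycles ?N \<inter> grade ?N l)"
        unfolding N.A.coh_grade image_image by (rule image_cong[OF refl]) (simp add: N.coh_map_class)
      have Z: "cocycles ?N \<inter> grade ?N l \<subseteq> ?Z"
        using M.grade_closed by (auto simp: cocycles_def x_stage_simps)
      have "HB.subsp (coh_map B \<phi> ` coh ?N l)"
      proof -
        have "coh_map B \<phi> ` coh ?N l = coh_class B ` (\<phi> ` (cocycles ?N \<inter> grade ?N l))"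
          unfolding img by (simp add: image_image)
        moreover have "B.subsp (\<phi> ` (cocycles ?N \<inter> grade ?N l))"
          by (intro N.subsp_image N.A.subsp_Int N.A.subsp_cocycles N.A.grade_subspace)
        moreover have "\<phi> ` (cocycles ?N \<inter> grade ?N l) \<subseteq> cocycles B" using N.cocycle by blast
        ultimately show ?thesis using B.subsp_cls_image by simp
      qed
      then have "C \<subseteq> coh_map B \<phi> ` coh ?N l"
        using HB.basis_lspan(1) C(1) by (simp add: coh_space_def)
      then have "C \<union> (\<lambda>x. coh_class B (\<phi> x)) ` X l \<subseteq> (\<lambda>x. coh_class B (\<phi> x)) ` (X l \<union> ?Z)"
        unfolding img using Z by blast
      then show ?thesis using lspan_mono basis[OF C(2)] cB by blast
    qed
  qed
  then obtain v where v: "v \<in> lspan M (X l \<union> ?Z)" "coh_class B (\<phi> c) = coh_class B (\<phi> v)"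
    unfolding phi_span_class[OF U] by blast
  have "v \<in> carrier M" using M.lspan_closed[OF v(1)] U M.cocyclesD(1) by blast
  then show ?thesis
    using v B.cls_eq_iff[of "\<phi> c" "\<phi> v"] M.cocyclesD(1)[OF assms(3)] by auto
qed

text \<open>\<open>c\<close> differs from a combination \<open>v\<close> of \<open>X l\<close> and
  stage cocycles by a cocycle whose image is exact. Injectivity on the cohomology of the final
  \<open>M\<close> makes \<open>c - v\<close> exact, and exact elements of degree \<open>l\<close>
  lie in the stage.\<close>

lemma cocycle_decomposition:
  assumes "1 \<le> l" "l \<le> i" "c \<in> cocycles M" "c \<in> grade M l"
  shows "c \<in> lspan M (X l \<union> subalg M (T_inf l))"
proof -
  let ?Z = "cocycles M \<inter> grade M l \<inter> subalg M (T_inf l)"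
  obtain v where v: "v \<in> lspan M (X l \<union> ?Z)" "\<phi> c \<ominus>\<^bsub>B\<^esub> \<phi> v \<in> coboundaries B"
    using cohomologous_to_stage[OF assms] by blast
  have "lspan M (X l \<union> ?Z) \<subseteq> cocycles M \<inter> grade M l"
    using X_cocycles run.X_grade
    by (intro M.lspan_least M.subsp_Int M.subsp_cocycles M.grade_subspace) blast
  then have vc: "v \<in> cocycles M" "v \<in> grade M l" using v(1) by auto
  note cc = M.cocyclesD(1)[OF assms(3)] and vcc = M.cocyclesD(1)[OF vc(1)]
  have "c \<ominus>\<^bsub>M\<^esub> v \<in> coboundaries M"
  proof (rule inj_coh[of l])
    show "\<phi> (c \<ominus>\<^bsub>M\<^esub> v) \<in> coboundaries B" using v(2) cc vcc by simp
  qed (use assms vc M.subspD(6)[OF M.subsp_cocycles] M.grade_minus in auto)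
  moreover have "c \<ominus>\<^bsub>M\<^esub> v \<in> grade M (Suc (l - 1))" using assms vc M.grade_minus by simp
  ultimately have "c \<ominus>\<^bsub>M\<^esub> v \<in> subalg M (T_inf (Suc (l - 1)))" by (rule exact_in_T_inf)
  then have "c \<ominus>\<^bsub>M\<^esub> v \<in> lspan M (X l \<union> subalg M (T_inf l))" using assms(1) by (auto intro: lspan.incl)
  moreover have "v \<in> lspan M (X l \<union> subalg M (T_inf l))"
    using v(1) lspan_mono[of "X l \<union> ?Z" "X l \<union> subalg M (T_inf l)" M] by blast
  ultimately have "(c \<ominus>\<^bsub>M\<^esub> v) \<oplus>\<^bsub>M\<^esub> v \<in> lspan M (X l \<union> subalg M (T_inf l))" by (rule lspan.add)
  then show ?thesis using M.minus_add_cancel[OF cc vcc] by simp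
qed

text \<open>No cocycle of degree \<open>l\<close> appears during the \<open>y\<close>-step for
  \<open>l + 1\<close>: all are present at its start, which is the case
  \<open>t = 0\<close>.\<close>

lemma cocycle_in_T:
  assumes "1 \<le> l" "l \<le> i" "c \<in> cocycles M" "c \<in> grade M l"
  shows "c \<in> subalg M (T (Suc l) t)"
proof -
  have "X l \<union> subalg M (T_inf l) \<subseteq> subalg M (T (Suc l) t)"
    using subalg_mono[OF T_inf_subset_T[of l "Suc l" t], of M]
    by (auto simp: T_def gens_below_Suc intro: subalg.incl)
  then show ?thesis using cocycle_decomposition[OF assms] M.lspan_subset_subalg by blast
qed

lemma coh_kernel_eq:
  "coh_kernel (y_stage M X Y k t) B \<phi> k = coh_class (y_stage M X Y k t) `
    {z \<in> cocycles (y_stage M X Y k t) \<inter> grade (y_stage M X Y k t) k. \<phi> z \<in> coboundaries B}"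
proof -
  interpret N: dga_map "y_stage M X Y k t" B \<phi> by (rule y_stage_map)
  have "coh_map B \<phi> (coh_class (y_stage M X Y k t) z) = \<zero>\<^bsub>cohomology B\<^esub> \<longleftrightarrow> \<phi> z \<in> coboundaries B"
    if "z \<in> cocycles (y_stage M X Y k t)" for z
    using that N.coh_map_class[OF that] B.cls_eq_zero_iff[OF N.closed] N.A.cocyclesD(1) by simp
  then show ?thesis unfolding coh_kernel_def N.A.coh_grade by blast
qed

lemma subsp_coh_kernel:
  "VectorSpace.subspace QQ (coh_kernel (y_stage M X Y k t) B \<phi> k) (cohomology (y_stage M X Y k t))"
proof -
  interpret N: dga_map "y_stage M X Y k t" B \<phi> by (rule y_stage_map)
  show ?thesis
    unfolding coh_kernel_eq
    by (intro N.A.subsp_cls_image N.subsp_vimage N.A.subsp_Int N.A.subsp_cocycles N.A.grade_subspace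
        B.subsp_coboundaries) blast
qed

text \<open>\<open>dif M x\<close> is a cocycle of the stage that becomes exact in \<open>B\<close>,
  so its class is a combination of the classes of the \<open>dif M y\<close>. Hence
  \<open>dif M x = dif M v + dif M n\<close> with \<open>v\<close> in the span of the new generators
  and \<open>n\<close> in the stage; the remainder of \<open>x\<close> is a cocycle of degree
  \<open>l\<close> and already lies in the stage.\<close>

lemma Y_step_decomposition:
  assumes "1 \<le> l" "l \<le> i" "x \<in> grade M l" "dif M x \<in> subalg M (T (Suc l) j)"
  shows "x \<in> lspan M (Y (Suc l) j \<union> subalg M (T (Suc l) j))"
proof (cases "l < first_degree B")
  \<comment> \<open>No \<open>y\<close>-step has taken place for \<open>l + 1\<close>, so the stage
    already contains all of degree \<open>l\<close>.\<close>
  case True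
  then have "Y (Suc l) t = {}" for t using run.Y_range[of "Suc l" t] by auto
  then have "T_inf (Suc l) \<subseteq> T (Suc l) j" by (auto simp: T_inf_def T_def)
  then show ?thesis using grade_low[OF assms(3)] subalg_mono by (blast intro: lspan.incl)
next
  case False
  let ?k = "Suc l"
  have k: "?k \<in> {Suc (first_degree B)..Suc i}" using False assms by auto
  let ?N = "y_stage M X Y ?k j" and ?Y = "Y ?k j" and ?A = "subalg M (T (Suc l) j)"
  interpret N: dga_map ?N B \<phi> by (rule y_stage_map)
  interpret HN: rat_space "cohomology ?N" by (rule N.A.rat_space_H)
  have xc: "x \<in> carrier M" by (rule M.grade_closed[OF assms(3)])
  have Ygr: "?Y \<subseteq> grade M l" using run.Y_grade[of ?k j] by simp
  then have Yc: "?Y \<subseteq> carrier M" using M.grade_closed by blast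
  have lspanN: "lspan ?N U = lspan M U" for U by (rule lspan_cong) (simp_all add: y_stage_simps)
  have dx: "dif M x \<in> cocycles ?N \<inter> grade ?N ?k"
    using assms M.dif_dif[OF xc] M.dif_grade by (simp add: cocycles_def y_stage_simps)
  have "\<phi> (dif M x) \<in> coboundaries B"
    using xc by (auto simp: phi.dif coboundaries_def)
  then have "coh_class ?N (dif M x) \<in> coh_kernel ?N B \<phi> ?k" unfolding coh_kernel_eq using dx by blast
  moreover have "vectorspace.basis QQ ((cohomology ?N)\<lparr>carrier := coh_kernel ?N B \<phi> ?k\<rparr>)
      ((\<lambda>y. coh_class ?N (dif M y)) ` ?Y)"
    using run.y_step_basis[OF k refl, of j] by (simp add: basis_family_def coh_space_def)
  ultimately have "coh_class ?N (dif M x) \<in> lspan (cohomology ?N) ((\<lambda>y. coh_class ?N (dif M y)) ` ?Y)"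
    using HN.basis_lspan(2)[OF subsp_coh_kernel] by blast
  moreover have "dif M ` ?Y \<subseteq> cocycles ?N"
    using dif_Y M.dif_dif Yc by (auto simp: cocycles_def y_stage_simps)
  ultimately have "coh_class ?N (dif M x) \<in> coh_class ?N ` lspan M (dif M ` ?Y)"
    using N.A.lspan_cls[of "dif M ` ?Y"] by (simp add: image_image lspanN)
  moreover have "lspan M (dif M ` ?Y) = dif M ` lspan M ?Y" by (rule M.dif.lspan_image[OF Yc])
  ultimately obtain v where v: "v \<in> lspan M ?Y" "coh_class ?N (dif M x) = coh_class ?N (dif M v)"
    by auto
  have vg: "v \<in> grade M l" using v(1) M.lspan_least[OF Ygr M.grade_subspace] by blast
  note vc = M.grade_closed[OF vg]
  have "dif M v \<in> cocycles ?N"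
    using v(1) \<open>dif M ` ?Y \<subseteq> cocycles ?N\<close> M.dif.lspan_image[OF Yc] N.A.lspan_least[OF _ N.A.subsp_cocycles]
    unfolding lspanN by blast
  then have "dif M x \<ominus>\<^bsub>?N\<^esub> dif M v \<in> coboundaries ?N"
    using v(2) dx N.A.cocyclesD(1) by (simp add: N.A.cls_eq_iff)
  moreover have "dif M x \<ominus>\<^bsub>?N\<^esub> dif M v = dif M x \<ominus>\<^bsub>M\<^esub> dif M v"
    using N.A.minus_eq_add_smult[of "dif M x" "dif M v"] dx \<open>dif M v \<in> cocycles ?N\<close> N.A.cocyclesD(1) xc vc
    by (simp add: y_stage_simps M.minus_eq_add_smult)
  ultimately obtain n where n: "n \<in> ?A" "dif M x \<ominus>\<^bsub>M\<^esub> dif M v = dif M n"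
    by (auto simp: coboundaries_def y_stage_simps)
  have nc: "n \<in> carrier M" by (rule M.subalg_closed[OF n(1) T_closed])
  \<comment> \<open>\<open>n\<close> need not be homogeneous; only its component of degree
    \<open>l\<close> contributes to the equation in degree \<open>l + 1\<close>.\<close>
  define m where "m = component M l n"
  have m: "m \<in> ?A" "m \<in> grade M l" "m \<in> carrier M"
    unfolding m_def using M.component_in_subalg[OF homogeneous_T n(1)] M.component_props(1)[OF nc] nc by auto
  have xv: "x \<ominus>\<^bsub>M\<^esub> v \<in> grade M l" by (rule M.grade_minus[OF assms(3) vg])
  have "dif M m = component M ?k (dif M (x \<ominus>\<^bsub>M\<^esub> v))"
    unfolding m_def using n(2) nc xc vc by (simp add: M.component_dif)
  also have "\<dots> = dif M (x \<ominus>\<^bsub>M\<^esub> v)"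
    using M.component_grade[OF M.dif_grade[OF xv], of ?k] by simp
  finally have "dif M ((x \<ominus>\<^bsub>M\<^esub> v) \<ominus>\<^bsub>M\<^esub> m) = \<zero>\<^bsub>M\<^esub>"
    using xc vc m by simp
  then have "(x \<ominus>\<^bsub>M\<^esub> v) \<ominus>\<^bsub>M\<^esub> m \<in> ?A"
    using cocycle_in_T[OF assms(1,2)] M.grade_minus[OF xv m(2)] M.grade_closed by (simp add: cocycles_def)
  then have "((x \<ominus>\<^bsub>M\<^esub> v) \<ominus>\<^bsub>M\<^esub> m) \<oplus>\<^bsub>M\<^esub> m \<in> ?A" using m(1) by (rule subalg.add)
  then have "x \<ominus>\<^bsub>M\<^esub> v \<in> ?A" using M.minus_add_cancel[of "x \<ominus>\<^bsub>M\<^esub> v" m] xc vc m by simp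
  then have "x \<ominus>\<^bsub>M\<^esub> v \<in> lspan M (?Y \<union> ?A)" by (auto intro: lspan.incl)
  moreover have "v \<in> lspan M (?Y \<union> ?A)" using v(1) lspan_mono[of ?Y "?Y \<union> ?A" M] by blast
  ultimately have "(x \<ominus>\<^bsub>M\<^esub> v) \<oplus>\<^bsub>M\<^esub> v \<in> lspan M (?Y \<union> ?A)" by (rule lspan.add)
  then show ?thesis using M.minus_add_cancel[OF xc vc] by simp
qed

end

section \<open>Identification of the stages with the subalgebras of the numerical invariants\<close>

context model_run
begin

text \<open>The first degree is at least \<open>1\<close>, so \<open>x\<close>-steps start at
  \<open>1\<close> and \<open>y\<close>-steps at \<open>2\<close>. This is the bottom of the
  induction over stages.\<close>

lemma T_1_empty: "T 1 j = {}"
proof -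
  have "X 0 = {}" "Y 0 t = {}" "Y 1 t = {}" for t
    using run.X_range[of 0] run.Y_range[of 0 t] run.Y_range[of 1 t] first_degree_pos by fastforce+
  then show ?thesis by (auto simp: T_def gens_below_def)
qed

lemma subalg_insert_zero: "subalg M {\<zero>\<^bsub>M\<^esub>} = subalg M {}"
  by (rule subset_antisym; rule subalg_least) (auto intro: M.subalg_zero)

lemma Vsub_subset_Nsub: "k \<le> j \<Longrightarrow> Vsub M l k \<subseteq> Nsub M l j"
  by (auto intro: subalg.incl)

lemma X_subset_Vsub: "1 \<le> l \<Longrightarrow> X l \<subseteq> Vsub M l 0"
  using run.X_grade run.X_closed by (cases l) auto

text \<open>\<open>cocycle_in_T\<close> and \<open>Y_step_decomposition\<close> bound the spaces
  \<open>Vsub\<close> from above; conversely each generator of degree \<open>l\<close> lies in some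
  \<open>Vsub M l k\<close>. The induction is nested because the space for \<open>j + 1\<close> is
  defined through the subalgebra for \<open>j\<close>, and that one through all lower
  degrees.\<close>

lemma Nsub_eq: "l \<le> i \<Longrightarrow> Nsub M l j = subalg M (T (Suc l) j)"
proof (induction l arbitrary: j rule: less_induct)
  case (less l)
  note IH_l = less.IH
  show ?case
  proof (cases "l = 0")
    case True
    then show ?thesis using T_1_empty subalg_insert_zero by (simp add: image_constant_conv)
  next
    case False
    then have l: "1 \<le> l" "l \<le> i" using less.prems by auto
    obtain l' where l': "l = Suc l'" using False by (cases l) auto
    show ?thesis
    proof (induction j rule: less_induct)
      case (less j)
      note IH_j = less.IH
      let ?V = "(\<Union>m\<in>{..<l}. \<Union>k. Vsub M m k) \<union> (\<Union>k\<in>{..j}. Vsub M l k)"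
      have N: "Nsub M l j = subalg M ?V" by simp
      have "?V \<subseteq> subalg M (T (Suc l) j)"
      proof
        fix x assume "x \<in> ?V"
        then consider m k where "m < l" "x \<in> Vsub M m k" | "x \<in> Vsub M l 0" | k where "Suc k \<le> j" "x \<in> Vsub M l (Suc k)"
          by (auto) (metis not0_implies_Suc)
        then show "x \<in> subalg M (T (Suc l) j)"
        proof cases
          case 1
          then have "x \<in> subalg M (T (Suc m) k)"
            using IH_l[OF 1(1), of k] Vsub_subset_Nsub[of k k m] l(2) by auto
          then show ?thesis using subalg_mono[OF T_lt_subset[of "Suc m" "Suc l" k j]] 1(1) by blast
        next
          case 2
          then show ?thesis
            using cocycle_in_T[OF l, of x j] M.grade_closed by (simp add: l' cocycles_def)
        next
          case 3
          then have x: "x \<in> grade M l" "dif M x \<in> subalg M (T (Suc l) k)"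
            using IH_j[of k] by (auto simp: l' simp del: Nsub.simps)
          \<comment> \<open>\<open>Vsub M l (Suc k)\<close> corresponds to iteration number
            \<open>k\<close>, since iterations are counted from zero while filtration
            \<open>0\<close> consists of the cocycles.\<close>
          have "Y (Suc l) k \<union> subalg M (T (Suc l) k) \<subseteq> subalg M (T (Suc l) (Suc k))"
            using subalg_mono[OF T_mono[of k "Suc k" "Suc l"], of M] by (auto simp: T_Suc intro: subalg.incl)
          then have "x \<in> subalg M (T (Suc l) (Suc k))"
            using Y_step_decomposition[OF l x] M.lspan_subset_subalg by blast
          then show ?thesis using subalg_mono[OF T_mono[OF 3(1)]] by blast
        qed
      qed
      moreover have "T (Suc l) j \<subseteq> ?V"
      proof
        fix s assume "s \<in> T (Suc l) j"
        then consider m where "m \<le> l" "s \<in> X m" | m t where "m \<le> l" "s \<in> Y m t" | t where "t < j" "s \<in> Y (Suc l) t"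
          by (auto simp: T_def gens_below_def less_Suc_eq_le)
        then show "s \<in> ?V"
        proof cases
          case 1
          then have "1 \<le> m" using run.X_range[of m] first_degree_pos by fastforce
          then have "s \<in> Vsub M m 0" using X_subset_Vsub 1(2) by blast
          with 1(1) show ?thesis by (cases "m = l") auto
        next
          case 2
          \<comment> \<open>A generator in \<open>Y m t\<close> has degree \<open>m - 1\<close>,
            which is positive, and belongs to \<open>Vsub M (m - 1) (Suc t)\<close>.\<close>
          then have m: "2 \<le> m" using run.Y_range[of m t] first_degree_pos by fastforce
          then obtain m' where m': "m = Suc (Suc m')" by (metis add_2_eq_Suc le_Suc_ex)
          have "dif M s \<in> Nsub M (Suc m') t"
            using dif_Y[OF 2(2)] IH_l[of "Suc m'" t] 2(1) l(2) by (simp add: m' del: Nsub.simps)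
          then have "s \<in> Vsub M (Suc m') (Suc t)"
            using run.Y_grade[of m t] 2(2) by (auto simp: m' simp del: Nsub.simps)
          moreover have "Suc m' \<in> {..<l}" using 2(1) m' by simp
          ultimately show ?thesis by blast
        next
          case 3
          then have "dif M s \<in> Nsub M l t" using dif_Y[OF 3(2)] IH_j[OF 3(1)] by (simp del: Nsub.simps)
          then have "s \<in> Vsub M l (Suc t)"
            using run.Y_grade[of "Suc l" t] 3(2) by (auto simp: l' simp del: Nsub.simps)
          moreover have "Suc t \<in> {..j}" using 3(1) by simp
          ultimately show ?thesis by blast
        qed
      qed
      ultimately show ?case
        unfolding N using subalg_least[of ?V M] subalg_mono[of "T (Suc l) j" ?V M] by blast
    qed
  qed
qed

lemma Vsub_0: "1 \<le> l \<Longrightarrow> Vsub M l 0 = cocycles M \<inter> grade M l"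
  using M.grade_closed by (cases l) (auto simp: cocycles_def)

lemma Vsub_Suc: "\<lbrakk>1 \<le> l; l \<le> i\<rbrakk> \<Longrightarrow> Vsub M l (Suc j) = {x \<in> grade M l. dif M x \<in> subalg M (T (Suc l) j)}"
  using Nsub_eq[of l j] by (cases l) (auto simp del: Nsub.simps)

lemma subalg_T_inf: "subalg M (T_inf k) = (\<Union>t. subalg M (T k t))"
proof
  show "(\<Union>t. subalg M (T k t)) \<subseteq> subalg M (T_inf k)" using subalg_mono[OF T_subset_T_inf] by blast
  show "subalg M (T_inf k) \<subseteq> (\<Union>t. subalg M (T k t))"
  proof
    fix x assume "x \<in> subalg M (T_inf k)"
    then show "x \<in> (\<Union>t. subalg M (T k t))"
    proof induction
      case (incl x)
      then show ?case by (auto simp: T_inf_eq intro: subalg.incl)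
    next
      case (add x y)
      then obtain t t' where "x \<in> subalg M (T k t)" "y \<in> subalg M (T k t')" by blast
      then have "x \<in> subalg M (T k (max t t'))" "y \<in> subalg M (T k (max t t'))"
        using subalg_mono[OF T_mono[of t "max t t'" k], of M] subalg_mono[OF T_mono[of t' "max t t'" k], of M]
        by auto
      then show ?case by (blast intro: subalg.add)
    next
      case (mult x y)
      then obtain t t' where "x \<in> subalg M (T k t)" "y \<in> subalg M (T k t')" by blast
      then have "x \<in> subalg M (T k (max t t'))" "y \<in> subalg M (T k (max t t'))"
        using subalg_mono[OF T_mono[of t "max t t'" k], of M] subalg_mono[OF T_mono[of t' "max t t'" k], of M]
        by auto
      then show ?case by (blast intro: subalg.mult)
    qed (auto intro: subalg.intros)
  qed
qed

lemma Ninf_eq: "l \<le> i \<Longrightarrow> Ninf M l = subalg M (T_inf (Suc l))"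
  by (simp add: Ninf_def Nsub_eq subalg_T_inf del: Nsub.simps)

text \<open>The closed generators are counted modulo everything generated in lower degree:
  \<open>Ninf M (l - 1)\<close> is the stage \<open>T_inf l\<close> just before the
  \<open>x\<close>-step for \<open>l\<close>.\<close>

lemma num_inv_0:
  "\<lbrakk>1 \<le> l; l \<le> i\<rbrakk> \<Longrightarrow> num_inv M l 0 = vectorspace.dim QQ (quotient_module M (cocycles M \<inter> grade M l)
    ((cocycles M \<inter> grade M l) \<inter> subalg M (T_inf l)))"
  using Ninf_eq[of "l - 1"] by (simp add: num_inv_def Vsub_0)

lemma num_inv_Suc:
  "\<lbrakk>1 \<le> l; l \<le> i\<rbrakk> \<Longrightarrow> num_inv M l (Suc j) =
    vectorspace.dim QQ (quotient_module M {x \<in> grade M l. dif M x \<in> subalg M (T (Suc l) j)}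
      ({x \<in> grade M l. dif M x \<in> subalg M (T (Suc l) j)} \<inter> subalg M (T (Suc l) j)))"
  using Nsub_eq[of l j] by (simp add: num_inv_def Vsub_Suc del: Nsub.simps)

section \<open>Finiteness of the sets of generators\<close>

lemma Y_eventually_empty: "\<exists>t. \<forall>s\<ge>t. Y k s = {}"
proof (cases "k \<in> {Suc (first_degree B)..Suc i}")
  case False
  then show ?thesis using run.Y_range by blast
next
  case True
  then obtain t where t: "inj_on (coh_map B \<phi>) (coh (y_stage M X Y k t) k)"
    using run.y_step_terminates by blast
  \<comment> \<open>Injectivity makes the kernel zero, and a basis does not contain zero, so the
    basis indexed by \<open>Y k s\<close> is empty.\<close>
  have empty: "Y k s = {}" if "inj_on (coh_map B \<phi>) (coh (y_stage M X Y k s) k)" for s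
  proof -
    let ?N = "y_stage M X Y k s"
    interpret N: dga_map ?N B \<phi> by (rule y_stage_map)
    interpret HN: rat_space "cohomology ?N" by (rule N.A.rat_space_H)
    have ker: "coh_kernel ?N B \<phi> k \<subseteq> {\<zero>\<^bsub>cohomology ?N\<^esub>}"
    proof
      fix c assume "c \<in> coh_kernel ?N B \<phi> k"
      then obtain z where z: "z \<in> cocycles ?N" "z \<in> grade ?N k" "\<phi> z \<in> coboundaries B" "c = coh_class ?N z"
        unfolding coh_kernel_eq by blast
      then have "z \<in> coboundaries ?N" using N.coh_map_inj_onD that by blast
      then show "c \<in> {\<zero>\<^bsub>cohomology ?N\<^esub>}"
        using z N.A.cls_eq_zero_iff[OF N.A.cocyclesD(1)] by simp
    qed
    have "vectorspace.basis QQ ((cohomology ?N)\<lparr>carrier := coh_kernel ?N B \<phi> k\<rparr>)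
      ((\<lambda>y. coh_class ?N (dif M y)) ` Y k s)"
      using run.y_step_basis[OF True refl, of s] by (simp add: basis_family_def coh_space_def)
    note b = HN.basis_lspan(1,3)[OF subsp_coh_kernel this]
    have "(\<lambda>y. coh_class ?N (dif M y)) ` Y k s = {}"
      using subset_trans[OF b(1) ker] b(2) by (metis subset_singletonD singletonI)
    then show ?thesis by simp
  qed
  \<comment> \<open>An iteration that adds nothing leaves the stage and hence its injectivity
    unchanged, so emptiness propagates to all later iterations.\<close>
  have eq: "T k s = T k t" if "t \<le> s" for s
    using that
  proof (induction s rule: dec_induct)
    case (step s)
    then have "y_stage M X Y k s = y_stage M X Y k t" by (simp add: y_stage_def T_def)
    then show ?case using step empty[of s] t by (simp add: T_Suc)
  qed simp
  have "Y k s = {}" if "t \<le> s" for s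
  proof -
    have "y_stage M X Y k s = y_stage M X Y k t"
      using eq[OF that] by (simp add: y_stage_def T_def)
    then show ?thesis using empty[of s] t by simp
  qed
  then show ?thesis by blast
qed

lemma T_inf_eq_T: obtains t where "T_inf k = T k t"
proof -
  obtain t where t: "\<forall>s\<ge>t. Y k s = {}" using Y_eventually_empty by blast
  have "T_inf k = T k t"
    unfolding T_inf_def T_def using t by (auto simp: not_less intro: leI)
  then show ?thesis using that by blast
qed

lemma finite_X:
  assumes "\<And>l. finite_span B (grade B l)"
  shows "finite (X k)"
proof (cases "X k = {}")
  case False
  then have k: "k \<in> {first_degree B..i}" using run.X_range by blast
  interpret HB: rat_space "cohomology B" by (rule B.rat_space_H)
  obtain b where b: "vectorspace.basis QQ (coh_space B (coh B k)) b" "(\<lambda>x. coh_class B (\<phi> x)) ` X k \<subseteq> b"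
    "inj_on (\<lambda>x. coh_class B (\<phi> x)) (X k)"
  proof (cases "k = first_degree B")
    case True
    then show ?thesis using run.first_step[OF True] that unfolding basis_family_def by blast
  next
    case False
    then have "k \<in> {Suc (first_degree B)..i}" using k by auto
    from run.x_step[OF this refl] that show ?thesis by blast
  qed
  have "finite b"
    using HB.finite_basis_if_finite_span[OF B.subsp_coh_grade B.finite_span_coh_grade[OF assms]] b(1)
    by (simp add: coh_space_def)
  then show ?thesis using b(2,3) finite_imageD finite_subset by blast
qed simp

text \<open>Finitely many generators make the stage finite-dimensional in degree \<open>k\<close>,
  hence also the kernel of which \<open>Y k t\<close> indexes a basis.\<close>

lemma finite_Y:
  assumes "finite (T k t)"
  shows "finite (Y k t)"
proof (cases "Y k t = {}")
  case False
  then have k: "k \<in> {Suc (first_degree B)..Suc i}" using run.Y_range by blast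
  let ?N = "y_stage M X Y k t"
  interpret N: dga_map ?N B \<phi> by (rule y_stage_map)
  interpret HN: rat_space "cohomology ?N" by (rule N.A.rat_space_H)
  have "finite_span M (grade M k \<inter> subalg M (T k t))"
    by (rule M.finite_span_grade_subalg[OF homogeneous_T assms])
  moreover have "lspan ?N U = lspan M U" for U by (rule lspan_cong) (simp_all add: y_stage_simps)
  ultimately have "finite_span ?N (grade ?N k)" by (simp add: finite_span_def y_stage_simps)
  then have "finite_span (cohomology ?N) (coh ?N k)" by (rule N.A.finite_span_coh_grade)
  then have "finite_span (cohomology ?N) (coh_kernel ?N B \<phi> k)"
    by (rule HN.finite_span_subset[OF _ N.A.subsp_coh_grade subsp_coh_kernel]) (auto simp: coh_kernel_def)
  moreover have b: "basis_family (coh_space ?N (coh_kernel ?N B \<phi> k)) (\<lambda>y. coh_class ?N (dif M y)) (Y k t)"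
    by (rule run.y_step_basis[OF k refl])
  ultimately have "finite ((\<lambda>y. coh_class ?N (dif M y)) ` Y k t)"
    using HN.finite_basis_if_finite_span[OF subsp_coh_kernel] by (simp add: basis_family_def coh_space_def)
  then show ?thesis using b finite_imageD unfolding basis_family_def by blast
qed simp

text \<open>Each step adds finitely many generators, and each \<open>y\<close>-step has finitely
  many effective iterations by \<open>T_inf_eq_T\<close>.\<close>

lemma finite_gens:
  assumes "\<And>l. finite_span B (grade B l)"
  shows "finite (gens_below X Y k)" "finite (T k t)" "finite S"
proof -
  have T: "finite (T k t)" if "finite (gens_below X Y k)" for k t
    by (induction t) (simp_all add: that T_0 T_Suc finite_Y)
  have *: "finite (gens_below X Y k)" for k
  proof (induction k)
    case 0
    then show ?case by (simp add: gens_below_def)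
  next
    case (Suc k)
    obtain t where "T_inf k = T k t" by (rule T_inf_eq_T)
    then show ?case using T[OF Suc] finite_X[OF assms] by (simp add: gens_below_Suc)
  qed
  then show "finite (gens_below X Y k)" .
  show "finite (T k t)" by (rule T[OF *])
  \<comment> \<open>The last step is the \<open>y\<close>-step for \<open>i + 1\<close>, and
    \<open>gens_below\<close> counts steps strictly below its index.\<close>
  have "S \<subseteq> gens_below X Y (Suc (Suc i))"
    using run.X_range run.Y_range by (fastforce simp: S_def gens_below_def)
  then show "finite S" using * finite_subset by blast
qed

lemma finite_span_grade:
  assumes "\<And>l. finite_span B (grade B l)"
  shows "finite_span M (grade M n)"
proof -
  have "grade M n \<inter> subalg M S = grade M n" using carrier_S M.grade_closed by blast
  then show ?thesis using M.finite_span_grade_subalg[OF homogeneous_S finite_gens(3)[OF assms]] by metis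
qed

lemma T_inf_top: "T_inf (Suc i) = S"
proof
  show "S \<subseteq> T_inf (Suc i)"
  proof
    fix s assume "s \<in> S"
    then consider k where "s \<in> X k" | k t where "s \<in> Y k t" by (auto simp: S_def)
    then show "s \<in> T_inf (Suc i)"
    proof cases
      case 1
      then have "k < Suc i" using run.X_range[of k] by fastforce
      with 1 show ?thesis by (auto simp: T_inf_def gens_below_def)
    next
      case 2
      then have "k < Suc i \<or> k = Suc i" using run.Y_range[of k t] by fastforce
      with 2 show ?thesis by (auto simp: T_inf_def gens_below_def)
    qed
  qed
qed (rule T_inf_subset_S)

text \<open>If the unit were zero the algebra would be zero, against the nonzero positive cohomology
  that starts the method.\<close>

lemma one_neq_zero: "\<one>\<^bsub>B\<^esub> \<noteq> \<zero>\<^bsub>B\<^esub>"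
proof
  assume 0: "\<one>\<^bsub>B\<^esub> = \<zero>\<^bsub>B\<^esub>"
  obtain k where k: "positive_coh B k" using run.applicable by blast
  have "x = \<zero>\<^bsub>B\<^esub>" if "x \<in> carrier B" for x
    using that B.l_one[OF that] 0 by simp
  then have "coh B k \<subseteq> {coh_class B \<zero>\<^bsub>B\<^esub>}"
    unfolding B.coh_grade using B.cocyclesD(1) by blast
  moreover have "\<zero>\<^bsub>cohomology B\<^esub> \<in> coh B k"
    unfolding B.cls_zero B.coh_grade
    using B.subspD(2)[OF B.subsp_cocycles] B.grade_zero by blast
  ultimately show False using k unfolding positive_coh_def B.cls_zero by blast
qed

end

section \<open>Extending an isomorphism over one stage\<close>

lemma alg_hom_comp:
  assumes "algebra_map A B f" "algebra_map B C g"
  shows "algebra_map A C (\<lambda>x. g (f x))"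
proof -
  interpret f: algebra_map A B f by fact
  interpret g: algebra_map B C g by fact
  have "(\<lambda>x. g (f x)) \<in> Ring.ring_hom A C" by (rule ring_hom_memI) auto
  moreover have "linear A C (\<lambda>x. g (f x))" by (simp add: linear_iff)
  ultimately show ?thesis by unfold_locales (simp add: alg_hom_def)
qed

lemma (in differential_algebra) algebra_map_id: "algebra_map A A (\<lambda>x. x)"
proof -
  have "(\<lambda>x. x) \<in> Ring.ring_hom A A" by (rule ring_hom_memI) auto
  moreover have "linear A A (\<lambda>x. x)" by (simp add: linear_iff)
  ultimately show ?thesis by unfold_locales (simp add: alg_hom_def)
qed

text \<open>The modular law for subspaces: the \<open>N\<close>-part of an element of
  \<open>Z\<close> is a difference of two elements of \<open>Z\<close>, because \<open>F\<close>
  lies in \<open>Z\<close>.\<close>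

lemma (in rat_space) lspan_modular:
  assumes "subsp Z" "subsp N" "F \<subseteq> Z" "Z \<subseteq> lspan V (F \<union> N)"
  shows "Z \<subseteq> lspan V (F \<union> (Z \<inter> N))"
proof
  fix z assume z: "z \<in> Z"
  have FC: "F \<subseteq> carrier V" using assms(3) subspD(1)[OF assms(1)] by blast
  have "z \<in> lspan V (F \<union> N)" using assms(4) z by blast
  from lspan_Un_subsp[OF this assms(2) FC]
  obtain s w where sw: "s \<in> lspan V F" "w \<in> N" "z = s \<oplus> w" by blast
  have sZ: "s \<in> Z" using lspan_least[OF assms(3,1)] sw(1) by blast
  have "w = z \<ominus> s"
    using sw(3) add_minus_cancel_left[OF subspD(1)[OF assms(1) sZ] subspD(1)[OF assms(2) sw(2)]] by simp
  then have "w \<in> Z \<inter> N" using subspD(6)[OF assms(1) z sZ] sw(2) by simp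
  then have "w \<in> lspan V (F \<union> (Z \<inter> N))" by (simp add: lspan.incl)
  moreover have "s \<in> lspan V (F \<union> (Z \<inter> N))" using lspan_mono[of F "F \<union> (Z \<inter> N)" V] sw(1) by blast
  ultimately show "z \<in> lspan V (F \<union> (Z \<inter> N))" using sw(3) lspan.add by metis
qed

text \<open>Freeness of the target provides a section \<open>g\<close> of \<open>f\<close> over the new stage; the injectivity
  hypothesis on \<open>V\<close> modulo the old stage then forces \<open>g \<circ> f\<close> to be the identity.\<close>

lemma (in dga_map) bij_extend_stage:
  assumes free: "freely_generated B S' deg"
    and U: "homogeneous_gens A U" and U': "U' \<subseteq> S'" and bij: "bij_betw f (subalg A U) (subalg B U')"
    and V: "A.subsp V" "V \<subseteq> grade A l" and fV: "f ` V \<subseteq> V'"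
    and G: "G \<subseteq> V" "V \<subseteq> lspan A (G \<union> subalg A U)"
    and G': "G' \<subseteq> V'" "V' \<subseteq> lspan B (G' \<union> subalg B U')" "G' \<subseteq> S'"
    and inj: "\<And>v. \<lbrakk>v \<in> V; f v \<in> subalg B U'\<rbrakk> \<Longrightarrow> v \<in> subalg A U"
    and surj: "\<And>x'. x' \<in> V' \<Longrightarrow> \<exists>x\<in>V. x' \<ominus>\<^bsub>B\<^esub> f x \<in> subalg B U'"
  shows "bij_betw f (subalg A (U \<union> G)) (subalg B (U' \<union> G'))"
proof -
  let ?N = "subalg A U" and ?N' = "subalg B U'"
  have UC: "U \<subseteq> carrier A" by (rule A.homogeneous_gens_closed[OF U])
  have S'C: "S' \<subseteq> carrier B"
    using B.freely_generated_homogeneous(1)[OF free] B.homogeneous_gens_closed by blast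
  then have U'C: "U' \<subseteq> carrier B" and G'C: "G' \<subseteq> carrier B" using U' G'(3) by blast+
  have N: "A.subsp ?N" by (rule A.subalg_subsp[OF UC])
  have N': "B.subsp ?N'" by (rule B.subalg_subsp[OF U'C])
  have VC: "V \<subseteq> carrier A" using A.subspD(1)[OF V(1)] by blast
  have fN: "f n \<in> ?N'" if "n \<in> ?N" for n using bij that by (auto simp: bij_betw_def)
  have injN: "n = m" if "n \<in> ?N" "m \<in> ?N" "f n = f m" for n m
    using bij that by (auto simp: bij_betw_def inj_on_def)
  have VN: "V \<union> ?N \<subseteq> carrier A" using VC A.subspD(1)[OF N] by blast
  let ?L = "lspan A (V \<union> ?N)"
  have L: "A.subsp ?L" by (rule A.subsp_lspan[OF VN])
  \<comment> \<open>\<open>?L\<close> is graded, since \<open>V\<close> sits in the single degree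
    \<open>l\<close> and the old stage has homogeneous generators. This allows preimages of
    generators to be chosen in the degree that the universal property demands.\<close>
  have comp_L: "component A n x \<in> ?L" if "x \<in> ?L" for n x
  proof -
    have xL: "x \<in> lspan A (V \<union> ?N)" using that .
    from A.lspan_Un_subsp[OF xL N VC]
    obtain v w where vw: "v \<in> lspan A V" "w \<in> ?N" "x = v \<oplus>\<^bsub>A\<^esub> w" by blast
    have v: "v \<in> V" using A.lspan_least[OF order_refl V(1)] vw(1) by blast
    have "component A n v = v \<or> component A n v = \<zero>\<^bsub>A\<^esub>"
      using A.component_grade[of v l n] V(2) v by (auto split: if_splits)
    then have "component A n v \<in> V" using v A.subspD(2)[OF V(1)] by auto
    moreover have "component A n w \<in> ?N" by (rule A.component_in_subalg[OF U vw(2)])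
    moreover have "component A n x = component A n v \<oplus>\<^bsub>A\<^esub> component A n w"
      using vw v VC A.subspD(1)[OF N] by (simp add: A.component_add subset_iff)
    ultimately show ?thesis by (auto intro: lspan.add lspan.incl)
  qed
  have s_grade: "s \<in> grade B (deg s)" if "s \<in> S'" for s
    using free that by (simp add: freely_generated_def presented_by_def)
  \<comment> \<open>The value of the section on each generator: a preimage in the old stage for
    \<open>U'\<close>, a preimage in \<open>?L\<close> for \<open>G'\<close>. A generator in both
    sets is served by the first choice, as the old stage is part of \<open>?L\<close>.\<close>
  have choice: "\<exists>w. w \<in> grade A (deg s) \<and> (s \<in> U' \<longrightarrow> w \<in> ?N \<and> f w = s) \<and>
      (s \<in> G' \<longrightarrow> w \<in> ?L \<and> f w = s)" if s: "s \<in> S'" for s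
  proof -
    have fcomp: "f (component A (deg s) w) = s" if "w \<in> carrier A" "f w = s" for w
      using component[OF that(1), of "deg s"] that(2) B.component_grade[OF s_grade[OF s], of "deg s"] by simp
    consider "s \<in> U'" | "s \<notin> U'" "s \<in> G'" | "s \<notin> U'" "s \<notin> G'" by blast
    then show ?thesis
    proof cases
      case 1
      then have "s \<in> f ` ?N" using bij subset_subalg[of U' B] by (auto simp: bij_betw_def)
      then obtain w where w: "w \<in> ?N" "f w = s" by blast
      have "component A (deg s) w \<in> ?N" by (rule A.component_in_subalg[OF U w(1)])
      moreover have "component A (deg s) w \<in> grade A (deg s)" "f (component A (deg s) w) = s"
        using w A.subspD(1)[OF N] A.component_props(1) fcomp by auto
      ultimately show ?thesis by (meson UnI2 lspan.incl)
    next
      case 2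
      then obtain x where x: "x \<in> V" "s \<ominus>\<^bsub>B\<^esub> f x \<in> ?N'" using surj G'(1) by blast
      then have "s \<ominus>\<^bsub>B\<^esub> f x \<in> f ` ?N" using bij by (simp add: bij_betw_def)
      then obtain n where n: "n \<in> ?N" "s \<ominus>\<^bsub>B\<^esub> f x = f n" by blast
      have c: "x \<in> carrier A" "n \<in> carrier A" "s \<in> carrier B"
        using x(1) VC A.subspD(1)[OF N n(1)] s S'C by auto
      have "f (n \<oplus>\<^bsub>A\<^esub> x) = (s \<ominus>\<^bsub>B\<^esub> f x) \<oplus>\<^bsub>B\<^esub> f x" using c n by simp
      then have fs: "f (n \<oplus>\<^bsub>A\<^esub> x) = s" using B.minus_add_cancel[of s "f x"] c by simp
      have nx: "n \<oplus>\<^bsub>A\<^esub> x \<in> ?L" using n(1) x(1) by (auto intro: lspan.add lspan.incl)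
      have nxc: "n \<oplus>\<^bsub>A\<^esub> x \<in> carrier A" using c by simp
      show ?thesis
        using 2 comp_L[OF nx, of "deg s"] fcomp[OF nxc fs] A.component_props(1)[OF nxc, of "deg s"] by blast
    next
      \<comment> \<open>Generators of later stages have no influence on the claim; zero is
        admissible in every degree.\<close>
      case 3
      then show ?thesis using A.grade_zero[of "deg s"] by blast
    qed
  qed
  define h where "h s = (SOME w. w \<in> grade A (deg s) \<and> (s \<in> U' \<longrightarrow> w \<in> ?N \<and> f w = s) \<and>
      (s \<in> G' \<longrightarrow> w \<in> ?L \<and> f w = s))" for s
  have h: "h s \<in> grade A (deg s) \<and> (s \<in> U' \<longrightarrow> h s \<in> ?N \<and> f (h s) = s) \<and>
      (s \<in> G' \<longrightarrow> h s \<in> ?L \<and> f (h s) = s)" if "s \<in> S'" for s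
    unfolding h_def by (rule someI_ex[OF choice[OF that]])
  obtain g where g: "g \<in> alg_hom B A" "\<And>s. s \<in> S' \<Longrightarrow> g s = h s"
    using freely_generated_extension[OF B.differential_algebra_axioms A.differential_algebra_axioms free, of h] h by blast
  interpret g: algebra_map B A g using g(1) by unfold_locales
  have fg: "f (g y) = y" if "y \<in> subalg B (U' \<union> G')" for y
  proof -
    interpret fg: algebra_map B B "\<lambda>x. f (g x)"
      by (rule alg_hom_comp[OF g.algebra_map_axioms algebra_map_axioms])
    have "f (g s) = s" if "s \<in> U' \<union> G'" for s using h[of s] g(2)[of s] that U' G'(3) by auto
    then show ?thesis
      using fg.agree_on_subalg[OF B.algebra_map_id, of "U' \<union> G'" y] that U'C G'C by blast
  qed
  have gN: "g y \<in> ?N" if "y \<in> ?N'" for y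
  proof (rule g.subalg_image_subset[OF U'C _ that])
    show "g ` U' \<subseteq> ?N"
    proof
      fix x assume "x \<in> g ` U'"
      then obtain s where s: "s \<in> U'" "x = g s" by blast
      then have "s \<in> S'" using U' by blast
      then show "x \<in> ?N" using h[of s] g(2)[of s] s by simp
    qed
  qed
  have N'_sub: "?N' \<subseteq> subalg B (U' \<union> G')" by (rule subalg_mono) blast
  have N_sub: "?N \<subseteq> subalg A (U \<union> G)" by (rule subalg_mono) blast
  have V'_sub: "V' \<subseteq> subalg B (U' \<union> G')"
    using G'(2) B.lspan_subset_subalg[of "G' \<union> ?N'" "U' \<union> G'"] N'_sub subset_subalg[of "U' \<union> G'" B] by blast
  have V_sub: "V \<subseteq> subalg A (U \<union> G)"
    using G(2) A.lspan_subset_subalg[of "G \<union> ?N" "U \<union> G"] N_sub subset_subalg[of "U \<union> G" A] by blast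
  have L_sub: "?L \<subseteq> subalg A (U \<union> G)"
    by (rule A.lspan_subset_subalg) (use V_sub N_sub in blast)
  have gL: "g y \<in> ?L" if "y \<in> V'" for y
  proof -
    have C: "G' \<union> ?N' \<subseteq> carrier B" using G'C B.subspD(1)[OF N'] by blast
    have "g ` (G' \<union> ?N') \<subseteq> ?L"
      using h g(2) G'(3) gN by (auto intro: lspan.incl)
    then have "lspan A (g ` (G' \<union> ?N')) \<subseteq> ?L" by (rule lspan_subset_lspan)
    then show ?thesis using g.lspan_image[OF C] G'(2) that by blast
  qed
  have gfN: "g (f n) = n" if n: "n \<in> ?N" for n
  proof (rule injN)
    show "g (f n) \<in> ?N" "n \<in> ?N" using gN fN n by auto
    show "f (g (f n)) = f n" using fg fN[OF n] N'_sub by blast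
  qed
  have gfV: "g (f v) = v" if v: "v \<in> V" for v
  proof -
    have vc: "v \<in> carrier A" using v VC by blast
    have fv: "f v \<in> V'" using fV v by blast
    have gfL: "g (f v) \<in> ?L" by (rule gL[OF fv])
    have gfc: "g (f v) \<in> carrier A" using A.subspD(1)[OF L gfL] .
    \<comment> \<open>The defect \<open>?u\<close> is killed by \<open>f\<close>. Writing it as
      \<open>v0 + n0\<close>, the image of \<open>v0\<close> lies in the old target stage, so
      \<open>inj\<close> moves \<open>v0\<close> and with it \<open>?u\<close> into the old stage,
      where \<open>f\<close> is injective.\<close>
    let ?u = "v \<ominus>\<^bsub>A\<^esub> g (f v)"
    have uL: "?u \<in> lspan A (V \<union> ?N)" using A.subspD(6)[OF L _ gfL] v by (auto intro: lspan.incl)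
    have "f (g (f v)) = f v" using fg[of "f v"] fv V'_sub by blast
    then have fu: "f ?u = \<zero>\<^bsub>B\<^esub>" using vc gfc by simp
    from A.lspan_Un_subsp[OF uL N VC]
    obtain v0 n0 where vn: "v0 \<in> lspan A V" "n0 \<in> ?N" "?u = v0 \<oplus>\<^bsub>A\<^esub> n0" by blast
    have v0: "v0 \<in> V" using A.lspan_least[OF order_refl V(1)] vn(1) by blast
    have c: "v0 \<in> carrier A" "n0 \<in> carrier A" using v0 VC A.subspD(1)[OF N vn(2)] by auto
    have "f v0 \<oplus>\<^bsub>B\<^esub> f n0 = \<zero>\<^bsub>B\<^esub>" using fu vn(3) c by simp
    then have "f v0 = \<ominus>\<^bsub>B\<^esub> f n0" using c by (simp add: B.minus_equality)
    then have "f v0 \<in> ?N'" using B.subspD(5)[OF N' fN[OF vn(2)]] by simp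
    then have "v0 \<in> ?N" by (rule inj[OF v0])
    then have uN: "?u \<in> ?N" using vn(2,3) A.subspD(3)[OF N] by simp
    have "f ?u = f \<zero>\<^bsub>A\<^esub>" using fu by simp
    then have "?u = \<zero>\<^bsub>A\<^esub>" using injN[OF uN A.subspD(2)[OF N]] by simp
    then show ?thesis using A.eq_iff_minus_zero[OF vc gfc] by simp
  qed
  have UG: "U \<union> G \<subseteq> carrier A" using UC G(1) VC by blast
  have gf: "g (f x) = x" if x: "x \<in> subalg A (U \<union> G)" for x
  proof -
    interpret gf: algebra_map A A "\<lambda>x. g (f x)"
      by (rule alg_hom_comp[OF algebra_map_axioms g.algebra_map_axioms])
    have "g (f s) = s" if "s \<in> U \<union> G" for s
      using that gfN[of s] gfV[of s] G(1) subset_subalg[of U A] by blast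
    then show ?thesis using gf.agree_on_subalg[OF A.algebra_map_id UG _ x] by blast
  qed
  have f_sub: "f x \<in> subalg B (U' \<union> G')" if "x \<in> subalg A (U \<union> G)" for x
  proof (rule subalg_image_subset[OF UG _ that])
    show "f ` (U \<union> G) \<subseteq> subalg B (U' \<union> G')"
      using fN subset_subalg[of U A] N'_sub fV G(1) V'_sub by blast
  qed
  have g_sub: "g y \<in> subalg A (U \<union> G)" if "y \<in> subalg B (U' \<union> G')" for y
  proof (rule g.subalg_image_subset[OF _ _ that])
    show "U' \<union> G' \<subseteq> carrier B" using U'C G'C by blast
    show "g ` (U' \<union> G') \<subseteq> subalg A (U \<union> G)"
      using gN subset_subalg[of U' B] N_sub gL G'(1) L_sub by blast
  qed
  show ?thesis
    by (rule bij_betw_byWitness[where f' = g]) (use gf fg f_sub g_sub in auto)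
qed

section \<open>Comparing the two models\<close>

text \<open>The second run has the cohomology of \<open>MA\<close> as its base algebra. Finite
  presentation of \<open>A\<close> is kept only in the form of finite dimension in each
  degree.\<close>

locale psi_condition =
  a: model_run i A MA \<phi>A X Y + h: model_run i "cohomology MA" MH \<phi>H XH YH
  for i and A :: "'a dga" and MA :: "'m dga" and \<phi>A X Y
    and MH :: "'n dga" and \<phi>H XH YH +
  fixes \<psi> :: "'m \<Rightarrow> 'm set"
  assumes psi_hom: "\<psi> \<in> alg_hom MA (cohomology MA)"
    and psi_x: "x \<in> X k \<Longrightarrow> \<psi> x = coh_class MA x"
    and psi_y: "y \<in> Y k t \<Longrightarrow> \<psi> y = \<zero>\<^bsub>cohomology MA\<^esub>"
    and psi_z: "y \<in> Y k t \<Longrightarrow> \<psi> (dif MA y) = \<zero>\<^bsub>cohomology MA\<^esub>"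
    and finite_A: "finite_span A (grade A l)"
    and num_inv_eq: "\<lbrakk>1 \<le> l; l \<le> i\<rbrakk> \<Longrightarrow> num_inv MA l j = num_inv MH l j"
begin

abbreviation HM :: "'m set dga" where "HM \<equiv> cohomology MA"

sublocale psi: algebra_map MA HM \<psi>
  using psi_hom by unfold_locales

lemma psi_gens:
  assumes "s \<in> a.S"
  shows "s \<in> grade MA d \<Longrightarrow> \<psi> s \<in> grade HM d" "\<psi> (dif MA s) = \<zero>\<^bsub>HM\<^esub>"
proof -
  from assms consider k where "s \<in> X k" | k t where "s \<in> Y k t" by (auto simp: a.S_def)
  then have "(s \<in> grade MA d \<longrightarrow> \<psi> s \<in> grade HM d) \<and> \<psi> (dif MA s) = \<zero>\<^bsub>HM\<^esub>"
  proof cases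
    case 1
    then have "s \<in> cocycles MA" using a.X_cocycles by blast
    then show ?thesis using 1 psi_x a.run.X_closed by (simp add: a.M.coh_grade)
  next
    case 2
    then show ?thesis using psi_y psi_z h.B.grade_zero by simp
  qed
  then show "s \<in> grade MA d \<Longrightarrow> \<psi> s \<in> grade HM d" "\<psi> (dif MA s) = \<zero>\<^bsub>HM\<^esub>" by blast+
qed

lemma psi_dga_hom: "\<psi> \<in> dga_hom MA HM"
proof (rule psi.dga_homI)
  show "\<psi> x \<in> grade HM n" if "x \<in> grade MA n" for x n
    by (rule psi.grade_image[OF a.homogeneous_S a.carrier_S _ that]) (rule psi_gens)
  show "\<psi> (dif MA x) = dif HM (\<psi> x)" if "x \<in> carrier MA" for x
  proof (rule psi.dif_commutes[OF a.homogeneous_S])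
    show "x \<in> subalg MA a.S" using that a.carrier_S by simp
    show "\<psi> (dif MA s) = dif HM (\<psi> s)" if "s \<in> a.S" for s
      using psi_gens(2)[OF that] by (simp add: a.M.coh_dif)
  qed (rule psi_gens)
qed

lemma psi_dif: "x \<in> carrier MA \<Longrightarrow> \<psi> (dif MA x) = \<zero>\<^bsub>HM\<^esub>"
  using psi_dga_hom by (simp add: dga_hom_def a.M.coh_dif)

lemma coboundaries_HM: "coboundaries HM = {\<zero>\<^bsub>HM\<^esub>}"
  unfolding coboundaries_def a.M.coh_dif using h.B.zero_closed by blast

lemma cocycles_HM: "cocycles HM = carrier HM"
  by (simp add: cocycles_def a.M.coh_dif)

text \<open>Since the target has zero differential, a surjection in cohomology is a surjection of the
  algebras themselves; this is why no homotopies are needed below.\<close>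

lemma phiH_surj:
  assumes "l \<le> i" "e \<in> grade HM l"
  obtains c where "c \<in> cocycles MH" "c \<in> grade MH l" "\<phi>H c = e"
proof -
  have ec: "e \<in> carrier HM" by (rule h.B.grade_closed[OF assms(2)])
  have "coh_class HM e \<in> coh HM l"
    using assms(2) ec by (auto simp: h.B.coh_grade cocycles_HM)
  moreover have "coh_map HM \<phi>H ` coh MH l = coh HM l"
    using h.quasi assms(1) by (auto simp: quasi_iso_def bij_betw_def)
  ultimately have "coh_class HM e \<in> coh_map HM \<phi>H ` coh MH l" by simp
  then obtain c where c: "c \<in> cocycles MH" "c \<in> grade MH l" "coh_class HM e = coh_map HM \<phi>H (coh_class MH c)"
    unfolding h.M.coh_grade by blast
  then have "coh_class HM e = coh_class HM (\<phi>H c)" by (simp add: h.phi.coh_map_class)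
  moreover have phic: "\<phi>H c \<in> carrier HM" using h.M.cocyclesD(1)[OF c(1)] by simp
  ultimately have "e \<ominus>\<^bsub>HM\<^esub> \<phi>H c = \<zero>\<^bsub>HM\<^esub>"
    using h.B.cls_eq_iff[OF ec phic] coboundaries_HM by simp
  then have "\<phi>H c = e" using h.B.eq_iff_minus_zero[OF ec phic] by simp
  with c that show ?thesis by blast
qed

section \<open>Lifting \<open>\<psi>\<close> through \<open>\<phi>H\<close>\<close>

definition deg where "deg = (SOME deg. freely_generated MA a.S deg)"

lemma deg: "freely_generated MA a.S deg"
  unfolding deg_def using a.S_free by (rule someI_ex)

lemma deg_grade: "s \<in> a.S \<Longrightarrow> s \<in> grade MA (deg s)"
  using deg by (simp add: freely_generated_def presented_by_def)

lemma deg_unique: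
  assumes "s \<in> a.S" "s \<in> grade MA d"
  shows "s = \<zero>\<^bsub>MA\<^esub> \<or> d = deg s"
  using a.M.component_grade[OF deg_grade[OF assms(1)], of d] a.M.component_grade[OF assms(2), of d]
  by (auto split: if_splits)

lemma deg_le:
  assumes "s \<in> a.S"
  shows "s = \<zero>\<^bsub>MA\<^esub> \<or> deg s \<le> i"
proof -
  from assms consider k where "s \<in> X k" | k t where "s \<in> Y k t" by (auto simp: a.S_def)
  then show ?thesis
  proof cases
    case 1
    then show ?thesis using deg_unique[OF assms, of k] a.run.X_grade[of k] a.run.X_range[of k] by fastforce
  next
    case 2
    then show ?thesis
      using deg_unique[OF assms, of "k - 1"] a.run.Y_grade[of k t] a.run.Y_range[of k t] by fastforce
  qed
qed

text \<open>A partial lift is a total algebra map, as freeness provides, with the right degrees on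
  all generators; compatibility with the differential and with \<open>\<psi>\<close> is demanded on
  \<open>U\<close> only. This avoids maps on varying domains.\<close>

definition lifts_on :: "('m \<Rightarrow> 'n) \<Rightarrow> 'm set \<Rightarrow> bool"
  where "lifts_on f U \<longleftrightarrow> f \<in> alg_hom MA MH \<and> (\<forall>s\<in>a.S. f s \<in> grade MH (deg s)) \<and>
    (\<forall>s\<in>U. f (dif MA s) = dif MH (f s) \<and> \<phi>H (f s) = \<psi> s)"

lemma lifts_on_grade:
  assumes "lifts_on f U"
  shows "\<lbrakk>s \<in> a.S; s \<in> grade MA d\<rbrakk> \<Longrightarrow> f s \<in> grade MH d" "x \<in> grade MA n \<Longrightarrow> f x \<in> grade MH n"
proof -
  interpret f: algebra_map MA MH f using assms by unfold_locales (simp add: lifts_on_def)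
  show *: "f s \<in> grade MH d" if "s \<in> a.S" "s \<in> grade MA d" for s d
    using assms that deg_unique[OF that] h.M.grade_zero by (auto simp: lifts_on_def)
  show "f x \<in> grade MH n" if "x \<in> grade MA n"
    by (rule f.grade_image[OF a.homogeneous_S a.carrier_S _ that]) (rule *)
qed

lemma lifts_on_subalg:
  assumes f: "lifts_on f U" and U: "U \<subseteq> a.S" and x: "x \<in> subalg MA U"
  shows "f (dif MA x) = dif MH (f x)" "\<phi>H (f x) = \<psi> x"
proof -
  interpret f: algebra_map MA MH f using f by unfold_locales (simp add: lifts_on_def)
  have UC: "U \<subseteq> carrier MA" using U a.S_closed by blast
  show "f (dif MA x) = dif MH (f x)"
  proof (rule f.dif_commutes[OF homogeneous_gens_subset[OF a.homogeneous_S U] _ _ x])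
    show "f s \<in> grade MH d" if "s \<in> U" "s \<in> grade MA d" for s d
      using lifts_on_grade(1)[OF f] that U by blast
    show "f (dif MA s) = dif MH (f s)" if "s \<in> U" for s using f that by (simp add: lifts_on_def)
  qed
  interpret pf: algebra_map MA HM "\<lambda>x. \<phi>H (f x)"
    by (rule alg_hom_comp[OF f.algebra_map_axioms h.phi.algebra_map_axioms])
  show "\<phi>H (f x) = \<psi> x"
    by (rule pf.agree_on_subalg[OF psi.algebra_map_axioms UC _ x]) (use f in \<open>simp add: lifts_on_def\<close>)
qed

lemma lifts_on_empty: "\<exists>f. lifts_on f {}"
proof -
  obtain f where "f \<in> alg_hom MA MH" "\<And>s. s \<in> a.S \<Longrightarrow> f s = \<zero>\<^bsub>MH\<^esub>"
    using freely_generated_extension[OF a.run.dga_M h.run.dga_M deg, of "\<lambda>_. \<zero>\<^bsub>MH\<^esub>"] h.M.grade_zero by metis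
  then show ?thesis using h.M.grade_zero by (auto simp: lifts_on_def)
qed

text \<open>For a new generator \<open>s\<close> the element \<open>f (dif MA s)\<close> is a
  cocycle mapped to zero by \<open>\<phi>H\<close>, hence equal to some \<open>dif MH u\<close> by
  injectivity in degree \<open>deg s + 1 \<le> i + 1\<close>. Surjectivity in degree
  \<open>deg s\<close> then supplies a cocycle that corrects \<open>\<phi>H u\<close> to
  \<open>\<psi> s\<close>.\<close>

lemma lifts_on_extend:
  assumes f: "lifts_on f U" and U: "U \<subseteq> a.S" and G: "G \<subseteq> a.S"
    and dU: "\<And>s. s \<in> U \<Longrightarrow> dif MA s \<in> subalg MA U" and dG: "\<And>s. s \<in> G \<Longrightarrow> dif MA s \<in> subalg MA U"
  shows "\<exists>f. lifts_on f (U \<union> G)"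
proof -
  interpret f: algebra_map MA MH f using f by unfold_locales (simp add: lifts_on_def)
  have UC: "U \<subseteq> carrier MA" using U a.S_closed by blast
  have lift: "\<exists>u. u \<in> grade MH (deg s) \<and> dif MH u = f (dif MA s) \<and> \<phi>H u = \<psi> s" if s: "s \<in> G" for s
  \<comment> \<open>The bound \<open>deg s \<le> i\<close> is available for nonzero generators; a
    zero generator is lifted to zero.\<close>
  proof (cases "s = \<zero>\<^bsub>MA\<^esub>")
    case True
    then show ?thesis by (intro exI[of _ "\<zero>\<^bsub>MH\<^esub>"]) (simp add: h.M.grade_zero)
  next
    case False
    have sS: "s \<in> a.S" using s G by blast
    then have sc: "s \<in> carrier MA" using a.S_closed by blast
    have di: "deg s \<le> i" using deg_le[OF sS] False by blast
    let ?z = "f (dif MA s)"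
    have ds: "dif MA s \<in> carrier MA" using sc by simp
    have zg: "?z \<in> grade MH (Suc (deg s))"
      by (rule lifts_on_grade(2)[OF f a.M.dif_grade[OF deg_grade[OF sS]]])
    have "dif MH ?z = f (dif MA (dif MA s))" using lifts_on_subalg(1)[OF f U dG[OF s]] by simp
    then have zc: "?z \<in> cocycles MH" using a.M.dif_dif[OF sc] ds by (simp add: cocycles_def)
    have "\<phi>H ?z = \<zero>\<^bsub>HM\<^esub>" using lifts_on_subalg(2)[OF f U dG[OF s]] psi_dif[OF sc] by simp
    then have "?z \<in> coboundaries MH"
      using h.inj_coh[of "Suc (deg s)" ?z] di zc zg coboundaries_HM by simp
    then obtain u where u: "u \<in> grade MH (deg s)" "?z = dif MH u"
      using h.M.grade_coboundary zg by blast
    note uc = h.M.grade_closed[OF u(1)]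
    have psg: "\<psi> s \<in> grade HM (deg s)" by (rule psi_gens(1)[OF sS deg_grade[OF sS]])
    have "\<psi> s \<ominus>\<^bsub>HM\<^esub> \<phi>H u \<in> grade HM (deg s)"
      by (rule h.B.grade_minus[OF psg h.phi.grade[OF u(1)]])
    from phiH_surj[OF di this]
    obtain c where c: "c \<in> cocycles MH" "c \<in> grade MH (deg s)" "\<phi>H c = \<psi> s \<ominus>\<^bsub>HM\<^esub> \<phi>H u" by blast
    note cc = h.M.cocyclesD[OF c(1)]
    show ?thesis
    proof (intro exI[of _ "c \<oplus>\<^bsub>MH\<^esub> u"] conjI)
      show "c \<oplus>\<^bsub>MH\<^esub> u \<in> grade MH (deg s)" by (rule h.M.grade_add[OF c(2) u(1)])
      show "dif MH (c \<oplus>\<^bsub>MH\<^esub> u) = ?z" using cc uc u(2) by simp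
      show "\<phi>H (c \<oplus>\<^bsub>MH\<^esub> u) = \<psi> s"
        using cc uc c(3) h.B.minus_add_cancel[OF psi.closed[OF sc] h.phi.closed[OF uc]] by simp
    qed
  qed
  define u where "u s = (SOME u. u \<in> grade MH (deg s) \<and> dif MH u = f (dif MA s) \<and> \<phi>H u = \<psi> s)" for s
  have u: "u s \<in> grade MH (deg s) \<and> dif MH (u s) = f (dif MA s) \<and> \<phi>H (u s) = \<psi> s" if "s \<in> G" for s
    unfolding u_def by (rule someI_ex[OF lift[OF that]])
  \<comment> \<open>Images of old generators are kept, so the new map agrees with \<open>f\<close>
    on the old stage, where the differentials of \<open>G\<close> lie. The value zero elsewhere is a
    placeholder for later extensions.\<close>
  let ?h = "\<lambda>s. if s \<in> U then f s else if s \<in> G then u s else \<zero>\<^bsub>MH\<^esub>"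
  have hg: "?h s \<in> grade MH (deg s)" if "s \<in> a.S" for s
    using f that u[of s] h.M.grade_zero by (auto simp: lifts_on_def)
  from freely_generated_extension[OF a.run.dga_M h.run.dga_M deg hg]
  obtain f' where f': "f' \<in> alg_hom MA MH" "\<And>s. s \<in> a.S \<Longrightarrow> f' s = ?h s" by blast
  interpret f': algebra_map MA MH f' using f'(1) by unfold_locales
  have eq: "f' x = f x" if "x \<in> subalg MA U" for x
    by (rule f'.agree_on_subalg[OF f.algebra_map_axioms UC _ that]) (use f'(2) U in auto)
  have "lifts_on f' (U \<union> G)"
    unfolding lifts_on_def
  proof (intro conjI ballI f'(1))
    show "f' s \<in> grade MH (deg s)" if "s \<in> a.S" for s using hg[OF that] f'(2)[OF that] by simp
    fix s assume s: "s \<in> U \<union> G"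
    then have sS: "s \<in> a.S" using U G by blast
    have d: "f' (dif MA s) = f (dif MA s)" using s dU dG eq by blast
    show "f' (dif MA s) = dif MH (f' s)"
      using d f'(2)[OF sS] s u[of s] f by (auto simp: lifts_on_def)
    show "\<phi>H (f' s) = \<psi> s"
      using f'(2)[OF sS] s u[of s] f by (auto simp: lifts_on_def)
  qed
  then show ?thesis by blast
qed

lemma lifts_on_gens_below: "\<exists>f. lifts_on f (gens_below X Y k)"
proof (induction k)
  case 0
  then show ?case using lifts_on_empty by (simp add: gens_below_def)
next
  case (Suc k)
  have T: "\<exists>f. lifts_on f (a.T k t)" for t
  proof (induction t)
    case 0
    then show ?case using Suc by (simp add: a.T_0)
  next
    case (Suc t)
    then obtain f where "lifts_on f (a.T k t)" by blast
    then show ?case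
      unfolding a.T_Suc
      by (rule lifts_on_extend) (use a.T_subset_S a.dif_T a.dif_Y in \<open>auto simp: a.S_def\<close>)
  qed
  \<comment> \<open>The \<open>y\<close>-step is finished after finitely many iterations, so no
    limit of successive lifts has to be formed.\<close>
  obtain t where t: "a.T_inf k = a.T k t" by (rule a.T_inf_eq_T)
  obtain f where "lifts_on f (a.T_inf k)" using T t by metis
  then show ?case
    unfolding a.gens_below_Suc
    by (rule lifts_on_extend)
      (use a.T_inf_subset_S a.dif_T_inf a.run.X_closed a.M.subalg_zero in \<open>auto simp: a.S_def\<close>)
qed

lemma lift_exists:
  obtains f where "f \<in> dga_hom MA MH" "\<And>x. x \<in> carrier MA \<Longrightarrow> \<phi>H (f x) = \<psi> x"
proof -
  \<comment> \<open>The index \<open>i + 2\<close> is the first one beyond the final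
    \<open>y\<close>-step, which is the one for \<open>i + 1\<close>.\<close>
  obtain f where f: "lifts_on f (gens_below X Y (Suc (Suc i)))" using lifts_on_gens_below by blast
  moreover have "a.S \<subseteq> gens_below X Y (Suc (Suc i))"
    unfolding a.gens_below_Suc a.T_inf_top by blast
  ultimately have f: "lifts_on f a.S" by (auto simp: lifts_on_def)
  then interpret f: algebra_map MA MH f by unfold_locales (simp add: lifts_on_def)
  have "f \<in> dga_hom MA MH"
    using lifts_on_subalg(1)[OF f order_refl] lifts_on_grade(2)[OF f] a.carrier_S
    by (intro f.dga_homI) auto
  moreover have "\<phi>H (f x) = \<psi> x" if "x \<in> carrier MA" for x
    using lifts_on_subalg(2)[OF f order_refl] that a.carrier_S by simp
  ultimately show ?thesis using that by blast
qed

lemma finite_HM: "finite_span HM (grade HM l)"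
  by (rule a.M.finite_span_coh_grade[OF a.finite_span_grade[OF finite_A]])

end

section \<open>Bijectivity of the lift along the stages\<close>

locale lifted = psi_condition +
  fixes f
  assumes f_hom: "f \<in> dga_hom MA MH" and f_psi: "x \<in> carrier MA \<Longrightarrow> \<phi>H (f x) = \<psi> x"
begin

sublocale f: dga_map MA MH f
  using f_hom by unfold_locales

text \<open>\<open>\<psi>\<close> maps a closed generator to its own class and the others to zero,
  so representatives exist in the same stage for generators; cocycles of the stage are closed under
  all operations.\<close>

lemma psi_image_stage:
  assumes "m \<in> subalg MA (a.T_inf l)"
  shows "\<exists>m'\<in>subalg MA (a.T_inf l) \<inter> cocycles MA. \<psi> m = coh_class MA m'"
  using assms
proof induction
  case one
  then show ?case using a.M.one_cocycle a.M.cls_one by (intro bexI[of _ "\<one>\<^bsub>MA\<^esub>"]) (auto intro: subalg.one)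
next
  case (incl s)
  then have "s \<in> a.S" using a.T_inf_subset_S by blast
  then consider k where "s \<in> X k" | k t where "s \<in> Y k t" by (auto simp: a.S_def)
  then show ?case
  proof cases
    case 1
    then have "s \<in> cocycles MA" using a.X_cocycles by blast
    then show ?thesis using psi_x[OF 1] incl by (intro bexI[of _ s]) (auto intro: subalg.incl)
  next
    case 2
    then show ?thesis
      using psi_y[OF 2] a.M.cls_zero a.M.subalg_zero a.M.subspD(2)[OF a.M.subsp_cocycles]
      by (intro bexI[of _ "\<zero>\<^bsub>MA\<^esub>"]) auto
  qed
next
  case (smult x c)
  then obtain x' where x': "x' \<in> subalg MA (a.T_inf l)" "x' \<in> cocycles MA" "\<psi> x = coh_class MA x'" by blast
  have xc: "x \<in> carrier MA" using smult(1) a.M.subalg_closed a.T_inf_closed by blast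
  show ?case
  proof (intro bexI[of _ "c \<odot>\<^bsub>MA\<^esub> x'"] IntI)
    show "\<psi> (c \<odot>\<^bsub>MA\<^esub> x) = coh_class MA (c \<odot>\<^bsub>MA\<^esub> x')"
      using x' xc a.M.cls_smult[OF a.M.cocyclesD(1)] by simp
  qed (use x' a.M.subspD(4)[OF a.M.subsp_cocycles] in \<open>auto intro: subalg.smult\<close>)
next
  case (add x y)
  then obtain x' y' where xy: "x' \<in> subalg MA (a.T_inf l)" "x' \<in> cocycles MA" "\<psi> x = coh_class MA x'"
    "y' \<in> subalg MA (a.T_inf l)" "y' \<in> cocycles MA" "\<psi> y = coh_class MA y'" by blast
  have c: "x \<in> carrier MA" "y \<in> carrier MA" using add(1,2) a.M.subalg_closed a.T_inf_closed by blast+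
  show ?case
  proof (intro bexI[of _ "x' \<oplus>\<^bsub>MA\<^esub> y'"] IntI)
    show "\<psi> (x \<oplus>\<^bsub>MA\<^esub> y) = coh_class MA (x' \<oplus>\<^bsub>MA\<^esub> y')"
      using xy c a.M.cls_add[OF a.M.cocyclesD(1) a.M.cocyclesD(1)] by simp
  qed (use xy a.M.subspD(3)[OF a.M.subsp_cocycles] in \<open>auto intro: subalg.add\<close>)
next
  case (mult x y)
  then obtain x' y' where xy: "x' \<in> subalg MA (a.T_inf l)" "x' \<in> cocycles MA" "\<psi> x = coh_class MA x'"
    "y' \<in> subalg MA (a.T_inf l)" "y' \<in> cocycles MA" "\<psi> y = coh_class MA y'" by blast
  have c: "x \<in> carrier MA" "y \<in> carrier MA" using mult(1,2) a.M.subalg_closed a.T_inf_closed by blast+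
  show ?case
  proof (intro bexI[of _ "x' \<otimes>\<^bsub>MA\<^esub> y'"] IntI)
    show "\<psi> (x \<otimes>\<^bsub>MA\<^esub> y) = coh_class MA (x' \<otimes>\<^bsub>MA\<^esub> y')"
      using xy c a.M.cls_mult by simp
  qed (use xy a.M.cocycle_mult in \<open>auto intro: subalg.mult\<close>)
qed

text \<open>The component of degree \<open>l\<close> of any preimage is still a preimage, because
  \<open>f\<close> commutes with taking components.\<close>

lemma homogeneous_preimage:
  assumes "bij_betw f (subalg MA U) N'" "homogeneous_gens MA U" "v \<in> grade MA l" "f v \<in> N'"
  obtains n where "n \<in> subalg MA U" "n \<in> grade MA l" "f n = f v"
proof -
  obtain m where m: "m \<in> subalg MA U" "f m = f v" using assms(1,4) by (metis bij_betw_imp_surj_on imageE)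
  have mc: "m \<in> carrier MA"
    using a.M.subalg_closed[OF m(1) a.M.homogeneous_gens_closed[OF assms(2)]] .
  have "f (component MA l m) = f v"
    using f.component[OF mc, of l] h.M.component_grade[OF f.grade[OF assms(3)], of l] m(2) by simp
  then show ?thesis
    using that a.M.component_in_subalg[OF assms(2) m(1)] a.M.component_props(1)[OF mc] by blast
qed

text \<open>On the span of \<open>X l\<close> the map \<open>\<psi>\<close> is passage to the cohomology class, and it maps the stage
  below into classes of that stage.\<close>

lemma psi_kernel_in_stage:
  assumes l: "1 \<le> l" "l \<le> i" and c: "c \<in> cocycles MA" "c \<in> grade MA l" and 0: "\<psi> c = \<zero>\<^bsub>HM\<^esub>"
  shows "c \<in> subalg MA (a.T_inf l)"
proof -
  let ?N = "subalg MA (a.T_inf l)"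
  have N: "a.M.subsp ?N" by (rule a.M.subalg_subsp[OF a.T_inf_closed])
  have XC: "X l \<subseteq> carrier MA" using a.X_cocycles a.M.cocyclesD(1) by blast
  from a.M.lspan_Un_subsp[OF a.cocycle_decomposition[OF l c] N XC]
  obtain s m where sm: "s \<in> lspan MA (X l)" "m \<in> ?N" "c = s \<oplus>\<^bsub>MA\<^esub> m" by blast
  have sZ: "s \<in> cocycles MA" using a.M.lspan_least[OF a.X_cocycles a.M.subsp_cocycles] sm(1) by blast
  have sg: "s \<in> grade MA l" using a.M.lspan_least[OF a.run.X_grade a.M.grade_subspace] sm(1) by blast
  note sc = a.M.cocyclesD(1)[OF sZ] and mc = a.M.subspD(1)[OF N sm(2)]
  have "\<psi> s = coh_class MA s"
    using sm(1)
  proof induction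
    case zero then show ?case by (simp add: a.M.cls_zero)
  next
    case (incl x) then show ?case by (rule psi_x)
  next
    case (smult x c)
    then show ?case using a.M.lspan_closed[OF smult(1) XC] by (simp add: a.M.cls_smult)
  next
    case (add x y)
    then show ?case using a.M.lspan_closed[OF add(1) XC] a.M.lspan_closed[OF add(2) XC] by (simp add: a.M.cls_add)
  qed
  moreover obtain m' where m': "m' \<in> ?N" "m' \<in> cocycles MA" "\<psi> m = coh_class MA m'"
    using psi_image_stage[OF sm(2)] by blast
  moreover note m'c = a.M.cocyclesD(1)[OF m'(2)]
  ultimately have "coh_class MA (s \<oplus>\<^bsub>MA\<^esub> m') = \<zero>\<^bsub>HM\<^esub>"
    using 0 sm(3) sc mc by (simp add: a.M.cls_add[OF sc m'c])
  then have "s \<oplus>\<^bsub>MA\<^esub> m' \<in> coboundaries MA" using a.M.cls_eq_zero_iff sc m'c by simp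
  \<comment> \<open>The representative \<open>m'\<close> need not be homogeneous, while exact
    elements are located by degree; passing to the component of degree \<open>l\<close> leaves
    \<open>s\<close> unchanged.\<close>
  then have "component MA l (s \<oplus>\<^bsub>MA\<^esub> m') \<in> coboundaries MA" by (rule a.M.component_coboundary)
  moreover have "component MA l (s \<oplus>\<^bsub>MA\<^esub> m') \<in> grade MA (Suc (l - 1))"
    using a.M.component_props(1)[of "s \<oplus>\<^bsub>MA\<^esub> m'" l] sc m'c l(1) by simp
  ultimately have "component MA l (s \<oplus>\<^bsub>MA\<^esub> m') \<in> subalg MA (a.T_inf (Suc (l - 1)))"
    by (rule a.exact_in_T_inf)
  then have 1: "s \<oplus>\<^bsub>MA\<^esub> component MA l m' \<in> ?N"
    using a.M.component_add[OF sc m'c, of l] a.M.component_grade[OF sg, of l] l(1) by simp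
  have 2: "component MA l m' \<in> ?N" by (rule a.M.component_in_subalg[OF a.homogeneous_T_inf m'(1)])
  have "s = (component MA l m' \<oplus>\<^bsub>MA\<^esub> s) \<ominus>\<^bsub>MA\<^esub> component MA l m'"
    using a.M.add_minus_cancel_left[of "component MA l m'" s] sc m'c by simp
  also have "component MA l m' \<oplus>\<^bsub>MA\<^esub> s = s \<oplus>\<^bsub>MA\<^esub> component MA l m'"
    using sc m'c by (intro a.M.a_comm) simp_all
  finally have "s \<in> ?N" using a.M.subspD(6)[OF N 1 2] by simp
  then show ?thesis using sm(2,3) by (simp add: subalg.add)
qed

text \<open>Let \<open>n\<close> be a homogeneous stage element with \<open>f n = f v\<close>. Since
  \<open>f\<close> is injective on the stage and \<open>dif MA n\<close> has image zero,
  \<open>n\<close> is closed. Then \<open>v - n\<close> is a cocycle killed by \<open>f\<close>,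
  hence by \<open>\<psi>\<close>, and \<open>psi_kernel_in_stage\<close> applies.\<close>

lemma inj_mod_stage_0:
  assumes bij: "bij_betw f (subalg MA (a.T_inf l)) (subalg MH (h.T_inf l))"
    and l: "1 \<le> l" "l \<le> i" and v: "v \<in> cocycles MA \<inter> grade MA l" "f v \<in> subalg MH (h.T_inf l)"
  shows "v \<in> subalg MA (a.T_inf l)"
proof -
  let ?N = "subalg MA (a.T_inf l)"
  have N: "a.M.subsp ?N" by (rule a.M.subalg_subsp[OF a.T_inf_closed])
  have vg: "v \<in> grade MA l" and vZ: "v \<in> cocycles MA" using v(1) by auto
  obtain n where n: "n \<in> ?N" "n \<in> grade MA l" "f n = f v"
    using homogeneous_preimage[OF bij a.homogeneous_T_inf vg v(2)] by blast
  note nc = a.M.grade_closed[OF n(2)] and vc = a.M.grade_closed[OF vg]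
  have "f (dif MA n) = f \<zero>\<^bsub>MA\<^esub>"
    using f.dif[OF nc] f.dif[OF vc] n(3) a.M.cocyclesD(2)[OF vZ] by simp
  then have "dif MA n = \<zero>\<^bsub>MA\<^esub>"
    using bij a.dif_subalg_T_inf[OF n(1)] a.M.subspD(2)[OF N] by (meson bij_betw_def inj_onD)
  then have nZ: "n \<in> cocycles MA" using nc by (simp add: cocycles_def)
  have "f (v \<ominus>\<^bsub>MA\<^esub> n) = \<zero>\<^bsub>MH\<^esub>" using n(3) nc vc by simp
  then have "\<psi> (v \<ominus>\<^bsub>MA\<^esub> n) = \<zero>\<^bsub>HM\<^esub>" using f_psi[of "v \<ominus>\<^bsub>MA\<^esub> n"] nc vc by simp
  then have "v \<ominus>\<^bsub>MA\<^esub> n \<in> ?N"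
    using psi_kernel_in_stage[OF l] a.M.subspD(6)[OF a.M.subsp_cocycles vZ nZ] a.M.grade_minus[OF vg n(2)] by blast
  then have "(v \<ominus>\<^bsub>MA\<^esub> n) \<oplus>\<^bsub>MA\<^esub> n \<in> ?N" using n(1) by (rule subalg.add)
  then show ?thesis using a.M.minus_add_cancel[OF vc nc] by simp
qed

text \<open>For a homogeneous stage element \<open>n\<close> with \<open>f n = f v\<close>,
  injectivity on the stage gives \<open>dif MA n = dif MA v\<close>. So \<open>v - n\<close> is a
  cocycle of degree \<open>l\<close>, and all of these are already in the stage.\<close>

lemma inj_mod_stage_Suc:
  assumes bij: "bij_betw f (subalg MA (a.T (Suc l) j)) (subalg MH (h.T (Suc l) j))"
    and l: "1 \<le> l" "l \<le> i" and v: "v \<in> grade MA l" "dif MA v \<in> subalg MA (a.T (Suc l) j)"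
    and fv: "f v \<in> subalg MH (h.T (Suc l) j)"
  shows "v \<in> subalg MA (a.T (Suc l) j)"
proof -
  let ?N = "subalg MA (a.T (Suc l) j)"
  have N: "a.M.subsp ?N" by (rule a.M.subalg_subsp[OF a.T_closed])
  obtain n where n: "n \<in> ?N" "n \<in> grade MA l" "f n = f v"
    using homogeneous_preimage[OF bij a.homogeneous_T v(1) fv] by blast
  note nc = a.M.grade_closed[OF n(2)] and vc = a.M.grade_closed[OF v(1)]
  have "f (dif MA n) = f (dif MA v)"
    using f.dif[OF nc] f.dif[OF vc] n(3) by simp
  then have "dif MA n = dif MA v"
    using bij a.dif_subalg_T[OF n(1)] v(2) by (meson bij_betw_def inj_onD)
  then have "v \<ominus>\<^bsub>MA\<^esub> n \<in> cocycles MA" using nc vc by (simp add: cocycles_def)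
  then have "v \<ominus>\<^bsub>MA\<^esub> n \<in> ?N"
    using a.cocycle_in_T[OF l] a.M.grade_minus[OF v(1) n(2)] by blast
  then have "(v \<ominus>\<^bsub>MA\<^esub> n) \<oplus>\<^bsub>MA\<^esub> n \<in> ?N" using n(1) by (rule subalg.add)
  then show ?thesis using a.M.minus_add_cancel[OF vc nc] by simp
qed

text \<open>The \<open>x\<close>-step for \<open>l\<close>: here the relevant quotient consists of
  the cocycles of degree \<open>l\<close> modulo the stage, and its dimension is the invariant with
  \<open>j = 0\<close>.\<close>

lemma bij_stage_0:
  assumes bij: "bij_betw f (subalg MA (a.T_inf l)) (subalg MH (h.T_inf l))" and l: "1 \<le> l" "l \<le> i"
  shows "bij_betw f (subalg MA (a.T (Suc l) 0)) (subalg MH (h.T (Suc l) 0))"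
proof -
  let ?V = "cocycles MA \<inter> grade MA l" and ?V' = "cocycles MH \<inter> grade MH l"
  let ?N = "subalg MA (a.T_inf l)" and ?N' = "subalg MH (h.T_inf l)"
  obtain degH where free: "freely_generated MH h.S degH" using h.S_free by blast
  have V: "a.M.subsp ?V" by (rule a.M.subsp_Int[OF a.M.subsp_cocycles a.M.grade_subspace])
  have V': "h.M.subsp ?V'" by (rule h.M.subsp_Int[OF h.M.subsp_cocycles h.M.grade_subspace])
  have N: "a.M.subsp ?N" by (rule a.M.subalg_subsp[OF a.T_inf_closed])
  have N': "h.M.subsp ?N'" by (rule h.M.subalg_subsp[OF h.T_inf_closed])
  have X: "X l \<subseteq> ?V" using a.X_cocycles a.run.X_grade by blast
  have X': "XH l \<subseteq> ?V'" using h.X_cocycles h.run.X_grade by blast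
  have fin: "finite (X l)" "finite (XH l)" by (rule a.finite_X[OF finite_A]) (rule h.finite_X[OF finite_HM])
  have span: "?V \<subseteq> lspan MA (X l \<union> ?N)" using a.cocycle_decomposition[OF l] by blast
  have span': "?V' \<subseteq> lspan MH (XH l \<union> ?N')" using h.cocycle_decomposition[OF l] by blast
  have fV: "f ` ?V \<subseteq> ?V'" using f.cocycle f.grade by blast
  have fN: "f ` ?N \<subseteq> ?N'" using bij by (auto simp: bij_betw_def)
  note inj = inj_mod_stage_0[OF bij l]
  have dim: "vectorspace.dim QQ (quotient_module MA ?V (?V \<inter> ?N)) =
      vectorspace.dim QQ (quotient_module MH ?V' (?V' \<inter> ?N'))"
    using num_inv_eq[OF l, of 0] by (simp only: a.num_inv_0[OF l] h.num_inv_0[OF l])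
  have "bij_betw f (subalg MA (a.T_inf l \<union> X l)) (subalg MH (h.T_inf l \<union> XH l))"
  proof (rule f.bij_extend_stage[OF free a.homogeneous_T_inf h.T_inf_subset_S bij V Int_lower2 fV X span X' span'])
    show "XH l \<subseteq> h.S" by (auto simp: h.S_def)
    show "v \<in> ?N" if "v \<in> ?V" "f v \<in> ?N'" for v using inj that .
    show "\<exists>x\<in>?V. x' \<ominus>\<^bsub>MH\<^esub> f x \<in> ?N'" if "x' \<in> ?V'" for x'
      using quotient_dim_surj[OF f.rat_linear_axioms V N V' N' fV fN inj fin(1) X
          a.M.lspan_modular[OF V N X span] fin(2) X' h.M.lspan_modular[OF V' N' X' span'] dim that] .
  qed
  then show ?thesis by (simp add: a.T_0 h.T_0 a.gens_below_Suc h.gens_below_Suc)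
qed

text \<open>Iteration \<open>j\<close> of the \<open>y\<close>-step for \<open>l + 1\<close>; its
  generators span the quotient whose dimension is the invariant of index
  \<open>j + 1\<close>.\<close>

lemma bij_stage_Suc:
  assumes bij: "bij_betw f (subalg MA (a.T (Suc l) j)) (subalg MH (h.T (Suc l) j))" and l: "1 \<le> l" "l \<le> i"
  shows "bij_betw f (subalg MA (a.T (Suc l) (Suc j))) (subalg MH (h.T (Suc l) (Suc j)))"
proof -
  let ?N = "subalg MA (a.T (Suc l) j)" and ?N' = "subalg MH (h.T (Suc l) j)"
  let ?V = "{x \<in> grade MA l. dif MA x \<in> ?N}" and ?V' = "{x \<in> grade MH l. dif MH x \<in> ?N'}"
  let ?Y = "Y (Suc l) j" and ?Y' = "YH (Suc l) j"
  obtain degH where free: "freely_generated MH h.S degH" using h.S_free by blast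
  have N: "a.M.subsp ?N" by (rule a.M.subalg_subsp[OF a.T_closed])
  have N': "h.M.subsp ?N'" by (rule h.M.subalg_subsp[OF h.T_closed])
  have V: "a.M.subsp ?V" by (rule a.M.dif.subsp_vimage[OF a.M.grade_subspace N])
  have V': "h.M.subsp ?V'" by (rule h.M.dif.subsp_vimage[OF h.M.grade_subspace N'])
  have Y: "?Y \<subseteq> ?V" using a.run.Y_grade[of "Suc l" j] a.dif_Y by auto
  have Y': "?Y' \<subseteq> ?V'" using h.run.Y_grade[of "Suc l" j] h.dif_Y by auto
  have fin: "finite ?Y" "finite ?Y'"
    by (rule a.finite_Y[OF a.finite_gens(2)[OF finite_A]]) (rule h.finite_Y[OF h.finite_gens(2)[OF finite_HM]])
  have span: "?V \<subseteq> lspan MA (?Y \<union> ?N)" using a.Y_step_decomposition[OF l] by blast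
  have span': "?V' \<subseteq> lspan MH (?Y' \<union> ?N')" using h.Y_step_decomposition[OF l] by blast
  have fN: "f ` ?N \<subseteq> ?N'" using bij by (auto simp: bij_betw_def)
  have fV: "f ` ?V \<subseteq> ?V'"
  proof
    fix y assume "y \<in> f ` ?V"
    then obtain x where x: "x \<in> grade MA l" "dif MA x \<in> ?N" "y = f x" by blast
    then show "y \<in> ?V'" using f.grade[OF x(1)] fN f.dif[OF a.M.grade_closed[OF x(1)]] by auto
  qed
  have inj: "v \<in> ?N" if "v \<in> ?V" "f v \<in> ?N'" for v using inj_mod_stage_Suc[OF bij l] that by blast
  have dim: "vectorspace.dim QQ (quotient_module MA ?V (?V \<inter> ?N)) =
      vectorspace.dim QQ (quotient_module MH ?V' (?V' \<inter> ?N'))"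
    using num_inv_eq[OF l, of "Suc j"] by (simp only: a.num_inv_Suc[OF l] h.num_inv_Suc[OF l])
  have "bij_betw f (subalg MA (a.T (Suc l) j \<union> ?Y)) (subalg MH (h.T (Suc l) j \<union> ?Y'))"
  proof (rule f.bij_extend_stage[OF free a.homogeneous_T h.T_subset_S bij V _ fV Y span Y' span'])
    show "?V \<subseteq> grade MA l" by blast
    show "?Y' \<subseteq> h.S" by (auto simp: h.S_def)
    show "v \<in> ?N" if "v \<in> ?V" "f v \<in> ?N'" for v using inj that .
    show "\<exists>x\<in>?V. x' \<ominus>\<^bsub>MH\<^esub> f x \<in> ?N'" if "x' \<in> ?V'" for x'
      using quotient_dim_surj[OF f.rat_linear_axioms V N V' N' fV fN inj fin(1) Y
          a.M.lspan_modular[OF V N Y span] fin(2) Y' h.M.lspan_modular[OF V' N' Y' span'] dim that] .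
  qed
  then show ?thesis by (simp add: a.T_Suc h.T_Suc)
qed

lemma bij_stage_inf:
  assumes "\<And>j. bij_betw f (subalg MA (a.T k j)) (subalg MH (h.T k j))"
  shows "bij_betw f (subalg MA (a.T_inf k)) (subalg MH (h.T_inf k))"
  unfolding a.subalg_T_inf h.subalg_T_inf
proof (rule bij_betw_UNION_chain)
  show "subalg MA (a.T k j) \<subseteq> subalg MA (a.T k j') \<or> subalg MA (a.T k j') \<subseteq> subalg MA (a.T k j)" for j j'
    using subalg_mono[OF a.T_mono[of j j' k], of MA] subalg_mono[OF a.T_mono[of j' j k], of MA] by linarith
qed (rule assms)

lemma subalg_empty: "subalg MA {} = range (\<lambda>c. c \<odot>\<^bsub>MA\<^esub> \<one>\<^bsub>MA\<^esub>)"
proof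
  show "subalg MA {} \<subseteq> range (\<lambda>c. c \<odot>\<^bsub>MA\<^esub> \<one>\<^bsub>MA\<^esub>)"
  proof
    fix x assume "x \<in> subalg MA {}"
    then show "x \<in> range (\<lambda>c. c \<odot>\<^bsub>MA\<^esub> \<one>\<^bsub>MA\<^esub>)"
    proof induction
      case one
      then show ?case by (intro range_eqI[of _ _ 1]) simp
    next
      case (smult x c)
      then obtain b where "x = b \<odot>\<^bsub>MA\<^esub> \<one>\<^bsub>MA\<^esub>" by blast
      then show ?case by (intro range_eqI[of _ _ "c * b"]) (simp add: a.M.smult_smult)
    next
      case (add x y)
      then obtain b c where "x = b \<odot>\<^bsub>MA\<^esub> \<one>\<^bsub>MA\<^esub>" "y = c \<odot>\<^bsub>MA\<^esub> \<one>\<^bsub>MA\<^esub>" by blast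
      then show ?case by (intro range_eqI[of _ _ "b + c"]) (simp add: a.M.smult_add_left)
    next
      case (mult x y)
      then obtain b c where "x = b \<odot>\<^bsub>MA\<^esub> \<one>\<^bsub>MA\<^esub>" "y = c \<odot>\<^bsub>MA\<^esub> \<one>\<^bsub>MA\<^esub>" by blast
      then show ?case
        by (intro range_eqI[of _ _ "b * c"]) (simp add: a.M.smult_smult a.M.smult_mult_left)
    qed simp
  qed
qed (auto intro: subalg.one subalg.smult)

text \<open>Both sides consist of the scalar multiples of the unit. The unit of \<open>MH\<close> is
  nonzero because \<open>\<phi>H\<close> maps it to the unit of the cohomology, which is
  nonzero.\<close>

lemma bij_stage_empty: "bij_betw f (subalg MA {}) (subalg MH {})"
  unfolding bij_betw_def
proof
  have one: "\<one>\<^bsub>MH\<^esub> \<noteq> \<zero>\<^bsub>MH\<^esub>"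
  proof
    assume "\<one>\<^bsub>MH\<^esub> = \<zero>\<^bsub>MH\<^esub>"
    then have "\<phi>H \<one>\<^bsub>MH\<^esub> = \<phi>H \<zero>\<^bsub>MH\<^esub>" by simp
    then show False using h.one_neq_zero h.phi.one h.phi.zero by metis
  qed
  show "inj_on f (subalg MA {})"
    unfolding subalg_empty
  proof (rule inj_onI, elim rangeE)
    fix x y b c assume *: "f x = f y" "x = b \<odot>\<^bsub>MA\<^esub> \<one>\<^bsub>MA\<^esub>" "y = c \<odot>\<^bsub>MA\<^esub> \<one>\<^bsub>MA\<^esub>"
    then have eq: "b \<odot>\<^bsub>MH\<^esub> \<one>\<^bsub>MH\<^esub> = c \<odot>\<^bsub>MH\<^esub> \<one>\<^bsub>MH\<^esub>" by simp
    have "(b + (- 1) * c) \<odot>\<^bsub>MH\<^esub> \<one>\<^bsub>MH\<^esub> = b \<odot>\<^bsub>MH\<^esub> \<one>\<^bsub>MH\<^esub> \<oplus>\<^bsub>MH\<^esub> (- 1) \<odot>\<^bsub>MH\<^esub> (c \<odot>\<^bsub>MH\<^esub> \<one>\<^bsub>MH\<^esub>)"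
      using h.M.smult_add_left[of "\<one>\<^bsub>MH\<^esub>" b "(- 1) * c"] h.M.smult_smult[of "\<one>\<^bsub>MH\<^esub>" "- 1" c] by simp
    also have "\<dots> = \<zero>\<^bsub>MH\<^esub>"
      unfolding eq using h.M.minus_eq_add_smult[of "c \<odot>\<^bsub>MH\<^esub> \<one>\<^bsub>MH\<^esub>" "c \<odot>\<^bsub>MH\<^esub> \<one>\<^bsub>MH\<^esub>"] by simp
    finally have "b = c" using one h.M.smult_eq_zero_iff[of "\<one>\<^bsub>MH\<^esub>" "b + (- 1) * c"] by simp
    then show "x = y" using * by simp
  qed
  show "f ` subalg MA {} = subalg MH {}"
  proof
    show "f ` subalg MA {} \<subseteq> subalg MH {}" using f.subalg_image[of "{}"] by auto
    show "subalg MH {} \<subseteq> f ` subalg MA {}"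
    proof
      fix y assume "y \<in> subalg MH {}"
      then show "y \<in> f ` subalg MA {}"
      proof induction
        case one
        then show ?case by (intro image_eqI[of _ _ "\<one>\<^bsub>MA\<^esub>"]) (auto intro: subalg.one)
      next
        case (smult y c)
        then obtain x where x: "x \<in> subalg MA {}" "y = f x" by blast
        then show ?case using a.M.subalg_closed[OF x(1)]
          by (intro image_eqI[of _ _ "c \<odot>\<^bsub>MA\<^esub> x"]) (auto intro: subalg.smult)
      next
        case (add y z)
        then obtain x w where x: "x \<in> subalg MA {}" "y = f x" "w \<in> subalg MA {}" "z = f w" by blast
        then show ?case using a.M.subalg_closed[OF x(1)] a.M.subalg_closed[OF x(3)]
          by (intro image_eqI[of _ _ "x \<oplus>\<^bsub>MA\<^esub> w"]) (auto intro: subalg.add)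
      next
        case (mult y z)
        then obtain x w where x: "x \<in> subalg MA {}" "y = f x" "w \<in> subalg MA {}" "z = f w" by blast
        then show ?case using a.M.subalg_closed[OF x(1)] a.M.subalg_closed[OF x(3)]
          by (intro image_eqI[of _ _ "x \<otimes>\<^bsub>MA\<^esub> w"]) (auto intro: subalg.mult)
      qed simp
    qed
  qed
qed

text \<open>Degree by degree: the \<open>x\<close>-step for a degree is followed by the iterations
  of the next \<open>y\<close>-step and their union. For \<open>l = i\<close> the stage is the whole
  model.\<close>

lemma bij_T_inf: "l \<le> i \<Longrightarrow> bij_betw f (subalg MA (a.T_inf (Suc l))) (subalg MH (h.T_inf (Suc l)))"
proof (induction l)
  case 0
  then show ?case
    using bij_stage_empty a.T_1_empty h.T_1_empty by (simp add: a.T_inf_eq h.T_inf_eq)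
next
  case (Suc l)
  then have l: "1 \<le> Suc l" "Suc l \<le> i" and bij: "bij_betw f (subalg MA (a.T_inf (Suc l))) (subalg MH (h.T_inf (Suc l)))"
    by auto
  have "bij_betw f (subalg MA (a.T (Suc (Suc l)) j)) (subalg MH (h.T (Suc (Suc l)) j))" for j
    by (induction j) (rule bij_stage_0[OF bij l], rule bij_stage_Suc[OF _ l])
  then show ?case by (rule bij_stage_inf)
qed

lemma bij_f: "bij_betw f (carrier MA) (carrier MH)"
  using bij_T_inf[OF order_refl] by (simp add: a.T_inf_top h.T_inf_top a.carrier_S h.carrier_S)

text \<open>\<open>\<psi>\<close> factors as \<open>\<phi>H\<close> after the bijection
  \<open>f\<close>, so exactness, closedness and degree are all transported back along
  \<open>f\<close>.\<close>

lemma quasi_iso_psi: "quasi_iso i MA HM \<psi>"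
proof -
  interpret p: dga_map MA HM \<psi> using psi_dga_hom by unfold_locales
  have injf: "x = y" if "f x = f y" "x \<in> carrier MA" "y \<in> carrier MA" for x y
    using bij_f that by (auto simp: bij_betw_def inj_on_def)
  have surjf: "\<exists>x\<in>carrier MA. y = f x" if "y \<in> carrier MH" for y
    using bij_f that by (auto simp: bij_betw_def)
  have inj: "inj_on (coh_map HM \<psi>) (coh MA j)" if j: "j \<le> Suc i" for j
  proof (rule p.coh_map_inj_onI)
    fix z assume z: "z \<in> cocycles MA" "z \<in> grade MA j" "\<psi> z \<in> coboundaries HM"
    note zc = a.M.cocyclesD(1)[OF z(1)]
    have "\<phi>H (f z) \<in> coboundaries HM" using f_psi[OF zc] z(3) by simp
    then have "f z \<in> coboundaries MH" using h.inj_coh[OF j] f.cocycle[OF z(1)] f.grade[OF z(2)] by blast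
    then obtain u where u: "u \<in> carrier MH" "f z = dif MH u" by (auto simp: coboundaries_def)
    obtain w where w: "w \<in> carrier MA" "u = f w" using surjf[OF u(1)] by blast
    have "f z = f (dif MA w)" using u(2) w f.dif[OF w(1)] by simp
    then have "z = dif MA w" using injf zc w(1) by simp
    then show "z \<in> coboundaries MA" using w(1) by (auto simp: coboundaries_def)
  qed
  have surj: "coh_map HM \<psi> ` coh MA j = coh HM j" if j: "j \<le> i" for j
  proof
    show "coh_map HM \<psi> ` coh MA j \<subseteq> coh HM j"
    proof
      fix e assume "e \<in> coh_map HM \<psi> ` coh MA j"
      then obtain z where z: "z \<in> cocycles MA" "z \<in> grade MA j" "e = coh_map HM \<psi> (coh_class MA z)"
        unfolding a.M.coh_grade by blast
      then show "e \<in> coh HM j"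
        using p.coh_map_class[OF z(1)] p.cocycle[OF z(1)] p.grade[OF z(2)] unfolding h.B.coh_grade by blast
    qed
    show "coh HM j \<subseteq> coh_map HM \<psi> ` coh MA j"
    proof
      fix e assume "e \<in> coh HM j"
      then obtain e' where e': "e' \<in> grade HM j" "e = coh_class HM e'" by (auto simp: h.B.coh_grade)
      obtain c where c: "c \<in> cocycles MH" "c \<in> grade MH j" "\<phi>H c = e'" using phiH_surj[OF j e'(1)] by blast
      \<comment> \<open>The preimage of a homogeneous cocycle is itself homogeneous and closed:
        \<open>f\<close> commutes with components and differentials and is injective.\<close>
      obtain z where z: "z \<in> carrier MA" "c = f z" using surjf h.M.cocyclesD(1)[OF c(1)] by blast
      have "f (component MA j z) = f z"
        using f.component[OF z(1), of j] h.M.component_grade[OF c(2), of j] z(2) by simp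
      then have "component MA j z = z" using injf z(1) by simp
      then have zg: "z \<in> grade MA j" using a.M.component_props(1)[OF z(1), of j] by simp
      have "f (dif MA z) = f \<zero>\<^bsub>MA\<^esub>" using f.dif[OF z(1)] h.M.cocyclesD(2)[OF c(1)] z(2) by simp
      then have zZ: "z \<in> cocycles MA" using injf z(1) by (simp add: cocycles_def)
      have "coh_map HM \<psi> (coh_class MA z) = e"
        using p.coh_map_class[OF zZ] f_psi[OF z(1)] z(2) c(3) e'(2) by simp
      then show "e \<in> coh_map HM \<psi> ` coh MA j"
        unfolding a.M.coh_grade using zZ zg by blast
    qed
  qed
  show ?thesis
    unfolding quasi_iso_def bij_betw_def using psi_dga_hom inj surj by simp
qed

end

theorem lemma4p2:
  fixes A :: "'a dga" and MA :: "'m dga" and MH :: "'n dga"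
    and \<phi>A :: "'m \<Rightarrow> 'a" and \<phi>H :: "'n \<Rightarrow> 'm set" and \<psi> :: "'m \<Rightarrow> 'm set"
    and X :: "nat \<Rightarrow> 'm set" and Y :: "nat \<Rightarrow> nat \<Rightarrow> 'm set"
    and XH :: "nat \<Rightarrow> 'n set" and YH :: "nat \<Rightarrow> nat \<Rightarrow> 'n set"
    and i :: nat
  assumes "differential_algebra A" and "finitely_presented A" and "connected_dga A"
    and "minimal_model i A MA \<phi>A" and "method_run i A MA \<phi>A X Y"
    and "minimal_model i (cohomology MA) MH \<phi>H"
    and "method_run i (cohomology MA) MH \<phi>H XH YH"
    and psi_hom: "\<psi> \<in> alg_hom MA (cohomology MA)"
    and psi_x: "\<And>k x. x \<in> X k \<Longrightarrow> \<psi> x = coh_class MA x"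
    and psi_y: "\<And>k t y. y \<in> Y k t \<Longrightarrow> \<psi> y = \<zero>\<^bsub>cohomology MA\<^esub>"
    and psi_condition:
      "\<And>k t y. \<lbrakk>k \<le> i + 1; y \<in> Y k t\<rbrakk> \<Longrightarrow> \<psi> (dif MA y) = \<zero>\<^bsub>cohomology MA\<^esub>"
    and num_inv_eq:
      "\<And>l j. \<lbrakk>1 \<le> l; l \<le> i\<rbrakk> \<Longrightarrow> num_inv MA l j = num_inv MH l j"
  shows "quasi_iso i MA (cohomology MA) \<psi>"
proof -
  interpret a: model_run i A MA \<phi>A X Y
    using assms(1,4,5) by (intro model_run.intro model_run_axioms.intro) (simp_all add: minimal_model_def)
  interpret h: model_run i "cohomology MA" MH \<phi>H XH YH
    using assms(6,7) a.M.cohomology_differential_algebra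
    by (intro model_run.intro model_run_axioms.intro) (simp_all add: minimal_model_def)
  \<comment> \<open>The bound on \<open>k\<close> in the \<open>\<psi>\<close>-condition is
    automatic, because no \<open>y\<close>-step goes beyond \<open>i + 1\<close>.\<close>
  have psi_z: "\<psi> (dif MA y) = \<zero>\<^bsub>cohomology MA\<^esub>" if "y \<in> Y k t" for y k t
  proof (rule psi_condition[OF _ that])
    have "Y k t \<noteq> {}" using that by blast
    then show "k \<le> i + 1" using a.run.Y_range by fastforce
  qed
  interpret psi_condition i A MA \<phi>A X Y MH \<phi>H XH YH \<psi>
    using psi_hom psi_x psi_y psi_z num_inv_eq a.B.finitely_presented_finite_span_grade[OF assms(2)]
    by unfold_locales
  show ?thesis
  proof (rule lift_exists)
    fix f assume f: "f \<in> dga_hom MA MH" "\<And>x. x \<in> carrier MA \<Longrightarrow> \<phi>H (f x) = \<psi> x"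
    interpret lifted i A MA \<phi>A X Y MH \<phi>H XH YH \<psi> f
      by (intro lifted.intro lifted_axioms.intro psi_condition_axioms f)
    show ?thesis by (rule quasi_iso_psi)
  qed
qed

end
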